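(* Let $\varphi$ be a PEB-spline of order $m\in\mathbb{N}$ supported on $[0,m]$. Assume that $X\subseteq\mathbb{R}$ with multiplicity function $\mu_X$ satisfies the following properties: (i) $X$ is separated. (ii) $S:=\max_{x\in X}\mu_X(x)\le m-1$. (iii) There exist integers $M,L>0$ and $\varepsilon>0$ such that for every $k\in\mathbb{Z}$ there exist points $x_1^k<x_2^k<\dots<x_{N(k)}^k$ in $X\cap[M+kL,M+kL+L)$ and nonnegative integers $\mu_1^k,\mu_2^k,\dots,\mu_{N(k)}^k$ with the following three properties: $$\mu_j^k\le\mu_X(x_j^k)\quad\text{for all }k\in\mathbb{Z},\ 1\le j\le N(k),$$ $$\sum_{j=1}^{N(k)}(1+\mu_j^k)=L+m-1\quad\text{for all }k\in\mathbb{Z},$$ $$x_j^k\in X\cap\Big([\mu_j^k-m+\varepsilon,\,-\varepsilon]+M+kL+1+\sum_{n=1}^{j-1}(1+\mu_n^k)\Big)\quad\text{for all }k\in\mathbb{Z},\ 1\le j\le N(k).$$ Then $(X,\mu_X)$ is a sampling set for $V^p(\varphi)$ for all $p\in[1,\infty]$.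
   Context: PEB-splines. Let $m\in\mathbb{N}=\{1,2,\dots\}$ and $T_yf(x)=f(x-y)$. For $1\le s\le m$ let $\gamma_s\in\mathbb{R}$, let $r_s\in C^{m-s}(\mathbb{R})$ be strictly positive and $1$-periodic, and put $w_s(x)=e^{\gamma_s x}r_s(x)$. Let $u_1=w_1$ and $u_s(x)=w_1(x)\int_0^x w_2(x_2)\int_0^{x_2}w_3(x_3)\cdots\int_0^{x_{s-1}}w_s(x_s)\,dx_s\cdots dx_2$ for $2\le s\le m$, and $\mathcal{U}_m=\mathrm{span}_{\mathbb{C}}(u_1,\dots,u_m)$. The periodic exponential B-spline (PEB-spline) of order $m$ for these weights is the function $\varphi:\mathbb{R}\to\mathbb{R}$, unique up to a positive scalar factor, with $\varphi\in C^{m-2}(\mathbb{R})$ (no condition if $m=1$), $\mathrm{supp}\,\varphi=[0,m]$, $\varphi>0$ on $(0,m)$, and whose restriction to each interval $(\ell,\ell+1)$, $\ell\in\mathbb{Z}$, is the restriction of an element of $\mathcal{U}_m$. The function $\varphi^{(m-1)}$ may jump at integers; values of the $(m-1)$-th derivative of $\varphi$ (and of functions in $V^p(\varphi)$) at integers are right-sided limits (for $m=1$, up to a factor, $\varphi=w_1\chi_{[0,1)}$). Shift-invariant space: $V^p(\varphi)=\{\sum_{\ell\in\mathbb{Z}}c_\ell\varphi(\cdot-\ell):(c_\ell)\in\ell^p(\mathbb{Z})\}\subseteq L^p(\mathbb{R})$. Sampling: $X$ is separated if $\inf_{x\ne y\in X}|x-y|>0$. A multiplicity function assigns to each $x\in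 X$ a nonnegative integer $\mu_X(x)$. $(X,\mu_X)$ is a sampling set for $V^p(\varphi)$ if there are constants $A_p,B_p>0$ with $A_p\|f\|_p^p\le\sum_{x\in X}\sum_{s=0}^{\mu_X(x)}|f^{(s)}(x)|^p\le B_p\|f\|_p^p$ for all $f\in V^p(\varphi)$ (with suprema in place of sums if $p=\infty$). *)

theory Defs
  imports "HOL-Analysis.Analysis" "HOL-Probability.Essential_Supremum"
begin

definition iter_deriv :: "nat \<Rightarrow> (real \<Rightarrow> 'a::real_normed_vector) \<Rightarrow> real \<Rightarrow> 'a" where
  "iter_deriv s = (\<lambda>g x. vector_derivative g (at x)) ^^ s"

definition C_class :: "nat \<Rightarrow> (real \<Rightarrow> 'a::real_normed_vector) \<Rightarrow> bool" where
  "C_class n f \<longleftrightarrow>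
     (\<forall>i<n. \<forall>x. iter_deriv i f differentiable (at x)) \<and> continuous_on UNIV (iter_deriv n f)"

definition peb_weight :: "(nat \<Rightarrow> real) \<Rightarrow> (nat \<Rightarrow> real \<Rightarrow> real) \<Rightarrow> nat \<Rightarrow> real \<Rightarrow> real" where
  "peb_weight \<gamma> r s x = exp (\<gamma> s * x) * r s x"

definition peb_weight_data :: "nat \<Rightarrow> (nat \<Rightarrow> real \<Rightarrow> real) \<Rightarrow> bool" where
  "peb_weight_data m r \<longleftrightarrow>
     (\<forall>s\<in>{1..m}. C_class (m - s) (r s) \<and> (\<forall>x. 0 < r s x) \<and> (\<forall>x. r s (x + 1) = r s x))"

(* iter_integral w j k x is the k-fold integral
     int_0^x w_j(x_j) int_0^(x_j) w_(j+1)(x_(j+1)) ... dx_(j+k-1) ... dx_j,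
   with integrals oriented (the sign changes when the upper limit is negative). *)
fun iter_integral :: "(nat \<Rightarrow> real \<Rightarrow> real) \<Rightarrow> nat \<Rightarrow> nat \<Rightarrow> real \<Rightarrow> real" where
  "iter_integral w j 0 x = 1"
| "iter_integral w j (Suc k) x = (LBINT t=0..ereal x. w j t * iter_integral w (Suc j) k t)"

definition peb_u :: "(nat \<Rightarrow> real \<Rightarrow> real) \<Rightarrow> nat \<Rightarrow> real \<Rightarrow> real" where
  "peb_u w s x = w 1 x * iter_integral w 2 (s - 1) x"

definition peb_space :: "nat \<Rightarrow> (nat \<Rightarrow> real \<Rightarrow> real) \<Rightarrow> (real \<Rightarrow> complex) set" where
  "peb_space m w =
     {g. \<exists>a :: nat \<Rightarrow> complex. g = (\<lambda>x. \<Sum>s=1..m. a s * complex_of_real (peb_u w s x))}"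

(* The last clause is the convention that values of the (m-1)-th derivative at integers are
   right-sided limits; for m = 1 this concerns the spline itself and makes it equal to a
   positive multiple of w_1 on [0,1) and 0 elsewhere. *)
definition peb_spline :: "nat \<Rightarrow> (nat \<Rightarrow> real) \<Rightarrow> (nat \<Rightarrow> real \<Rightarrow> real) \<Rightarrow> (real \<Rightarrow> real) \<Rightarrow> bool" where
  "peb_spline m \<gamma> r \<phi> \<longleftrightarrow>
     (2 \<le> m \<longrightarrow> C_class (m - 2) \<phi>) \<and>
     closure {x. \<phi> x \<noteq> 0} = {0..real m} \<and>
     (\<forall>x\<in>{0<..<real m}. 0 < \<phi> x) \<and>
     (\<forall>l::int. \<exists>g\<in>peb_space m (peb_weight \<gamma> r).
        \<forall>x\<in>{of_int l<..<of_int l + 1}. complex_of_real (\<phi> x) = g x) \<and>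
     (m = 1 \<longrightarrow> (\<forall>l::int. continuous (at_right (of_int l)) \<phi>))"

definition lp_seq :: "ennreal \<Rightarrow> (int \<Rightarrow> complex) \<Rightarrow> bool" where
  "lp_seq p c \<longleftrightarrow>
     (if p = \<infinity> then bounded (range c)
      else (\<lambda>l. norm (c l) powr enn2real p) summable_on UNIV)"

(* Elements are kept as pointwise functions rather than almost-everywhere classes, since they
   are sampled; the series has finitely many nonzero terms at each point when the generator
   has compact support. *)
definition shift_inv_space :: "ennreal \<Rightarrow> (real \<Rightarrow> real) \<Rightarrow> (real \<Rightarrow> complex) set" where
  "shift_inv_space p \<phi> =
     {f. \<exists>c. lp_seq p c \<and>
        f = (\<lambda>x. \<Sum>\<^sub>\<infinity>l\<in>UNIV. c l * complex_of_real (\<phi> (x - of_int l)))}"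

definition sample_deriv :: "nat \<Rightarrow> nat \<Rightarrow> (real \<Rightarrow> complex) \<Rightarrow> real \<Rightarrow> complex" where
  "sample_deriv m s f x =
     (if s = m - 1 \<and> x \<in> \<int> then Lim (at_right x) (iter_deriv s f) else iter_deriv s f x)"

(* For finite p these are the p-th powers of the norms; for p = \<infinity> the sup norms. *)
definition Lp_power :: "ennreal \<Rightarrow> (real \<Rightarrow> complex) \<Rightarrow> ennreal" where
  "Lp_power p f =
     (if p = \<infinity> then esssup lborel (\<lambda>x. ennreal (norm (f x)))
      else \<integral>\<^sup>+x. ennreal (norm (f x) powr enn2real p) \<partial>lborel)"

definition sample_power ::
  "nat \<Rightarrow> ennreal \<Rightarrow> real set \<Rightarrow> (real \<Rightarrow> nat) \<Rightarrow> (real \<Rightarrow> complex) \<Rightarrow> ennreal" where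
  "sample_power m p X \<mu> f =
     (if p = \<infinity> then SUP x\<in>X. SUP s\<in>{0..\<mu> x}. ennreal (norm (sample_deriv m s f x))
      else \<Sum>\<^sub>\<infinity>x\<in>X. \<Sum>s=0..\<mu> x. ennreal (norm (sample_deriv m s f x) powr enn2real p))"

definition sampling_set ::
  "nat \<Rightarrow> (real \<Rightarrow> real) \<Rightarrow> ennreal \<Rightarrow> real set \<Rightarrow> (real \<Rightarrow> nat) \<Rightarrow> bool" where
  "sampling_set m \<phi> p X \<mu> \<longleftrightarrow>
     (\<exists>A B :: real. 0 < A \<and> 0 < B \<and>
       (\<forall>f\<in>shift_inv_space p \<phi>.
          ennreal A * Lp_power p f \<le> sample_power m p X \<mu> f \<and>
          sample_power m p X \<mu> f \<le> ennreal B * Lp_power p f))"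

end

theory Submission
  imports Defs
begin

text \<open>On each window of \<open>L\<close> cells exactly \<open>L + m - 1\<close> translates of \<open>\<phi>\<close> are active, as many as there
  are samples, and condition (iii) places the samples, with multiplicity, strictly inside the supports
  of the corresponding translates. By a Schoenberg--Whitney argument the square system is injective:
  the spline is divided by \<open>w\<^sub>1\<close>, differentiated, divided by \<open>w\<^sub>2\<close>, and so on, which by Rolle turns zeros
  into sign changes of a function that is constant on cells, and there are too few cells. The
  margin \<open>\<epsilon>\<close> and the separation of \<open>X\<close> confine the configurations to a compact set on which the system
  depends continuously (a jump of the \<open>(m - 1)\<close>-st derivative is never met), so the inverses are
  uniformly bounded; this gives the lower bound. The upper bound is local: one cell with
  \<open>m\<close> equispaced simple nodes is another such system, and averaging over translates of the nodes bounds
  the active coefficients by the \<open>L\<^sup>p\<close>-norm on the cell.\<close>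

section \<open>Smooth functions and orders of vanishing\<close>

text \<open>Number the samples of a window from 1 to \<open>n = L + m - 1\<close>, node
  \<open>j\<close> with its \<open>1 + \<nu> j\<close> samples taking the block
  \<open>\<sigma> j + 1\<close>, ..., \<open>\<sigma> j + 1 + \<nu> j\<close>, and pair number
  \<open>q\<close> with the translate supported on \<open>[q - m, q]\<close>. The node is inside the
  supports of all translates of its block iff
  \<open>\<sigma> j + \<nu> j + 1 - m < x j < \<sigma> j + 1\<close>, which is (iii) without the
  margin. On a run \<open>[a, b]\<close> of cells this yields at least \<open>b - a - m + 1\<close>
  zeros. Each of the \<open>m - 1\<close> weighted differentiations gains one sign change from the
  zeros at the two ends, and a function constant on \<open>b - a\<close> cells changes sign at most
  \<open>b - a - 1\<close> times, so only \<open>b - a - m\<close> zeros fit. Two obstacles shape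
  the argument. Zeros need not be isolated or accompanied by a sign change, so a count mixing both
  is propagated. The last weighted derivative jumps at integers, so Rolle's step is obtained by
  integration, and a node with a zero of full order \<open>m\<close> is treated apart: it lies in an
  open cell, where it would force the combination to vanish. One constant serves all windows because
  moving a window to the origin only re-indexes the coefficients.\<close>

fun Ck :: "nat \<Rightarrow> real set \<Rightarrow> (real \<Rightarrow> 'a::real_normed_vector) \<Rightarrow> bool" where
  "Ck 0 S f \<longleftrightarrow> continuous_on S f"
| "Ck (Suc n) S f \<longleftrightarrow>
     (\<forall>x\<in>S. f differentiable (at x)) \<and> Ck n S (\<lambda>x. vector_derivative f (at x))"

definition flat :: "nat \<Rightarrow> (real \<Rightarrow> 'a::real_normed_vector) \<Rightarrow> real \<Rightarrow> bool" where
  "flat k f x \<longleftrightarrow> (\<forall>i<k. iter_deriv i f x = 0)"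

lemma iter_deriv_0 [simp]: "iter_deriv 0 f = f"
  by (simp add: iter_deriv_def)

lemma iter_deriv_Suc: "iter_deriv (Suc s) f = iter_deriv s (\<lambda>x. vector_derivative f (at x))"
  by (simp add: iter_deriv_def funpow_Suc_right del: funpow.simps)

lemma iter_deriv_Suc': "iter_deriv (Suc s) f = (\<lambda>x. vector_derivative (iter_deriv s f) (at x))"
  by (simp add: iter_deriv_def)

lemma has_vector_derivative_cong_open:
  assumes "open S" "x \<in> S" "\<And>y. y \<in> S \<Longrightarrow> f y = g y"
  shows "(f has_vector_derivative D) (at x) \<longleftrightarrow> (g has_vector_derivative D) (at x)"
  using assms by (metis has_vector_derivative_transform_within_open)

lemma vector_derivative_cong_open:
  assumes "open S" "x \<in> S" "\<And>y. y \<in> S \<Longrightarrow> f y = g y"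
  shows "vector_derivative f (at x) = vector_derivative g (at x)"
  unfolding vector_derivative_def using has_vector_derivative_cong_open[OF assms] by presburger

lemma differentiable_cong_open:
  assumes "open S" "x \<in> S" "\<And>y. y \<in> S \<Longrightarrow> (f :: real \<Rightarrow> 'a::real_normed_vector) y = g y"
  shows "f differentiable (at x) \<longleftrightarrow> g differentiable (at x)"
proof -
  have *: "h differentiable (at x) \<longleftrightarrow> (\<exists>D. (h has_vector_derivative D) (at x))" for h :: "real \<Rightarrow> 'a"
    using differentiableI_vector vector_derivative_works by blast
  show ?thesis unfolding * using has_vector_derivative_cong_open[OF assms] by presburger
qed

lemma iter_deriv_cong_open:
  assumes "open S" "x \<in> S" "\<And>y. y \<in> S \<Longrightarrow> f y = g y"
  shows "iter_deriv s f x = iter_deriv s g x"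
  using assms(2,3)
proof (induction s arbitrary: f g x)
  case (Suc s)
  show ?case unfolding iter_deriv_Suc
    by (intro Suc.IH vector_derivative_cong_open[OF assms(1)] Suc.prems)
qed simp

lemma Ck_cong:
  assumes "open S" "\<And>y. y \<in> S \<Longrightarrow> f y = g y"
  shows "Ck n S f \<longleftrightarrow> Ck n S g"
  using assms(2)
proof (induction n arbitrary: f g)
  case (Suc n)
  have "Ck n S (\<lambda>x. vector_derivative f (at x)) = Ck n S (\<lambda>x. vector_derivative g (at x))"
    by (intro Suc.IH vector_derivative_cong_open[OF assms(1)] Suc.prems)
  then show ?case
    using differentiable_cong_open[OF assms(1) _ Suc.prems] by simp
qed (simp cong: continuous_on_cong)

lemma Ck_subset: "Ck n S f \<Longrightarrow> T \<subseteq> S \<Longrightarrow> Ck n T f"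
  by (induction n arbitrary: f) (auto intro: continuous_on_subset)

lemma Ck_SucD: "Ck (Suc n) S f \<Longrightarrow> Ck n S f"
proof (induction n arbitrary: f)
  case 0
  then show ?case
    by (metis Ck.simps differentiable_at_withinI differentiable_imp_continuous_on differentiable_on_def)
qed auto

lemma Ck_le: "Ck n S f \<Longrightarrow> k \<le> n \<Longrightarrow> Ck k S f"
  by (induction n) (simp_all add: le_Suc_eq del: Ck.simps, metis Ck_SucD)

lemma Ck_continuous: "Ck n S f \<Longrightarrow> continuous_on S f"
  using Ck_le[of n S f 0] by simp

lemma Ck_SucI:
  assumes "open S" "\<And>x. x \<in> S \<Longrightarrow> (f has_vector_derivative f' x) (at x)" "Ck n S f'"
  shows "Ck (Suc n) S f"
proof -
  have "Ck n S (\<lambda>x. vector_derivative f (at x)) = Ck n S f'"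
    by (intro Ck_cong assms(1)) (use assms(2) vector_derivative_at in blast)
  then show ?thesis using assms differentiableI_vector by auto
qed

lemma Ck_SucE:
  assumes "Ck (Suc n) S f" "x \<in> S"
  shows "(f has_vector_derivative vector_derivative f (at x)) (at x)"
  using assms by (simp add: vector_derivative_works)

text \<open>The recursive form suits inductions and open subsets; this links it to the form with
  iterated derivatives used by \<open>C_class\<close>.\<close>

lemma Ck_iff_iter_deriv:
  "Ck n S f \<longleftrightarrow> (\<forall>i<n. \<forall>x\<in>S. iter_deriv i f differentiable (at x)) \<and> continuous_on S (iter_deriv n f)"
  by (induction n arbitrary: f) (auto simp: iter_deriv_Suc All_less_Suc2 less_Suc_eq_0_disj)

lemma C_class_iff_Ck: "C_class n f \<longleftrightarrow> Ck n UNIV f"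
  by (simp add: C_class_def Ck_iff_iter_deriv)

lemma continuous_on_iter_deriv: "Ck n S f \<Longrightarrow> s \<le> n \<Longrightarrow> continuous_on S (iter_deriv s f)"
  using Ck_le Ck_iff_iter_deriv by blast

lemma Ck_const: "Ck n S (\<lambda>x. c)"
  by (induction n arbitrary: c) (auto simp: vector_derivative_const_at)

lemma Ck_add:
  assumes S: "open S"
  shows "Ck n S f \<Longrightarrow> Ck n S g \<Longrightarrow> Ck n S (\<lambda>x. f x + g x)"
proof (induction n arbitrary: f g)
  case (Suc n)
  show ?case
    by (rule Ck_SucI[OF S has_vector_derivative_add[OF Ck_SucE[OF Suc.prems(1)] Ck_SucE[OF Suc.prems(2)]]])
      (use Suc in auto)
qed (simp_all add: continuous_on_add continuous_on_scaleR continuous_on_inverse)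

lemma Ck_scaleR:
  fixes f :: "real \<Rightarrow> real"
  assumes S: "open S"
  shows "Ck n S f \<Longrightarrow> Ck n S g \<Longrightarrow> Ck n S (\<lambda>x. f x *\<^sub>R g x)"
proof (induction n arbitrary: f g)
  case (Suc n)
  show ?case
  proof (rule Ck_SucI[OF S])
    show "((\<lambda>x. f x *\<^sub>R g x) has_vector_derivative
       (f x *\<^sub>R vector_derivative g (at x) + vector_derivative f (at x) *\<^sub>R g x)) (at x)" if "x \<in> S" for x
      by (intro has_vector_derivative_scaleR Ck_SucE[OF Suc.prems(2) that])
        (use Ck_SucE[OF Suc.prems(1) that] in \<open>simp add: has_real_derivative_iff_has_vector_derivative\<close>)
    show "Ck n S (\<lambda>x. f x *\<^sub>R vector_derivative g (at x) + vector_derivative f (at x) *\<^sub>R g x)"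
      by (intro Ck_add S Suc.IH Ck_SucD[OF Suc.prems(1)] Ck_SucD[OF Suc.prems(2)])
        (use Suc.prems in auto)
  qed
qed (simp_all add: continuous_on_add continuous_on_scaleR continuous_on_inverse)

lemma Ck_mult:
  fixes f g :: "real \<Rightarrow> real"
  shows "open S \<Longrightarrow> Ck n S f \<Longrightarrow> Ck n S g \<Longrightarrow> Ck n S (\<lambda>x. f x * g x)"
  using Ck_scaleR[of S n f g] by simp

lemma Ck_sum:
  assumes "open S" "\<And>j. j \<in> J \<Longrightarrow> Ck n S (f j)"
  shows "Ck n S (\<lambda>x. \<Sum>j\<in>J. f j x)"
proof (cases "finite J")
  case True
  then show ?thesis using assms(2)
    by (induction J) (simp_all add: Ck_const Ck_add[OF assms(1)] del: Ck.simps)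
qed (simp add: Ck_const)

lemma Ck_inverse:
  fixes f :: "real \<Rightarrow> real"
  assumes S: "open S"
  shows "Ck n S f \<Longrightarrow> (\<And>x. x \<in> S \<Longrightarrow> f x \<noteq> 0) \<Longrightarrow> Ck n S (\<lambda>x. inverse (f x))"
proof (induction n arbitrary: f)
  case (Suc n)
  show ?case
  proof (rule Ck_SucI[OF S])
    show "((\<lambda>x. inverse (f x)) has_vector_derivative
       (-1 * vector_derivative f (at x)) * (inverse (f x) * inverse (f x))) (at x)" if "x \<in> S" for x
      unfolding has_real_derivative_iff_has_vector_derivative[symmetric]
      using DERIV_inverse'[OF Ck_SucE[OF Suc.prems(1) that, folded has_real_derivative_iff_has_vector_derivative]
          Suc.prems(2)[OF that]]
      by (simp add: mult_ac)
    show "Ck n S (\<lambda>x. (-1 * vector_derivative f (at x)) * (inverse (f x) * inverse (f x)))"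
      by (intro Ck_mult S Suc.IH Ck_const Suc.prems(2) Ck_SucD[OF Suc.prems(1)])
        (use Suc.prems(1) in simp_all)
  qed
qed (simp_all add: continuous_on_add continuous_on_scaleR continuous_on_inverse)

lemma Ck_exp: "Ck n S (\<lambda>x. exp (c * x :: real))"
proof -
  have "Ck n UNIV (\<lambda>x. exp (c * x :: real))"
  proof (induction n)
    case (Suc n)
    show ?case
    proof (rule Ck_SucI)
      show "((\<lambda>x. exp (c * x)) has_vector_derivative c * exp (c * x)) (at x)" for x
        unfolding has_real_derivative_iff_has_vector_derivative[symmetric]
        by (auto intro!: derivative_eq_intros)
    qed (auto intro: Ck_mult Ck_const Suc)
  qed (auto intro!: continuous_intros)
  then show ?thesis using Ck_subset by blast
qed

section \<open>Derivatives of translates and of linear combinations\<close>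

lemma has_vector_derivative_shift_iff:
  "((\<lambda>x. f (x - d)) has_vector_derivative D) (at x) \<longleftrightarrow> (f has_vector_derivative D) (at (x - d :: real))"
proof
  have *: "((\<lambda>x. f (x - d)) has_vector_derivative D) (at x)"
    if "(f has_vector_derivative D) (at (x - d))" for f :: "real \<Rightarrow> 'a" and d x
  proof -
    have "((\<lambda>x. x - d) has_vector_derivative 1) (at x)"
      unfolding has_real_derivative_iff_has_vector_derivative[symmetric]
      by (auto intro!: derivative_eq_intros)
    then show ?thesis
      using vector_diff_chain_at[of "\<lambda>x. x - d" 1 x f D] that by (simp add: o_def)
  qed
  show "(f has_vector_derivative D) (at (x - d)) \<Longrightarrow> ((\<lambda>x. f (x - d)) has_vector_derivative D) (at x)"
    by (rule *)
  show "((\<lambda>x. f (x - d)) has_vector_derivative D) (at x) \<Longrightarrow> (f has_vector_derivative D) (at (x - d))"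
    using *[of "\<lambda>x. f (x - d)" "x - d" "-d"] by simp
qed

lemma vector_derivative_shift:
  "vector_derivative (\<lambda>x. f (x - d)) (at x) = vector_derivative f (at (x - d :: real))"
  unfolding vector_derivative_def by (simp add: has_vector_derivative_shift_iff)

lemma iter_deriv_shift: "iter_deriv s (\<lambda>x. f (x - d)) x = iter_deriv s f (x - d)"
proof (induction s arbitrary: f)
  case (Suc s)
  show ?case
    unfolding iter_deriv_Suc vector_derivative_shift by (rule Suc)
qed simp

lemma Ck_shift: "Ck n S f \<Longrightarrow> (\<And>x. x \<in> T \<Longrightarrow> x - d \<in> S) \<Longrightarrow> Ck n T (\<lambda>x. f (x - d))"
proof (induction n arbitrary: f)
  case 0
  then show ?case
    by (auto intro!: continuous_on_compose2[of S f T "\<lambda>x. x - d"] continuous_intros)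
next
  case (Suc n)
  have "(\<lambda>x. f (x - d)) differentiable (at x)" if "x \<in> T" for x
    using Ck_SucE[OF Suc.prems(1) Suc.prems(2)[OF that]] has_vector_derivative_shift_iff
    by (metis differentiableI_vector)
  then show ?case using Suc by (auto simp: vector_derivative_shift)
qed

text \<open>Real functions with vector coefficients cover real and complex combinations of
  translates at once.\<close>

lemma iter_deriv_lincomb:
  fixes g :: "'i \<Rightarrow> real \<Rightarrow> real" and c :: "'i \<Rightarrow> 'a::real_normed_vector"
  assumes S: "open S" and x: "x \<in> S" and g: "\<And>j. j \<in> J \<Longrightarrow> Ck s S (g j)"
  shows "iter_deriv s (\<lambda>x. \<Sum>j\<in>J. g j x *\<^sub>R c j) x = (\<Sum>j\<in>J. iter_deriv s (g j) x *\<^sub>R c j)"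
  using x g
proof (induction s arbitrary: g x)
  case (Suc s)
  have "vector_derivative (\<lambda>x. \<Sum>j\<in>J. g j x *\<^sub>R c j) (at y) = (\<Sum>j\<in>J. vector_derivative (g j) (at y) *\<^sub>R c j)"
    if "y \<in> S" for y
  proof (rule vector_derivative_at)
    have "((\<lambda>x. g j x *\<^sub>R c j) has_vector_derivative vector_derivative (g j) (at y) *\<^sub>R c j) (at y)" if "j \<in> J" for j
      using has_vector_derivative_scaleR[OF
          Ck_SucE[OF Suc.prems(2)[OF that] \<open>y \<in> S\<close>, folded has_real_derivative_iff_has_vector_derivative]
          has_vector_derivative_const] by simp
    then show "((\<lambda>x. \<Sum>j\<in>J. g j x *\<^sub>R c j) has_vector_derivative
        (\<Sum>j\<in>J. vector_derivative (g j) (at y) *\<^sub>R c j)) (at y)"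
      by (rule has_vector_derivative_sum)
  qed
  then have "iter_deriv s (\<lambda>x. vector_derivative (\<lambda>x. \<Sum>j\<in>J. g j x *\<^sub>R c j) (at x)) x
      = iter_deriv s (\<lambda>x. \<Sum>j\<in>J. vector_derivative (g j) (at x) *\<^sub>R c j) x"
    by (intro iter_deriv_cong_open[OF S Suc.prems(1)])
  also have "\<dots> = (\<Sum>j\<in>J. iter_deriv s (\<lambda>x. vector_derivative (g j) (at x)) x *\<^sub>R c j)"
    by (rule Suc.IH) (use Suc.prems in auto)
  finally show ?case by (simp add: iter_deriv_Suc)
qed simp

section \<open>Orders of vanishing under sums and products\<close>

lemma flat_0 [simp]: "flat 0 f x"
  by (simp add: flat_def)

lemma flat_Suc: "flat (Suc k) f x \<longleftrightarrow> f x = 0 \<and> flat k (\<lambda>x. vector_derivative f (at x)) x"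
  by (auto simp: flat_def All_less_Suc2 less_Suc_eq_0_disj iter_deriv_Suc)

lemma flat_le: "flat k f x \<Longrightarrow> l \<le> k \<Longrightarrow> flat l f x"
  by (auto simp: flat_def)

lemma flat_cong:
  assumes "open S" "x \<in> S" "\<And>y. y \<in> S \<Longrightarrow> f y = g y"
  shows "flat k f x \<longleftrightarrow> flat k g x"
  using iter_deriv_cong_open[OF assms] by (simp add: flat_def)

lemma flat_add:
  fixes f g :: "real \<Rightarrow> real"
  assumes "open S" "x \<in> S" "Ck n S f" "Ck n S g" "k \<le> Suc n" "flat k f x" "flat k g x"
  shows "flat k (\<lambda>x. f x + g x) x"
  unfolding flat_def
proof (intro allI impI)
  fix i assume i: "i < k"
  have "Ck i S f" "Ck i S g" using Ck_le assms i by (metis less_Suc_eq_le order_less_le_trans)+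
  \<comment> \<open>The sum is read as a linear combination indexed by the two booleans.\<close>
  then have "iter_deriv i (\<lambda>x. \<Sum>b\<in>{True,False}. (if b then f else g) x *\<^sub>R (1::real)) x
      = (\<Sum>b\<in>{True,False}. iter_deriv i (if b then f else g) x *\<^sub>R 1)"
    by (intro iter_deriv_lincomb[OF assms(1,2)]) auto
  then show "iter_deriv i (\<lambda>x. f x + g x) x = 0"
    using assms(6,7) i by (simp add: flat_def)
qed

text \<open>Leibniz by induction on the order: in \<open>f' g + f g'\<close> the first term inherits
  one order less from \<open>f'\<close>, the second has at least that much from \<open>f\<close>
  itself. The bound \<open>k \<le> Suc n\<close> keeps all inspected derivatives within the
  available smoothness.\<close>

lemma flat_mult:
  fixes f g :: "real \<Rightarrow> real"
  assumes S: "open S" and x: "x \<in> S"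
  shows "Ck n S f \<Longrightarrow> Ck n S g \<Longrightarrow> k \<le> Suc n \<Longrightarrow> flat k f x \<Longrightarrow> flat k (\<lambda>x. f x * g x) x"
proof (induction k arbitrary: n f g)
  case (Suc k)
  let ?f' = "\<lambda>x. vector_derivative f (at x)" and ?g' = "\<lambda>x. vector_derivative g (at x)"
  have fx: "f x = 0" "flat k ?f' x" using Suc.prems(4) by (auto simp: flat_Suc)
  show ?case
  proof (cases k)
    \<comment> \<open>Order one concerns only the value of the product; no derivative need exist
      when \<open>n = 0\<close>.\<close>
    case 0
    then show ?thesis using fx by (simp add: flat_Suc)
  next
    case (Suc k')
    then obtain n' where n: "n = Suc n'" "k \<le> Suc n'" using Suc.prems(3) by (cases n) auto
    have C: "Ck n' S f" "Ck n' S g" "Ck n' S ?f'" "Ck n' S ?g'"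
      using Suc.prems(1,2) Ck_SucD[of n' S f] Ck_SucD[of n' S g] unfolding n by auto
    have "flat k (\<lambda>x. ?f' x * g x + f x * ?g' x) x"
    proof (rule flat_add[OF S x _ _ n(2)])
      show "flat k (\<lambda>x. ?f' x * g x) x"
        using Suc.IH[OF C(3,2) n(2) fx(2)] .
      show "flat k (\<lambda>x. f x * ?g' x) x"
        using Suc.IH[OF C(1,4) n(2)] flat_le[OF Suc.prems(4), of k] by auto
    qed (auto intro: Ck_mult C S)
    moreover have "vector_derivative (\<lambda>x. f x * g x) (at y) = ?f' y * g y + f y * ?g' y" if "y \<in> S" for y
      by (rule vector_derivative_at)
        (use has_vector_derivative_mult[OF Ck_SucE[of n' S f y] Ck_SucE[of n' S g y]] Suc.prems(1,2) n that
          in \<open>simp add: add.commute\<close>)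
    ultimately have "flat k (\<lambda>x. vector_derivative (\<lambda>x. f x * g x) (at x)) x"
      using flat_cong[OF S x] by (metis (no_types, lifting))
    then show ?thesis using fx by (simp add: flat_Suc)
  qed
qed simp

section \<open>Weighted derivatives and counting zeros\<close>

lemma floor_interior: "of_int l < (x :: real) \<Longrightarrow> x < of_int l + 1 \<Longrightarrow> \<lfloor>x\<rfloor> = l"
  by (simp add: floor_eq_iff)

lemma floor_interval: "(x :: real) \<notin> \<int> \<Longrightarrow> x \<in> {of_int \<lfloor>x\<rfloor><..<of_int \<lfloor>x\<rfloor> + 1}"
proof -
  assume "x \<notin> \<int>"
  then have "x \<noteq> of_int \<lfloor>x\<rfloor>" by (metis Ints_of_int)
  then have "of_int \<lfloor>x\<rfloor> < x" "x < of_int \<lfloor>x\<rfloor> + 1"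
    using of_int_floor_le[of x] real_of_int_floor_add_one_gt[of x] by linarith+
  then show ?thesis unfolding greaterThanLessThan_iff by blast
qed

lemma cell_not_Ints: "x \<in> {of_int l<..<of_int l + 1 :: real} \<Longrightarrow> x \<notin> \<int>"
proof
  assume x: "x \<in> {of_int l<..<of_int l + 1 :: real}" and "x \<in> \<int>"
  then obtain i where "x = of_int i" by (auto elim: Ints_cases)
  then have "of_int l < (of_int i :: real)" "(of_int i :: real) < of_int (l + 1)" using x by auto
  then show False unfolding of_int_less_iff by linarith
qed

text \<open>Replaces the mean value theorem where \<open>g1\<close> may jump at integers. If
  \<open>g1\<close> had the sign of \<open>g y - g x\<close> nowhere in between, integrating the
  derivative times \<open>g y - g x\<close> would make the square of this increment
  nonpositive.\<close>

lemma weighted_mean_value: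
  fixes g g1 v :: "real \<Rightarrow> real"
  assumes xy: "x < y" and c: "continuous_on {x..y} g"
    and d: "\<And>z. x < z \<Longrightarrow> z < y \<Longrightarrow> z \<notin> \<int> \<Longrightarrow> (g has_real_derivative v z * g1 z) (at z)"
    and v: "\<And>z. 0 < v z" and ne: "g x \<noteq> g y"
  obtains z where "x < z" "z < y" "0 < g1 z * (g y - g x)"
proof -
  have "\<exists>z. x < z \<and> z < y \<and> 0 < g1 z * (g y - g x)"
  proof (rule ccontr)
    assume *: "\<not> ?thesis"
    \<comment> \<open>Only finitely many points are altered, so the integral is unaffected, and the
      value 0 there lets the sign estimate hold on the whole interval.\<close>
    define D where "D z = (if z \<in> \<int> \<or> z = x \<or> z = y then 0 else v z * g1 z)" for z
    have "(D has_integral (g y - g x)) {x..y}"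
    proof (rule fundamental_theorem_of_calculus_interior_strong[where S = "{z \<in> \<int>. x \<le> z \<and> z \<le> y}"])
      show "(g has_vector_derivative D z) (at z)" if "z \<in> {x<..<y} - {z \<in> \<int>. x \<le> z \<and> z \<le> y}" for z
        using d[of z] that by (auto simp: D_def has_real_derivative_iff_has_vector_derivative)
    qed (use xy c finite_int_segment in auto)
    then have "((\<lambda>z. D z * (g y - g x)) has_integral (g y - g x) * (g y - g x)) {x..y}"
      by (rule has_integral_mult_left)
    moreover have "D z * (g y - g x) \<le> 0" if "z \<in> {x..y}" for z
    proof (cases "z \<in> \<int> \<or> z = x \<or> z = y")
      case False
      then have "x < z" "z < y" using that by auto
      then have "g1 z * (g y - g x) \<le> 0" using * by (meson linorder_not_less)
      then have "v z * (g1 z * (g y - g x)) \<le> 0" using v[of z] by (simp add: mult_le_0_iff)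
      then show ?thesis using False by (simp add: D_def mult.assoc)
    qed (auto simp: D_def)
    ultimately have "(g y - g x) * (g y - g x) \<le> 0"
      using has_integral_le[OF _ has_integral_0] by blast
    then show False using ne by (metis eq_iff_diff_eq_0 mult_eq_0_iff not_square_less_zero order_antisym_conv linorder_not_le)
  qed
  then show ?thesis using that by blast
qed

section \<open>Chains of successive weighted derivatives\<close>

locale peb_weights =
  fixes m :: nat and w :: "nat \<Rightarrow> real \<Rightarrow> real"
  assumes m_pos: "1 \<le> m"
    and Ck_w: "\<And>s. s \<in> {1..m} \<Longrightarrow> Ck (m - s) UNIV (w s)"
    and w_pos: "\<And>s x. s \<in> {1..m} \<Longrightarrow> 0 < w s x"
begin

text \<open>For \<open>f = w 1 * G 0\<close> these are the functions obtained by alternately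
  differentiating and dividing by the next weight. The step into \<open>G (m - 1)\<close> is
  demanded only off the integers; the last clause makes \<open>G (m - 1)\<close> constant on the
  half-open cells, in line with right-sided limits.\<close>

definition chain :: "(nat \<Rightarrow> real \<Rightarrow> real) \<Rightarrow> bool" where
  "chain G \<longleftrightarrow>
     (\<forall>k x. k + 1 < m \<longrightarrow> isCont (G k) x) \<and>
     (\<forall>k x. k + 1 < m \<longrightarrow> k + 2 < m \<or> x \<notin> \<int> \<longrightarrow>
        (G k has_real_derivative w (k + 2) x * G (k + 1) x) (at x)) \<and>
     (\<forall>x. G (m - 1) x = G (m - 1) (of_int \<lfloor>x\<rfloor>))"

lemma chain_isCont: "chain G \<Longrightarrow> k + 1 < m \<Longrightarrow> isCont (G k) x"
  by (auto simp: chain_def)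

lemma chain_deriv:
  "chain G \<Longrightarrow> k + 1 < m \<Longrightarrow> k + 2 < m \<or> x \<notin> \<int> \<Longrightarrow>
     (G k has_real_derivative w (k + 2) x * G (k + 1) x) (at x)"
  by (auto simp: chain_def)

lemma chain_last: "chain G \<Longrightarrow> \<lfloor>x\<rfloor> = \<lfloor>y\<rfloor> \<Longrightarrow> G (m - 1) x = G (m - 1) y"
  unfolding chain_def by metis

text \<open>Smoothness climbs down the chain: each entry has one derivative more than the next one,
  and the weights have enough derivatives because \<open>n < m\<close>. The set \<open>S\<close> and
  the index \<open>n\<close> stay free because a combination of translates has the full chain
  \<open>n = m - 1\<close> only inside a cell, but \<open>n = m - 2\<close> on the whole
  line.\<close>

lemma Ck_chain:
  assumes S: "open S" and n: "n < m"
    and d: "\<And>k x. k < n \<Longrightarrow> x \<in> S \<Longrightarrow> (G k has_real_derivative w (k + 2) x * G (k + 1) x) (at x)"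
    and c: "continuous_on S (G n)"
  shows "k \<le> n \<Longrightarrow> Ck (n - k) S (G k)"
proof -
  have "Ck d S (G (n - d))" if "d \<le> n" for d
    using that
  proof (induction d)
    case (Suc d)
    define k where "k = n - Suc d"
    have k: "k < n" "n - d = k + 1" using Suc.prems by (auto simp: k_def)
    show ?case unfolding k_def[symmetric]
    proof (rule Ck_SucI[OF S])
      show "(G k has_vector_derivative w (k + 2) x * G (k + 1) x) (at x)" if "x \<in> S" for x
        using d[OF k(1) that] by (simp add: has_real_derivative_iff_has_vector_derivative)
      show "Ck d S (\<lambda>x. w (k + 2) x * G (k + 1) x)"
      proof (rule Ck_mult[OF S])
        show "Ck d S (w (k + 2))"
          by (rule Ck_subset[OF Ck_le[OF Ck_w]]) (use n k Suc.prems in auto)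
        show "Ck d S (G (k + 1))" using Suc k by simp
      qed
    qed
  qed (simp add: c)
  then show "k \<le> n \<Longrightarrow> Ck (n - k) S (G k)"
    by (metis diff_diff_cancel diff_le_self)
qed

lemma Ck_inverse_w: "s \<in> {1..m} \<Longrightarrow> n \<le> m - s \<Longrightarrow> open S \<Longrightarrow> Ck n S (\<lambda>x. inverse (w s x))"
  by (rule Ck_inverse[OF _ Ck_subset[OF Ck_le[OF Ck_w]]]) (auto simp: less_imp_neq[OF w_pos, symmetric])

text \<open>Division by a positive smooth function and differentiation both preserve vanishing orders
  (the latter lowering them by one), so zeros of \<open>f\<close> with multiplicity pass to the weighted
  derivatives of \<open>f\<close>.\<close>

lemma chain_zeros:
  assumes S: "open S" and n: "n < m"
    and d: "\<And>k x. k < n \<Longrightarrow> x \<in> S \<Longrightarrow> (G k has_real_derivative w (k + 2) x * G (k + 1) x) (at x)"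
    and c: "continuous_on S (G n)"
    and f: "\<And>x. x \<in> S \<Longrightarrow> f x = w 1 x * G 0 x"
    and x: "x \<in> S" and k: "flat k f x" "k \<le> Suc n" and i: "i < k"
  shows "G i x = 0"
proof -
  have C: "Ck (n - k) S (G k)" if "k \<le> n" for k
    by (rule Ck_chain[OF S n d c that])
  have "Ck n S (w 1)" by (rule Ck_subset[OF Ck_le[OF Ck_w]]) (use n in auto)
  then have Cf: "Ck n S f"
    using Ck_mult[OF S _ C[of 0]] Ck_cong[OF S, of f "\<lambda>x. w 1 x * G 0 x"] f by simp
  \<comment> \<open>The order left at stage \<open>i\<close> is \<open>k - i\<close>; truncated
    subtraction makes the claim trivial once the order is used up.\<close>
  have "flat (k - i) (G i) x" if "i \<le> n" for i
    using that
  proof (induction i)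
    case 0
    have "flat k (\<lambda>x. f x * inverse (w 1 x)) x"
      by (rule flat_mult[OF S x Cf Ck_inverse_w k(2,1)]) (use n S in auto)
    moreover have "f y * inverse (w 1 y) = G 0 y" if "y \<in> S" for y
      using f[OF that] w_pos[of 1 y] m_pos by simp
    ultimately show ?case using flat_cong[OF S x] by (metis (no_types, lifting) diff_zero)
  next
    case (Suc i)
    show ?case
    proof (cases "k - i")
      case (Suc l)
      let ?D = "\<lambda>x. vector_derivative (G i) (at x)"
      have "Ck (Suc (n - Suc i)) S (G i)"
        using C[of i] Suc.prems by (simp add: Suc_diff_Suc del: Ck.simps)
      then have "Ck (n - Suc i) S ?D" by simp
      moreover have "flat l ?D x" using Suc.IH Suc.prems Suc by (simp add: flat_Suc)
      ultimately have "flat l (\<lambda>x. ?D x * inverse (w (i + 2) x)) x"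
        by (intro flat_mult[OF S x, of "n - Suc i"] Ck_inverse_w) (use n S k Suc Suc.prems in auto)
      moreover have "?D y * inverse (w (i + 2) y) = G (Suc i) y" if "y \<in> S" for y
      proof -
        have "?D y = w (i + 2) y * G (i + 1) y"
          by (rule vector_derivative_at)
            (use d[of i y] Suc.prems that in \<open>simp add: has_real_derivative_iff_has_vector_derivative\<close>)
        then show ?thesis using w_pos[of "i + 2" y] n Suc.prems by simp
      qed
      ultimately have "flat l (G (Suc i)) x" using flat_cong[OF S x] by (metis (no_types, lifting))
      moreover have "l = k - Suc i" using Suc by simp
      ultimately show ?thesis by simp
    qed simp
  qed
  then have "flat (k - i) (G i) x" using i k by simp
  then show ?thesis using i by (auto simp: flat_def dest!: spec[of _ 0])
qed

lemma chain_mean_value: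
  assumes "chain G" "s + 1 < m" "x < y" "G s x \<noteq> G s y"
  obtains z where "x < z" "z < y" "0 < G (s + 1) z * (G s y - G s x)"
proof -
  have "continuous_on {x..y} (G s)"
    using chain_isCont[OF assms(1,2)] by (simp add: continuous_at_imp_continuous_on)
  then show ?thesis
    using weighted_mean_value[OF assms(3) _ chain_deriv[OF assms(1,2)] w_pos assms(4)] that assms(2)
    by (metis Suc_1 add_2_eq_Suc' atLeastAtMost_iff le_add2 less_eq_Suc_le plus_1_eq_Suc Suc_eq_plus1 le_Suc_eq add_Suc_right)
qed

text \<open>Counts, going from \<open>a\<close> to a point \<open>t\<close> with \<open>G s t \<noteq> 0\<close>, sign changes of \<open>G s\<close> and
  prescribed zeros with multiplicity, a zero of multiplicity \<open>k\<close> contributing \<open>k\<close> regardless of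
  whether the sign changes there. By Rolle's argument the count passes to \<open>G (s + 1)\<close>, where
  multiplicities have dropped by one, without ever requiring that zeros be isolated.\<close>

inductive osc :: "(nat \<Rightarrow> real \<Rightarrow> real) \<Rightarrow> real \<Rightarrow> nat \<Rightarrow> real \<Rightarrow> nat \<Rightarrow> bool"
  for G a s where
  start: "a < t \<Longrightarrow> G s t \<noteq> 0 \<Longrightarrow> osc G a s t 0"
| skip: "osc G a s t n \<Longrightarrow> t < u \<Longrightarrow> G s u \<noteq> 0 \<Longrightarrow> osc G a s u n"
| alt: "osc G a s t n \<Longrightarrow> t < u \<Longrightarrow> G s t * G s u < 0 \<Longrightarrow> osc G a s u (Suc n)"
| zero: "osc G a s t n \<Longrightarrow> t < x \<Longrightarrow> x < u \<Longrightarrow> 0 < k \<Longrightarrow> s + k < m \<Longrightarrow>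
    (\<And>i. i < k \<Longrightarrow> G (s + i) x = 0) \<Longrightarrow> G s u \<noteq> 0 \<Longrightarrow> osc G a s u (n + k)"

lemma osc_nonzero: "osc G a s t n \<Longrightarrow> G s t \<noteq> 0 \<and> a < t"
  by (induction rule: osc.induct) auto

text \<open>The invariant is a point \<open>t'\<close> before \<open>t\<close> at which the next
  stage has the sign of \<open>G s t\<close>; the increase or decrease from the zero at
  \<open>a\<close> provides the first such point. With the signs aligned, an alternation of
  \<open>G s\<close> becomes one of \<open>G (s + 1)\<close>.\<close>

lemma osc_rolle:
  assumes G: "chain G" and s: "s + 1 < m" and a: "G s a = 0"
  shows "osc G a s t n \<Longrightarrow> \<exists>t'. t' < t \<and> 0 < G (s + 1) t' * G s t \<and> osc G a (s + 1) t' n"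
proof (induction rule: osc.induct)
  case (start t)
  obtain z where "a < z" "z < t" "0 < G (s + 1) z * (G s t - G s a)"
    by (rule chain_mean_value[OF G s start(1)]) (use start a in auto)
  then show ?case using a by (intro exI[of _ z]) (auto intro!: osc.start)
next
  case (skip t n u)
  then obtain t' where t': "t' < t" "0 < G (s + 1) t' * G s t" "osc G a (s + 1) t' n" by blast
  have nz: "G s t \<noteq> 0" using skip(1) osc_nonzero by blast
  show ?case
  proof (cases "0 < G s t * G s u")
    case True
    then have "0 < G (s + 1) t' * G s u"
      using t'(2) by (auto simp: zero_less_mult_iff)
    then show ?thesis using t' skip(2) by (intro exI[of _ t']) auto
  next
    case False
    then have neg: "G s t * G s u < 0" using nz skip by (simp add: not_less order_less_le)
    \<comment> \<open>A sign change that was not counted: \<open>t'\<close> now has the wrong sign,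
      so the increment from \<open>t\<close> to \<open>u\<close> supplies a new point and the count
      stays the same.\<close>
    obtain z where z: "t < z" "z < u" "0 < G (s + 1) z * (G s u - G s t)"
      by (rule chain_mean_value[OF G s skip(2)]) (use neg not_square_less_zero in auto)
    have "0 < G (s + 1) z * G s u" using z(3) neg by (auto simp: zero_less_mult_iff mult_less_0_iff)
    moreover have "osc G a (s + 1) z n"
      by (rule osc.skip[OF t'(3)]) (use z t' in auto)
    ultimately show ?thesis using z(2) by blast
  qed
next
  case (alt t n u)
  then obtain t' where t': "t' < t" "0 < G (s + 1) t' * G s t" "osc G a (s + 1) t' n" by blast
  obtain z where z: "t < z" "z < u" "0 < G (s + 1) z * (G s u - G s t)"
    by (rule chain_mean_value[OF G s alt(2)]) (use alt not_square_less_zero in auto)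
  have zu: "0 < G (s + 1) z * G s u" using z(3) alt(3) by (auto simp: zero_less_mult_iff mult_less_0_iff)
  have "G (s + 1) t' * G (s + 1) z < 0"
    using t'(2) zu alt(3) by (auto simp: zero_less_mult_iff mult_less_0_iff)
  then have "osc G a (s + 1) z (Suc n)" using z t' by (intro osc.alt[OF t'(3)]) auto
  then show ?case using z(2) zu by blast
next
  case (zero t n x u k)
  then obtain t' where t': "t' < t" "0 < G (s + 1) t' * G s t" "osc G a (s + 1) t' n" by blast
  have nz: "G s t \<noteq> 0" using zero(1) osc_nonzero by blast
  have x0: "G s x = 0" using zero.hyps(6)[of 0] zero.hyps(4) by simp
  obtain z1 where z1: "t < z1" "z1 < x" "0 < G (s + 1) z1 * (G s x - G s t)"
    by (rule chain_mean_value[OF G s zero.hyps(2)]) (use x0 nz in auto)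
  obtain z2 where z2: "x < z2" "z2 < u" "0 < G (s + 1) z2 * (G s u - G s x)"
    by (rule chain_mean_value[OF G s zero.hyps(3)]) (use x0 zero in auto)
  \<comment> \<open>Coming back to the zero at \<open>x\<close> costs an alternation of
    \<open>G (s + 1)\<close>. It makes up for the order lost at \<open>x\<close>, where a zero of
    order \<open>k - 1\<close> remains.\<close>
  have "G (s + 1) t' * G (s + 1) z1 < 0"
    using t'(2) z1(3) x0 by (auto simp: zero_less_mult_iff mult_less_0_iff)
  then have o1: "osc G a (s + 1) z1 (Suc n)"
    using z1 t' by (intro osc.alt[OF t'(3)]) auto
  have z2nz: "G (s + 1) z2 \<noteq> 0" using z2 by auto
  have "osc G a (s + 1) z2 (n + k)"
  proof (cases "k = 1")
    case True
    then show ?thesis using osc.skip[OF o1 _ z2nz] z1 z2 by simp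
  next
    case False
    then have "osc G a (s + 1) z2 (Suc n + (k - 1))"
      using zero.hyps(6)[of "Suc i" for i] zero.hyps(4,5)
      by (intro osc.zero[OF o1 z1(2) z2(1)]) (use z2nz in \<open>auto simp: less_diff_conv\<close>)
    then show ?thesis using zero.hyps(4) by simp
  qed
  then show ?case using z2 x0 by (intro exI[of _ z2]) auto
qed

text \<open>The return to the zero at \<open>b\<close> after \<open>t\<close> adds one alternation
  to Rolle's count.\<close>

lemma osc_next:
  assumes G: "chain G" and s: "s + 1 < m" and ab: "G s a = 0" "G s b = 0" and o: "osc G a s t n" "t < b"
  shows "\<exists>t'<b. osc G a (s + 1) t' (Suc n)"
proof -
  obtain t' where t': "t' < t" "0 < G (s + 1) t' * G s t" "osc G a (s + 1) t' n"
    using osc_rolle[OF G s ab(1) o(1)] by blast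
  have nz: "G s t \<noteq> 0" using o osc_nonzero by blast
  obtain z where z: "t < z" "z < b" "0 < G (s + 1) z * (G s b - G s t)"
    by (rule chain_mean_value[OF G s o(2)]) (use nz ab in auto)
  have "G (s + 1) t' * G (s + 1) z < 0"
    using t'(2) z(3) ab by (auto simp: zero_less_mult_iff mult_less_0_iff)
  then have "osc G a (s + 1) z (Suc n)" using z t' by (intro osc.alt[OF t'(3)]) auto
  then show ?thesis using z(2) by blast
qed

text \<open>At the last stage the rule \<open>zero\<close> cannot apply, as it needs
  \<open>s + k < m\<close> with \<open>k\<close> positive, and an alternation has to enter a new
  cell because \<open>G (m - 1)\<close> is constant on cells.\<close>

lemma osc_last:
  assumes G: "chain G"
  shows "osc G (of_int a) (m - 1) t n \<Longrightarrow> int n \<le> \<lfloor>t\<rfloor> - a"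
proof (induction rule: osc.induct)
  case (skip t n u)
  then show ?case using floor_mono[of t u] by linarith
next
  case (alt t n u)
  have "\<lfloor>t\<rfloor> \<noteq> \<lfloor>u\<rfloor>" using alt(3) chain_last[OF G] not_square_less_zero by metis
  then show ?case using floor_mono[of t u] alt by linarith
qed (auto simp: less_imp_le le_floor_iff)

text \<open>The \<open>m - 1\<close> passes raise the count to \<open>n + (m - 1)\<close>, while the
  final point lies before \<open>b\<close>, hence in a cell with index at most
  \<open>b - 1\<close>.\<close>

lemma osc_bound:
  assumes G: "chain G" and ab: "\<And>k. k + 1 < m \<Longrightarrow> G k (of_int a) = 0 \<and> G k (of_int b) = 0"
    and o: "osc G (of_int a) 0 t n" "t < of_int b"
  shows "int n \<le> b - a - int m"
proof -
  have "\<exists>t<of_int b. osc G (of_int a) s t (n + s)" if "s < m" for s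
    using that
  proof (induction s)
    case (Suc s)
    then show ?case using osc_next[OF G, of s "of_int a" "of_int b" _ "n + s"] ab[of s] by auto
  qed (use o in auto)
  then obtain t where "t < of_int b" "osc G (of_int a) (m - 1) t (n + (m - 1))"
    using m_pos by (metis diff_less less_le_trans zero_less_one)
  then have "int (n + (m - 1)) \<le> \<lfloor>t\<rfloor> - a" "\<lfloor>t\<rfloor> < b" using osc_last[OF G] by (blast, simp add: floor_less_iff)
  then show ?thesis using m_pos by (simp add: of_nat_diff)
qed

text \<open>Since \<open>G 0\<close> vanishes on no subinterval, points with
  \<open>G 0 \<noteq> 0\<close> exist between consecutive marks, and the marks can be threaded from
  left to right into an \<open>osc\<close>. The bound \<open>K x < m\<close> is what the rule
  \<open>zero\<close> demands at stage 0.\<close>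

lemma zero_count:
  assumes G: "chain G" and ab: "\<And>k. k + 1 < m \<Longrightarrow> G k (of_int a) = 0 \<and> G k (of_int b) = 0"
    and nz: "\<And>x y. of_int a \<le> x \<Longrightarrow> x < y \<Longrightarrow> y \<le> of_int b \<Longrightarrow> \<exists>t. x < t \<and> t < y \<and> G 0 t \<noteq> 0"
    and P: "finite P" "P \<subseteq> {of_int a<..<of_int b}"
    and K: "\<And>x. x \<in> P \<Longrightarrow> 0 < K x \<and> K x < m \<and> (\<forall>i<K x. G i x = 0)"
    and less: "a < b"
  shows "int (\<Sum>x\<in>P. K x) \<le> b - a - int m"
proof -
  \<comment> \<open>The bound \<open>y\<close> is general because the point reached must still
    precede the next mark.\<close>
  have "\<exists>t<y. (\<forall>x\<in>P. x < t) \<and> osc G (of_int a) 0 t (\<Sum>x\<in>P. K x)"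
    if "of_int a < y" "y \<le> of_int b" "\<forall>x\<in>P. x < y" for y
    using P K that
  proof (induction P arbitrary: y rule: finite_linorder_max_induct)
    case empty
    then show ?case using nz[of "of_int a" y] by (auto intro: osc.start)
  next
    case (insert x P)
    obtain t where t: "t < x" "\<forall>x\<in>P. x < t" "osc G (of_int a) 0 t (\<Sum>x\<in>P. K x)"
      using insert.IH[of x] insert.prems insert.hyps by (auto simp: less_imp_le)
    obtain u where u: "x < u" "u < y" "G 0 u \<noteq> 0" using nz[of x y] insert.prems by auto
    have "osc G (of_int a) 0 u ((\<Sum>x\<in>P. K x) + K x)"
      using insert.prems(2)[of x] by (intro osc.zero[OF t(3,1) u(1)]) (auto simp: u)
    moreover have "x \<notin> P" using insert.hyps by auto
    ultimately show ?case using u t insert.hyps by (intro exI[of _ u]) (auto simp: add.commute)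
  qed
  from this[of "of_int b"] P less obtain t where "t < of_int b" "osc G (of_int a) 0 t (\<Sum>x\<in>P. K x)"
    by force
  then show ?thesis using osc_bound[OF G ab] by blast
qed

end

section \<open>PEB-splines and their translates\<close>

lemma integral_from_0_deriv:
  fixes f :: "real \<Rightarrow> real"
  assumes "continuous_on UNIV f"
  shows "((\<lambda>u. LBINT t=0..ereal u. f t) has_real_derivative f x) (at x)"
proof -
  \<comment> \<open>The interval has to contain the base point 0 as well as \<open>x\<close> in its
    interior.\<close>
  let ?a = "- \<bar>x\<bar> - 1" and ?b = "\<bar>x\<bar> + 1"
  have "((\<lambda>u. LBINT t=ereal 0..ereal u. f t) has_vector_derivative f x) (at x within {?a..?b})"
    by (rule interval_integral_FTC2) (use assms continuous_on_subset in auto)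
  moreover have "at x within {?a..?b} = at x" by (rule at_within_interior) auto
  ultimately show ?thesis by (simp add: has_real_derivative_iff_has_vector_derivative zero_ereal_def)
qed

text \<open>Carries identities known on an open cell to its left end, where values are right-sided
  limits.\<close>

lemma eq_at_left_end:
  fixes f g :: "real \<Rightarrow> 'a::real_normed_vector" and l :: int
  assumes "(f \<longlongrightarrow> a) (at_right (of_int l))" "(g \<longlongrightarrow> b) (at_right (of_int l))"
    "\<And>x. of_int l < x \<Longrightarrow> x < of_int l + 1 \<Longrightarrow> f x = g x"
  shows "a = b"
proof -
  have "\<forall>\<^sub>F x in at_right (of_int l). f x = g x"
    unfolding eventually_at_right_field using assms(3)
    by (intro exI[of _ "of_int l + 1"]) auto
  then have "(g \<longlongrightarrow> a) (at_right (of_int l))" using assms(1) Lim_transform_eventually by fast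
  then show ?thesis using assms(2) tendsto_unique[OF trivial_limit_at_right_real] by blast
qed

lemma cont_at_right: "continuous_on UNIV f \<Longrightarrow> (f \<longlongrightarrow> f x) (at_right (x::real))"
  by (simp add: continuous_on_eq_continuous_within continuous_within filterlim_at_split)

locale peb = fixes m :: nat and \<gamma> :: "nat \<Rightarrow> real" and r :: "nat \<Rightarrow> real \<Rightarrow> real" and \<phi> :: "real \<Rightarrow> real"
  assumes m1: "1 \<le> m" and data: "peb_weight_data m r" and spline: "peb_spline m \<gamma> r \<phi>"
begin

abbreviation w :: "nat \<Rightarrow> real \<Rightarrow> real" where "w \<equiv> peb_weight \<gamma> r"

sublocale peb_weights m w
proof
  fix s assume s: "s \<in> {1..m}"
  have "Ck (m - s) UNIV (r s)" using data s by (simp add: peb_weight_data_def C_class_iff_Ck)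
  then show "Ck (m - s) UNIV (w s)" unfolding peb_weight_def
    by (intro Ck_mult Ck_exp) auto
  show "0 < w s x" for x using data s by (simp add: peb_weight_data_def peb_weight_def)
qed (rule m1)

lemma w_shift:
  assumes s: "s \<in> {1..m}"
  shows "w s (x - of_int j) = exp (- \<gamma> s * of_int j) * w s x"
proof -
  have p: "r s (x + 1) = r s x" for x using data s by (simp add: peb_weight_data_def)
  have n: "r s (x + of_nat n) = r s x" for x n
  proof (induction n)
    case (Suc n)
    have "r s (x + of_nat (Suc n)) = r s ((x + of_nat n) + 1)" by (simp add: add_ac)
    then show ?case using p Suc by simp
  qed simp
  have "r s (x - of_int j) = r s x"
  proof (cases "0 \<le> j")
    case True
    then show ?thesis using n[of "x - of_int j" "nat j"] by simp
  next
    case False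
    then show ?thesis using n[of x "nat (- j)"] by simp
  qed
  then show ?thesis by (simp add: peb_weight_def algebra_simps flip: exp_add)
qed

lemma continuous_w: "s \<in> {1..m} \<Longrightarrow> continuous_on UNIV (w s)"
  using Ck_continuous Ck_w by blast

lemma iter_integral_deriv:
  "1 \<le> j \<Longrightarrow> j + k \<le> m \<Longrightarrow>
     (iter_integral w j (Suc k) has_real_derivative w j x * iter_integral w (Suc j) k x) (at x)"
proof (induction k arbitrary: j x)
  case (Suc k)
  have "continuous_on UNIV (iter_integral w (Suc j) (Suc k))"
    using Suc.IH[of "Suc j"] Suc.prems DERIV_isCont by (auto intro!: continuous_at_imp_continuous_on)
  then have "continuous_on UNIV (\<lambda>t. w j t * iter_integral w (Suc j) (Suc k) t)"
    by (intro continuous_on_mult continuous_w) (use Suc.prems in auto)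
  from integral_from_0_deriv[OF this] show ?case by (simp add: fun_eq_iff)
next
  case 0
  have "continuous_on UNIV (\<lambda>t. w j t * iter_integral w (Suc j) 0 t)"
    by (simp, rule continuous_w) (use 0 in auto)
  from integral_from_0_deriv[OF this] show ?case by simp
qed

text \<open>The weighted derivatives of \<open>\<Sum>s=1..m. a s * u\<^sub>s\<close> in closed form.\<close>

definition cell_chain :: "(nat \<Rightarrow> real) \<Rightarrow> nat \<Rightarrow> real \<Rightarrow> real" where
  "cell_chain a k x = (\<Sum>i<m - k. a (k + 1 + i) * iter_integral w (k + 2) i x)"

lemma cell_chain_deriv:
  assumes k: "k + 1 < m"
  shows "(cell_chain a k has_real_derivative w (k + 2) x * cell_chain a (k + 1) x) (at x)"
proof -
  have mk: "m - k = Suc (m - (k + 1))" using k by simp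
  have eq: "cell_chain a k = (\<lambda>x. a (k + 1) +
      (\<Sum>i<m - (k + 1). a (k + 2 + i) * iter_integral w (k + 2) (Suc i) x))"
    unfolding cell_chain_def mk sum.lessThan_Suc_shift by (simp del: iter_integral.simps(2))
  have "((\<lambda>x. a (k + 1) + (\<Sum>i<m - (k + 1). a (k + 2 + i) * iter_integral w (k + 2) (Suc i) x))
      has_real_derivative 0 + (\<Sum>i<m - (k + 1). a (k + 2 + i) * (w (k + 2) x * iter_integral w (Suc (k + 2)) i x))) (at x)"
    by (intro DERIV_add DERIV_const DERIV_sum DERIV_cmult iter_integral_deriv) auto
  moreover have "(\<Sum>i<m - (k + 1). a (k + 2 + i) * (w (k + 2) x * iter_integral w (Suc (k + 2)) i x))
      = w (k + 2) x * cell_chain a (k + 1) x"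
    by (simp add: cell_chain_def sum_distrib_left mult_ac)
  ultimately show ?thesis unfolding eq by simp
qed

lemma cell_chain_last: "cell_chain a (m - 1) x = a m"
proof -
  have "m - (m - 1) = Suc 0" using m1 by simp
  then show ?thesis using m1 by (simp add: cell_chain_def)
qed

lemma Ck_cell: "Ck (m - 1) UNIV (\<lambda>x. w 1 x * cell_chain a 0 x)"
proof (rule Ck_mult)
  show "Ck (m - 1) UNIV (w 1)" using Ck_w[of 1] m1 by simp
  have "cell_chain a (m - 1) = (\<lambda>_. a m)" using cell_chain_last by auto
  then show "Ck (m - 1) UNIV (cell_chain a 0)"
    using Ck_chain[of UNIV "m - 1" "cell_chain a" 0] cell_chain_deriv m1 by simp
qed simp

section \<open>The spline cell by cell and its weighted derivatives\<close>

lemma phi_zero: "x < 0 \<or> real m < x \<Longrightarrow> \<phi> x = 0"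
proof -
  have "{x. \<phi> x \<noteq> 0} \<subseteq> {0..real m}" using spline closure_subset unfolding peb_spline_def by metis
  then show "x < 0 \<or> real m < x \<Longrightarrow> \<phi> x = 0" by force
qed

lemma phi_pos: "0 < x \<Longrightarrow> x < real m \<Longrightarrow> 0 < \<phi> x"
  using spline by (simp add: peb_spline_def)

lemma Ck_phi: "2 \<le> m \<Longrightarrow> Ck (m - 2) UNIV \<phi>"
  using spline by (simp add: peb_spline_def C_class_iff_Ck)

lemma phi_right_cont: "(\<phi> \<longlongrightarrow> \<phi> (of_int l)) (at_right (of_int l))"
proof (cases "m = 1")
  case True
  then show ?thesis using spline by (simp add: peb_spline_def continuous_within)
next
  case False
  then have "continuous_on UNIV \<phi>" using Ck_phi m1 Ck_continuous by auto
  then show ?thesis by (simp add: continuous_on_eq_continuous_within continuous_within filterlim_at_split)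
qed

text \<open>The closed support leaves the value at \<open>m\<close> open; right continuity there
  makes it zero, so the support fits the half-open cells.\<close>

lemma phi_support: "\<phi> x = 0 \<or> 0 \<le> x \<and> x < real m"
proof -
  have "\<phi> (of_int (int m)) = 0"
    by (rule eq_at_left_end[OF phi_right_cont tendsto_const]) (use phi_zero in auto)
  then show ?thesis using phi_zero by force
qed

text \<open>The functions \<open>peb_u\<close> are real, so the real parts of the complex
  coefficients represent \<open>\<phi>\<close> as well, and right continuity adds the left end of
  the cell. Outside the support the coefficients are fixed to be zero, so that the extended piece
  vanishes on the whole line.\<close>

lemma phi_cell:
  "\<exists>a. (\<forall>x. \<lfloor>x\<rfloor> = l \<longrightarrow> \<phi> x = w 1 x * cell_chain a 0 x) \<and> (l < 0 \<or> int m \<le> l \<longrightarrow> a = (\<lambda>_. 0))"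
proof (cases "l < 0 \<or> int m \<le> l")
  case True
  have "\<phi> x = 0" if "\<lfloor>x\<rfloor> = l" for x
    using phi_support[of x] True that by (auto simp: floor_less_iff le_floor_iff dest!: sym[of _ l])
  then show ?thesis by (auto simp: cell_chain_def intro!: exI[of _ "\<lambda>_. 0"])
next
  case False
  obtain b :: "nat \<Rightarrow> complex" where b: "\<And>x. x \<in> {of_int l<..<of_int l + 1} \<Longrightarrow>
      complex_of_real (\<phi> x) = (\<Sum>s=1..m. b s * complex_of_real (peb_u w s x))"
    using spline unfolding peb_spline_def peb_space_def by fastforce
  define a where "a s = Re (b s)" for s
  have eq: "\<phi> x = w 1 x * cell_chain a 0 x" if x: "x \<in> {of_int l<..<of_int l + 1}" for x
  proof -
    have "\<phi> x = Re (\<Sum>s=1..m. b s * complex_of_real (peb_u w s x))"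
      using b[OF x] by (metis Re_complex_of_real)
    also have "\<dots> = (\<Sum>s=1..m. a s * peb_u w s x)" by (simp add: a_def)
    also have "\<dots> = (\<Sum>i<m. a (Suc i) * peb_u w (Suc i) x)"
      by (rule sum.reindex_bij_witness[of _ Suc "\<lambda>s. s - 1"]) auto
    also have "\<dots> = w 1 x * cell_chain a 0 x"
      by (simp add: peb_u_def cell_chain_def sum_distrib_left mult_ac numeral_2_eq_2)
    finally show ?thesis .
  qed
  have "\<phi> (of_int l) = w 1 (of_int l) * cell_chain a 0 (of_int l)"
    by (rule eq_at_left_end[OF phi_right_cont cont_at_right[OF Ck_continuous[OF Ck_cell]]])
      (use eq in auto)
  then have "\<phi> x = w 1 x * cell_chain a 0 x" if "\<lfloor>x\<rfloor> = l" for x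
    using eq[of x] that by (cases "x = of_int l") (auto simp: floor_eq_iff)
  then show ?thesis using False by auto
qed

definition coef :: "int \<Rightarrow> nat \<Rightarrow> real" where
  "coef = (SOME aa. \<forall>l. (\<forall>x. \<lfloor>x\<rfloor> = l \<longrightarrow> \<phi> x = w 1 x * cell_chain (aa l) 0 x) \<and>
     (l < 0 \<or> int m \<le> l \<longrightarrow> aa l = (\<lambda>_. 0)))"

lemma coef: "\<phi> x = w 1 x * cell_chain (coef \<lfloor>x\<rfloor>) 0 x"
    "l < 0 \<or> int m \<le> l \<Longrightarrow> coef l = (\<lambda>_. 0)"
proof -
  have "\<exists>aa. \<forall>l. (\<forall>x. \<lfloor>x\<rfloor> = l \<longrightarrow> \<phi> x = w 1 x * cell_chain (aa l) 0 x) \<and>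
     (l < 0 \<or> int m \<le> l \<longrightarrow> aa l = (\<lambda>_. 0))"
    using phi_cell by (intro choice) blast
  then have "\<forall>l. (\<forall>x. \<lfloor>x\<rfloor> = l \<longrightarrow> \<phi> x = w 1 x * cell_chain (coef l) 0 x) \<and>
     (l < 0 \<or> int m \<le> l \<longrightarrow> coef l = (\<lambda>_. 0))"
    unfolding coef_def by (rule someI_ex)
  then show "\<phi> x = w 1 x * cell_chain (coef \<lfloor>x\<rfloor>) 0 x" "l < 0 \<or> int m \<le> l \<Longrightarrow> coef l = (\<lambda>_. 0)"
    by blast+
qed

text \<open>Extends the formula of one cell to all of \<real>. The extension has
  \<open>m - 1\<close> continuous derivatives, and those at the left end of the cell are the
  right-sided derivatives of \<open>\<phi>\<close>.\<close>

definition piece :: "int \<Rightarrow> real \<Rightarrow> real" where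
  "piece l x = w 1 x * cell_chain (coef l) 0 x"

lemma phi_piece: "\<lfloor>x\<rfloor> = l \<Longrightarrow> \<phi> x = piece l x"
  using coef(1) by (auto simp: piece_def)

lemma Ck_piece: "s < m \<Longrightarrow> Ck s S (piece l)"
  using Ck_subset[OF Ck_le[OF Ck_cell[of "coef l"], of s], of S] unfolding piece_def[abs_def] by (simp add: less_eq_Suc_le le_diff_conv)

lemma piece_zero: "l < 0 \<or> int m \<le> l \<Longrightarrow> piece l = (\<lambda>_. 0)"
  by (auto simp: piece_def coef(2) cell_chain_def)

primrec weighted_deriv :: "nat \<Rightarrow> real \<Rightarrow> real" where
  "weighted_deriv 0 = (\<lambda>x. inverse (w 1 x) * \<phi> x)"
| "weighted_deriv (Suc k) = (\<lambda>x. inverse (w (k + 2) x) * vector_derivative (weighted_deriv k) (at x))"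

text \<open>At the last level the derivative inside \<open>weighted_deriv\<close> may fail to exist
  at integers; the leading coefficient of the cell, constant on it, is the right-sided
  value.\<close>

definition phi_chain :: "nat \<Rightarrow> real \<Rightarrow> real" where
  "phi_chain k x = (if k = m - 1 then coef \<lfloor>x\<rfloor> m else weighted_deriv k x)"

lemma phi_eq_chain: "\<phi> x = w 1 x * phi_chain 0 x"
proof (cases "m = 1")
  case True
  then have "phi_chain 0 x = cell_chain (coef \<lfloor>x\<rfloor>) 0 x"
    using cell_chain_last[of "coef \<lfloor>x\<rfloor>" x] unfolding phi_chain_def by simp
  then show ?thesis using coef(1)[of x] by metis
next
  case False
  then show ?thesis using w_pos[of 1 x] m1 by (simp add: phi_chain_def)
qed

lemma Ck_weighted_deriv: "k + 2 \<le> m \<Longrightarrow> Ck (m - 2 - k) UNIV (weighted_deriv k)"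
proof (induction k)
  case 0
  then show ?case
    by (auto intro!: Ck_mult Ck_inverse_w Ck_phi)
next
  case (Suc k)
  then have "Ck (Suc (m - 2 - Suc k)) UNIV (weighted_deriv k)"
    by (simp add: Suc_diff_Suc del: Ck.simps)
  then have "Ck (m - 2 - Suc k) UNIV (\<lambda>x. vector_derivative (weighted_deriv k) (at x))" by simp
  then show ?case unfolding weighted_deriv.simps
    by (intro Ck_mult Ck_inverse_w) (use Suc.prems in auto)
qed

lemma weighted_deriv_cell:
  "k < m \<Longrightarrow> x \<in> {of_int l<..<of_int l + 1} \<Longrightarrow> weighted_deriv k x = cell_chain (coef l) k x"
proof (induction k arbitrary: x)
  case 0
  then have "\<phi> x = w 1 x * cell_chain (coef l) 0 x"
    using coef(1)[of x] floor_interior[of l x] by auto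
  then show ?case using w_pos[of 1 x] m1 by simp
next
  case (Suc k)
  have "vector_derivative (weighted_deriv k) (at x) = vector_derivative (cell_chain (coef l) k) (at x)"
    by (rule vector_derivative_cong_open[of "{of_int l<..<of_int l + 1}"]) (use Suc in auto)
  also have "\<dots> = w (k + 2) x * cell_chain (coef l) (k + 1) x"
    using cell_chain_deriv[of k "coef l" x] Suc.prems
    by (intro vector_derivative_at) (simp add: has_real_derivative_iff_has_vector_derivative)
  finally show ?case using w_pos[of "k + 2" x] Suc.prems by simp
qed

text \<open>Below the last step the smoothness of \<open>\<phi>\<close> on the line suffices. For
  \<open>m = k + 2\<close> the derivative is computed inside a cell, where the weighted derivatives
  have the closed form \<open>cell_chain\<close>.\<close>

lemma chain_phi: "chain phi_chain"
  unfolding chain_def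
proof (intro conjI allI impI)
  fix k x assume k: "k + 1 < m"
  have "continuous_on UNIV (weighted_deriv k)"
    by (rule Ck_continuous[OF Ck_weighted_deriv]) (use k in simp)
  moreover have wd: "phi_chain k = weighted_deriv k"
  proof -
    have "k \<noteq> m - 1" using k by linarith
    then show ?thesis by (auto simp: phi_chain_def fun_eq_iff)
  qed
  ultimately show "isCont (phi_chain k) x" by (simp add: continuous_on_eq_continuous_within)
  assume kx: "k + 2 < m \<or> x \<notin> \<int>"
  show "(phi_chain k has_real_derivative w (k + 2) x * phi_chain (k + 1) x) (at x)"
  proof (cases "k + 2 < m")
    case True
    then have "Ck (Suc (m - 2 - Suc k)) UNIV (weighted_deriv k)"
      using Ck_weighted_deriv[of k] by (simp add: Suc_diff_Suc del: Ck.simps)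
    have "Suc k \<noteq> m - Suc 0" using True by linarith
    with Ck_SucE[OF \<open>Ck (Suc (m - 2 - Suc k)) UNIV (weighted_deriv k)\<close>, of x] show ?thesis
      using True w_pos[of "k + 2" x] unfolding has_real_derivative_iff_has_vector_derivative wd
      by (simp add: phi_chain_def flip: mult.assoc)
  next
    case False
    then have k2: "m = k + 2" "x \<notin> \<int>" using k kx by auto
    have "(cell_chain (coef \<lfloor>x\<rfloor>) k has_real_derivative w (k + 2) x * phi_chain (k + 1) x) (at x)"
    proof -
      have k1: "k + 1 = m - 1" using k2 by simp
      show ?thesis
        using cell_chain_deriv[OF k, of "coef \<lfloor>x\<rfloor>" x]
        unfolding k1 cell_chain_last by (simp add: phi_chain_def)
    qed
    then show ?thesis
      unfolding has_real_derivative_iff_has_vector_derivative wd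
      by (rule has_vector_derivative_cong_open[THEN iffD2, OF _ floor_interval[OF k2(2)], rotated -1])
        (use k floor_interval[OF k2(2)] weighted_deriv_cell[of k _ "\<lfloor>x\<rfloor>"] in auto)
  qed
next
  show "phi_chain (m - 1) x = phi_chain (m - 1) (of_int \<lfloor>x\<rfloor>)" for x
    by (simp add: phi_chain_def)
qed

text \<open>The quasi-periodicity of the weights makes integer translates of a chain, suitably
  rescaled, into chains.\<close>

definition comb_chain :: "int set \<Rightarrow> (int \<Rightarrow> real) \<Rightarrow> nat \<Rightarrow> real \<Rightarrow> real" where
  "comb_chain J c k x =
     (\<Sum>j\<in>J. c j * exp (- (\<Sum>s=1..k+1. \<gamma> s) * of_int j) * phi_chain k (x - of_int j))"

lemma comb_chain_0: "(\<Sum>j\<in>J. \<phi> (x - of_int j) *\<^sub>R c j) = w 1 x * comb_chain J c 0 x"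
  using w_shift[of 1 x] m1 by (simp add: comb_chain_def phi_eq_chain sum_distrib_left mult_ac)

lemma chain_comb: "chain (comb_chain J c)"
  unfolding chain_def
proof (intro conjI allI impI)
  fix k x assume k: "k + 1 < m"
  have "isCont (\<lambda>x. phi_chain k (x - of_int j)) x" for j :: int
    by (rule isCont_o2[OF _ chain_isCont[OF chain_phi k]]) simp
  then show "isCont (comb_chain J c k) x"
    unfolding comb_chain_def[abs_def] by (intro continuous_intros)
  assume kx: "k + 2 < m \<or> x \<notin> \<int>"
  have "((\<lambda>x. phi_chain k (x - of_int j)) has_real_derivative
      w (k + 2) (x - of_int j) * phi_chain (k + 1) (x - of_int j)) (at x)" for j
    using chain_deriv[OF chain_phi k, of "x - of_int j"] kx
    by (auto simp: has_real_derivative_iff_has_vector_derivative has_vector_derivative_shift_iff)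
  then have "(comb_chain J c k has_real_derivative
      (\<Sum>j\<in>J. (c j * exp (- (\<Sum>s=1..k+1. \<gamma> s) * of_int j)) * (w (k + 2) (x - of_int j) * phi_chain (k + 1) (x - of_int j)))) (at x)"
    unfolding comb_chain_def[abs_def] by (intro DERIV_sum DERIV_cmult)
  also have "(\<Sum>j\<in>J. (c j * exp (- (\<Sum>s=1..k+1. \<gamma> s) * of_int j)) * (w (k + 2) (x - of_int j) * phi_chain (k + 1) (x - of_int j)))
      = w (k + 2) x * comb_chain J c (k + 1) x"
    unfolding comb_chain_def sum_distrib_left
  proof (rule sum.cong[OF refl])
    fix j
    \<comment> \<open>Every differentiation brings in one more weight, whose shift factor extends
      the accumulated exponent by \<open>\<gamma> (k + 2)\<close>.\<close>
    have "exp (- (\<Sum>s=1..k+1. \<gamma> s) * of_int j) * exp (- \<gamma> (k + 2) * of_int j) =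
        exp (- (\<Sum>s=1..(k+1)+1. \<gamma> s) * of_int j)"
      by (simp add: algebra_simps flip: exp_add)
    then show "c j * exp (- (\<Sum>s=1..k+1. \<gamma> s) * of_int j) * (w (k + 2) (x - of_int j) * phi_chain (k + 1) (x - of_int j))
        = w (k + 2) x * (c j * exp (- (\<Sum>s=1..k+1+1. \<gamma> s) * of_int j) * phi_chain (k + 1) (x - of_int j))"
      using w_shift[of "k + 2" x j] k by (simp add: mult_ac)
  qed
  finally show "(comb_chain J c k has_real_derivative w (k + 2) x * comb_chain J c (k + 1) x) (at x)" .
next
  fix x
  have "phi_chain (m - 1) (x - of_int j) = phi_chain (m - 1) (of_int \<lfloor>x\<rfloor> - of_int j)" for j :: int
    by (rule chain_last[OF chain_phi]) simp
  then show "comb_chain J c (m - 1) x = comb_chain J c (m - 1) (of_int \<lfloor>x\<rfloor>)"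
    by (simp add: comb_chain_def)
qed

text \<open>The \<open>s\<close>-th derivative of \<open>\<phi>\<close>, right-sided at the integers.\<close>

definition \<psi> :: "nat \<Rightarrow> real \<Rightarrow> real" where
  "\<psi> s x = iter_deriv s (piece \<lfloor>x\<rfloor>) x"

lemma psi_zero: "x < 0 \<or> real m \<le> x \<Longrightarrow> \<psi> s x = 0"
proof -
  assume "x < 0 \<or> real m \<le> x"
  then have "piece \<lfloor>x\<rfloor> = (\<lambda>_. 0)" by (intro piece_zero) (auto simp: floor_less_iff le_floor_iff)
  moreover have "iter_deriv s (\<lambda>_. 0 :: real) = (\<lambda>_. 0)" by (induction s) (simp_all add: iter_deriv_Suc vector_derivative_const_at)
  ultimately show ?thesis by (simp add: \<psi>_def)
qed

section \<open>Finite combinations of translates and their sampled derivatives\<close>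

definition comb :: "int set \<Rightarrow> (int \<Rightarrow> 'a::real_normed_vector) \<Rightarrow> real \<Rightarrow> 'a" where
  "comb J c x = (\<Sum>j\<in>J. \<phi> (x - of_int j) *\<^sub>R c j)"

text \<open>A smooth stand-in for the combination on the cell starting at \<open>l\<close>: its
  derivatives at \<open>l\<close> exist and serve as one-sided ones.\<close>

definition comb_piece :: "int \<Rightarrow> int set \<Rightarrow> (int \<Rightarrow> 'a::real_normed_vector) \<Rightarrow> real \<Rightarrow> 'a" where
  "comb_piece l J c x = (\<Sum>j\<in>J. piece (l - j) (x - of_int j) *\<^sub>R c j)"

lemma comb_eq_piece: "\<lfloor>x\<rfloor> = l \<Longrightarrow> comb J c x = comb_piece l J c x"
  unfolding comb_def comb_piece_def by (intro sum.cong refl) (simp add: phi_piece)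

lemma Ck_comb_piece: "s < m \<Longrightarrow> Ck s UNIV (comb_piece l J c)"
  unfolding comb_piece_def
  by (intro Ck_sum Ck_scaleR Ck_const Ck_shift[OF Ck_piece[of s UNIV]]) auto

lemma Ck_comb: "2 \<le> m \<Longrightarrow> Ck (m - 2) UNIV (comb J c)"
  unfolding comb_def
  by (intro Ck_sum Ck_scaleR Ck_const Ck_shift[OF Ck_phi]) auto

lemma iter_deriv_comb_piece:
  assumes "s < m" "\<lfloor>x\<rfloor> = l"
  shows "iter_deriv s (comb_piece l J c) x = (\<Sum>j\<in>J. \<psi> s (x - of_int j) *\<^sub>R c j)"
proof -
  have "iter_deriv s (comb_piece l J c) x =
      (\<Sum>j\<in>J. iter_deriv s (\<lambda>x. piece (l - j) (x - of_int j)) x *\<^sub>R c j)"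
    unfolding comb_piece_def
    by (rule iter_deriv_lincomb[OF open_UNIV]) (auto intro!: Ck_shift[OF Ck_piece[of s UNIV]] assms)
  then show ?thesis using assms(2) by (simp add: iter_deriv_shift \<psi>_def)
qed

lemma iter_deriv_comb_interior:
  assumes "of_int l < x" "x < of_int l + 1"
  shows "iter_deriv s (comb J c) x = iter_deriv s (comb_piece l J c) x"
  by (rule iter_deriv_cong_open[of "{of_int l<..<of_int l + 1}"])
    (use assms in \<open>auto intro!: comb_eq_piece floor_interior\<close>)

lemma iter_deriv_comb_at_right:
  assumes "s < m"
  shows "(iter_deriv s (comb J c) \<longlongrightarrow> iter_deriv s (comb_piece l J c) (of_int l)) (at_right (of_int l))"
proof -
  have "\<forall>\<^sub>F x in at_right (of_int l). iter_deriv s (comb_piece l J c) x = iter_deriv s (comb J c) x"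
    unfolding eventually_at_right_field
    by (intro exI[of _ "of_int l + 1"]) (auto simp: iter_deriv_comb_interior)
  then show ?thesis
    using cont_at_right[OF continuous_on_iter_deriv[OF Ck_comb_piece[OF assms] order_refl]]
      Lim_transform_eventually by fast
qed

text \<open>Off the integers the combination agrees locally with the piece of its cell. At an
  integer the order is below \<open>m - 1\<close>, so the derivative is continuous and equals its
  right limit, which the piece computes.\<close>

lemma iter_deriv_comb:
  assumes "s + 1 < m \<or> s < m \<and> x \<notin> \<int>"
  shows "iter_deriv s (comb J c) x = (\<Sum>j\<in>J. \<psi> s (x - of_int j) *\<^sub>R c j)"
proof (cases "x \<in> \<int>")
  case False
  then show ?thesis
    using iter_deriv_comb_interior[of "\<lfloor>x\<rfloor>" x s J c] floor_interval[of x]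
      iter_deriv_comb_piece[of s x "\<lfloor>x\<rfloor>" J c] assms by auto
next
  case True
  then obtain l where l: "x = of_int l" by (auto elim: Ints_cases)
  have s: "s + 1 < m" using assms True by auto
  have "iter_deriv s (comb J c) (of_int l) = iter_deriv s (comb_piece l J c) (of_int l)"
    by (rule eq_at_left_end[OF cont_at_right iter_deriv_comb_at_right])
      (use s in \<open>auto intro!: continuous_on_iter_deriv[OF Ck_comb] simp: iter_deriv_comb_interior\<close>)
  then show ?thesis using iter_deriv_comb_piece[of s "of_int l" l J c] s l by simp
qed

text \<open>Since \<open>\<psi>\<close> has the right-limit convention built in, all samples form
  one linear system in the coefficients with entries \<open>\<psi> s (x - of_int j)\<close>,
  including samples taken at a jump.\<close>

lemma sample_deriv_comb:
  assumes "s < m"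
  shows "sample_deriv m s (comb J c) x = (\<Sum>j\<in>J. \<psi> s (x - of_int j) *\<^sub>R c j)"
proof (cases "s = m - 1 \<and> x \<in> \<int>")
  case True
  then obtain l where l: "x = of_int l" by (auto elim: Ints_cases)
  have "Lim (at_right x) (iter_deriv s (comb J c)) = iter_deriv s (comb_piece l J c) x"
    unfolding l by (rule tendsto_Lim[OF _ iter_deriv_comb_at_right[OF assms]]) simp
  then show ?thesis using iter_deriv_comb_piece[of s x l J c] l assms True by (simp add: sample_deriv_def)
next
  case False
  then have "s + 1 < m \<or> s < m \<and> x \<notin> \<int>" using assms by auto
  then show ?thesis using iter_deriv_comb[of s x J c] False unfolding sample_deriv_def by argo
qed

lemma phi_eq_comb: "comb {0} (\<lambda>_. 1) = \<phi>"
  by (simp add: comb_def fun_eq_iff)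

lemma psi_isCont:
  assumes "s + 1 < m \<or> s < m \<and> x \<notin> \<int>"
  shows "isCont (\<psi> s) x"
proof (cases "s + 1 < m")
  case True
  have "\<psi> s = iter_deriv s \<phi>"
    using iter_deriv_comb[of s _ "{0}" "\<lambda>_. 1 :: real"] True unfolding phi_eq_comb by (auto simp: fun_eq_iff)
  moreover have "continuous_on UNIV (iter_deriv s \<phi>)"
    using continuous_on_iter_deriv[OF Ck_phi] True by simp
  ultimately show ?thesis by (simp add: continuous_on_eq_continuous_within)
next
  case False
  let ?S = "{of_int \<lfloor>x\<rfloor><..<of_int \<lfloor>x\<rfloor> + 1 :: real}"
  have "continuous_on UNIV (iter_deriv s (piece \<lfloor>x\<rfloor>))"
    using continuous_on_iter_deriv[OF Ck_piece order_refl] assms by auto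
  then have "isCont (iter_deriv s (piece \<lfloor>x\<rfloor>)) x" by (simp add: continuous_on_eq_continuous_within)
  moreover have "\<forall>\<^sub>F y in nhds x. \<psi> s y = iter_deriv s (piece \<lfloor>x\<rfloor>) y"
  proof -
    have "x \<in> ?S" by (rule floor_interval) (use assms False in auto)
    moreover have "\<psi> s y = iter_deriv s (piece \<lfloor>x\<rfloor>) y" if "y \<in> ?S" for y
      using floor_interior[of "\<lfloor>x\<rfloor>" y] that unfolding \<psi>_def greaterThanLessThan_iff by metis
    ultimately show ?thesis using eventually_nhds open_greaterThanLessThan by blast
  qed
  ultimately show ?thesis by (simp add: isCont_cong)
qed

lemma psi_bounded: "s < m \<Longrightarrow> \<exists>K. \<forall>x. \<bar>\<psi> s x\<bar> \<le> K"
proof -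
  assume s: "s < m"
  have "\<exists>K. \<forall>x\<in>{of_int l..of_int l + 1}. \<bar>iter_deriv s (piece l) x\<bar> \<le> K" for l
  proof -
    have "compact (iter_deriv s (piece l) ` {of_int l..of_int l + 1})"
      using continuous_on_iter_deriv[OF Ck_piece order_refl] s
      by (intro compact_continuous_image) auto
    then show ?thesis using compact_imp_bounded bounded_iff by (metis imageI real_norm_def)
  qed
  then obtain K where K: "\<And>l x. x \<in> {of_int l..of_int l + 1} \<Longrightarrow> \<bar>iter_deriv s (piece l) x\<bar> \<le> K l" by metis
  have "\<bar>\<psi> s x\<bar> \<le> (\<Sum>l\<in>{0..int m}. \<bar>K l\<bar>)" for x
  proof (cases "x < 0 \<or> real m \<le> x")
    case True
    then show ?thesis by (simp add: psi_zero sum_nonneg)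
  next
    case False
    have "\<bar>\<psi> s x\<bar> \<le> K \<lfloor>x\<rfloor>" unfolding \<psi>_def by (rule K) (simp add: less_imp_le)
    also have "\<dots> \<le> \<bar>K \<lfloor>x\<rfloor>\<bar>" by simp
    also have "\<dots> \<le> (\<Sum>l\<in>{0..int m}. \<bar>K l\<bar>)"
      by (rule member_le_sum) (use False in \<open>auto simp: floor_le_iff\<close>)
    finally show ?thesis .
  qed
  then show ?thesis by blast
qed

end

section \<open>The Schoenberg--Whitney condition\<close>

context peb_weights
begin

text \<open>Uniqueness for the underlying initial value problem, from the top entry downwards: the
  last entry is constant on the cell, hence zero, and then each earlier entry has zero derivative
  and a zero at \<open>z\<close>.\<close>

lemma chain_zero_cell:
  assumes G: "chain G" and z: "z \<in> {of_int l<..<of_int l + 1}" "\<And>k. k < m \<Longrightarrow> G k z = 0"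
    and x: "x \<in> {of_int l<..<of_int l + 1}" and k: "k < m"
  shows "G k x = 0"
proof -
  let ?S = "{of_int l<..<of_int l + 1 :: real}"
  have "\<forall>x\<in>?S. G (m - 1 - d) x = 0" if "d \<le> m - 1" for d
    using that
  proof (induction d)
    case 0
    have "G (m - 1) x = G (m - 1) z" if "x \<in> ?S" for x
      by (rule chain_last[OF G]) (use that z floor_interior[of l x] floor_interior[of l z] in simp)
    then show ?case using z m_pos by simp
  next
    case (Suc d)
    define k where "k = m - 1 - Suc d"
    have k: "k + 1 < m" "m - 1 - d = k + 1" using Suc.prems by (auto simp: k_def)
    have "(G k has_real_derivative 0) (at y within ?S)" if "y \<in> ?S" for y
      using chain_deriv[OF G k(1), of y] Suc k cell_not_Ints[OF that] that
      by (auto intro: has_field_derivative_at_within)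
    then obtain c where "\<And>y. y \<in> ?S \<Longrightarrow> G k y = c"
      using has_field_derivative_zero_constant[of ?S "G k"] by auto
    then show ?case using z k unfolding k_def[symmetric] by fastforce
  qed
  from this[of "m - 1 - k"] show ?thesis using k x by simp
qed

text \<open>Differentiate the zero function and divide by the positive weight; integers are left out
  because the last entry is a derivative only away from them.\<close>

lemma chain_zero_interval:
  assumes G: "chain G" and xy: "\<And>t. x < t \<Longrightarrow> t < y \<Longrightarrow> G 0 t = 0"
    and t: "x < t" "t < y" "t \<notin> \<int>" and k: "k < m"
  shows "G k t = 0"
  using t k
proof (induction k arbitrary: t)
  case (Suc k)
  have "(G k has_real_derivative w (k + 2) t * G (k + 1) t) (at t)"
    by (rule chain_deriv[OF G]) (use Suc.prems in auto)
  moreover have "(G k has_real_derivative 0) (at t)"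
  proof -
    have "((\<lambda>_. 0) has_real_derivative 0) (at t)" by simp
    moreover have "open ({x<..<y} - \<int>)" by (intro open_Diff) auto
    ultimately show ?thesis unfolding has_real_derivative_iff_has_vector_derivative
      by (rule has_vector_derivative_transform_within_open) (use Suc in auto)
  qed
  ultimately have "w (k + 2) t * G (k + 1) t = 0" by (rule DERIV_unique)
  then show ?case using w_pos[of "k + 2" t] Suc.prems by simp
qed (use xy in auto)

text \<open>Source of the end zeros for the count: vanishing on a cell reaches its ends by
  continuity, for every entry but the last, which may jump.\<close>

lemma chain_zero_ends:
  assumes G: "chain G" and z: "\<And>x. x \<in> {of_int l<..<of_int l + 1} \<Longrightarrow> G 0 x = 0" and k: "k + 1 < m"
    and x: "x \<in> {of_int l..of_int l + 1}"
  shows "G k x = 0"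
proof -
  let ?S = "{of_int l<..<of_int l + 1 :: real}"
  have mid: "of_int l + 1/2 \<in> ?S" by simp
  have nint: "of_int l + 1/2 \<notin> (\<int> :: real set)"
  proof
    assume "of_int l + 1/2 \<in> (\<int> :: real set)"
    then obtain i where "of_int l + 1/2 = (of_int i :: real)" by (auto elim: Ints_cases)
    then have "of_int (2 * l + 1) = (of_int (2 * i) :: real)" by simp
    then have "2 * l + 1 = 2 * i" unfolding of_int_eq_iff .
    then show False by presburger
  qed
  have "G j (of_int l + 1/2) = 0" if "j < m" for j
    by (rule chain_zero_interval[OF G, of "of_int l" "of_int l + 1"]) (use z that nint in auto)
  then have "G k y = 0" if "y \<in> ?S" for y
    using chain_zero_cell[OF G mid _ that] k by auto
  moreover have "continuous_on (closure ?S) (G k)"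
    using chain_isCont[OF G k] by (simp add: continuous_at_imp_continuous_on)
  ultimately show ?thesis
    using continuous_constant_on_closure[of ?S "G k" 0 x] x by simp
qed

end

context peb
begin

text \<open>A nonzero combination of translates is restricted to a
  maximal run \<open>[a, b]\<close> of cells on which it does not vanish, starting at its first active
  translate. The translates supported in the run carry more zeros than the zero count allows.\<close>

lemma schoenberg_whitney:
  fixes x :: "nat \<Rightarrow> real" and \<nu> :: "nat \<Rightarrow> nat" and c :: "int \<Rightarrow> real"
  defines "\<sigma> \<equiv> \<lambda>j. \<Sum>i=1..j-1. 1 + \<nu> i"
  assumes incr: "\<And>i j. i \<in> {1..N} \<Longrightarrow> j \<in> {1..N} \<Longrightarrow> i < j \<Longrightarrow> x i < x j"
    and n: "(\<Sum>j=1..N. 1 + \<nu> j) = n"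
    and lo: "\<And>j. j \<in> {1..N} \<Longrightarrow> real (\<sigma> j) + real (\<nu> j) + 1 - real m < x j"
    and hi: "\<And>j. j \<in> {1..N} \<Longrightarrow> x j < real (\<sigma> j) + 1"
    and zero: "\<And>j s. j \<in> {1..N} \<Longrightarrow> s \<le> \<nu> j \<Longrightarrow>
      (\<Sum>i\<in>{1 - int m..int n - int m}. c i * \<psi> s (x j - of_int i)) = 0"
    and i: "i \<in> {1 - int m..int n - int m}"
  shows "c i = 0"
proof (rule ccontr)
  let ?J = "{1 - int m..int n - int m}"
  assume ci: "c i \<noteq> 0"
  define f where "f = comb ?J c"
  define F where "F = comb_chain ?J c"
  have F: "chain F" unfolding F_def by (rule chain_comb)
  have dF: "(F k has_real_derivative w (Suc (Suc k)) y * F (Suc k) y) (at y)"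
    if "Suc k < m" "Suc (Suc k) < m \<or> y \<notin> \<int>" for k y
    using chain_deriv[OF F, of k y] that by simp
  have fF: "f y = w 1 y * F 0 y" for y
    unfolding f_def F_def comb_def by (rule comb_chain_0)
  have f0: "f y = 0 \<longleftrightarrow> F 0 y = 0" for y
    using fF[of y] w_pos[of 1 y] m1 by simp
  have fin: "finite {j \<in> ?J. c j \<noteq> 0}" by (rule finite_subset[of _ ?J]) auto
  define a where "a = Min {j \<in> ?J. c j \<noteq> 0}"
  have "a \<in> {j \<in> ?J. c j \<noteq> 0}" unfolding a_def by (rule Min_in[OF fin]) (use i ci in auto)
  then have a: "a \<in> ?J" "c a \<noteq> 0" by auto
  have a_min: "a \<le> j" if "j \<in> ?J" "c j \<noteq> 0" for j
    unfolding a_def by (rule Min_le[OF fin]) (use that in auto)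
  define zc where "zc l \<longleftrightarrow> (\<forall>y\<in>{of_int l<..<of_int l + 1}. F 0 y = 0)" for l :: int
  have left: "zc (a - 1)"
    unfolding zc_def f0[symmetric] f_def comb_def
  proof (intro ballI sum.neutral)
    fix y j assume y: "y \<in> {of_int (a - 1)<..<of_int (a - 1) + (1 :: real)}" and j: "j \<in> ?J"
    show "\<phi> (y - of_int j) *\<^sub>R c j = 0"
    proof (cases "c j = 0")
      case False
      then have "a \<le> j" using a_min j by blast
      then have "real_of_int a \<le> of_int j" by simp
      then have "y - of_int j < 0" using y by simp
      then show ?thesis by (simp add: phi_zero)
    qed simp
  qed
  have right: "zc (int n)"
    unfolding zc_def f0[symmetric] f_def comb_def
  proof (intro ballI sum.neutral)
    fix y j assume y: "y \<in> {of_int (int n)<..<of_int (int n) + (1 :: real)}" and j: "j \<in> ?J"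
    then have "j \<le> int n - int m" by simp
    then have "real_of_int j \<le> of_int (int n - int m)" by (subst of_int_le_iff)
    then have "real m < y - of_int j" using y by simp
    then show "\<phi> (y - of_int j) *\<^sub>R c j = 0" by (simp add: phi_zero)
  qed
  \<comment> \<open>At the midpoint of cell \<open>a\<close> only translate \<open>a\<close>
    contributes, since earlier coefficients vanish and later translates start at
    \<open>a + 1\<close> or beyond.\<close>
  have start: "\<not> zc a"
  proof
    assume "zc a"
    then have "f (of_int a + 1/2) = 0" unfolding zc_def f0 by simp
    moreover have "f (of_int a + 1/2) = (\<Sum>j\<in>{a}. \<phi> (of_int a + 1/2 - of_int j) *\<^sub>R c j)"
      unfolding f_def comb_def
    proof (rule sum.mono_neutral_right)
      show "\<forall>j\<in>?J - {a}. \<phi> (of_int a + 1/2 - of_int j) *\<^sub>R c j = 0"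
      proof
        fix j assume j: "j \<in> ?J - {a}"
        show "\<phi> (of_int a + 1/2 - of_int j) *\<^sub>R c j = 0"
        proof (cases "c j = 0")
          case False
          then have "a + 1 \<le> j" using a_min[of j] j by auto
          then have "real_of_int (a + 1) \<le> of_int j" by (subst of_int_le_iff)
          then show ?thesis by (simp add: phi_zero)
        qed simp
      qed
    qed (use a in auto)
    ultimately show False using a phi_pos[of "1/2"] m1 by simp
  qed
  have an: "a < int n" using a m1 by simp
  \<comment> \<open>A vanishing cell is certain to occur, at \<open>n\<close> at the latest, where
    all supports have ended.\<close>
  define d where "d = (LEAST d. zc (a + int d))"
  have ex: "zc (a + int (nat (int n - a)))" using right an by simp
  have zd: "zc (a + int d)" unfolding d_def by (rule LeastI[of "\<lambda>d. zc (a + int d)", OF ex])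
  have d_min: "\<not> zc (a + int e)" if "e < d" for e
    using not_less_Least[of e "\<lambda>d. zc (a + int d)"] that unfolding d_def by blast
  have dn: "d \<le> nat (int n - a)" unfolding d_def by (rule Least_le[of "\<lambda>d. zc (a + int d)", OF ex])
  define b where "b = a + int d"
  have b: "zc b" "b \<le> int n" using zd dn an by (auto simp: b_def)
  have nzc: "\<not> zc l" if "a \<le> l" "l < b" for l
    using d_min[of "nat (l - a)"] that by (simp add: b_def)
  have "b \<noteq> a" using b start by metis
  then have ab: "a < b" by (simp add: b_def)
  have ends: "F k (of_int a) = 0 \<and> F k (of_int b) = 0" if "k + 1 < m" for k
    using chain_zero_ends[OF F _ that, of "a - 1" "of_int a"] chain_zero_ends[OF F _ that, of b "of_int b"]
      left b unfolding zc_def by simp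
  have cell_nz: False if "a \<le> l" "l < b" "z \<in> {of_int l<..<of_int l + 1}" "\<And>k. k < m \<Longrightarrow> F k z = 0" for l z
    using chain_zero_cell[OF F that(3,4), of _ 0] nzc[OF that(1,2)] m1 unfolding zc_def by auto
  have nz: "\<exists>t. y < t \<and> t < z \<and> F 0 t \<noteq> 0" if yz: "of_int a \<le> y" "y < z" "z \<le> of_int b" for y z
  proof (rule ccontr)
    assume *: "\<not> ?thesis"
    have "infinite ({y<..<z} - {t \<in> \<int>. y \<le> t \<and> t \<le> z})"
      by (rule Diff_infinite_finite[OF finite_int_segment]) (use yz in auto)
    then obtain t where t: "t \<in> {y<..<z} - {t \<in> \<int>. y \<le> t \<and> t \<le> z}"
      by (metis finite.emptyI ex_in_conv)
    then have t': "y < t" "t < z" "t \<notin> \<int>" by auto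
    show False
    proof (rule cell_nz[of "\<lfloor>t\<rfloor>" t])
      show "a \<le> \<lfloor>t\<rfloor>" "\<lfloor>t\<rfloor> < b" using t' yz by (auto simp: le_floor_iff floor_less_iff)
      show "F k t = 0" if "k < m" for k
        by (rule chain_zero_interval[OF F _ t' that]) (use * in blast)
    qed (rule floor_interval[OF t'(3)])
  qed
  define T where "T = {j \<in> {1..N}. of_int a < x j \<and> x j < of_int b}"
  have inj: "inj_on x T"
    unfolding T_def by (rule inj_onI) (use incr in \<open>metis (no_types, lifting) less_irrefl linorder_neqE_nat mem_Collect_eq\<close>)
  have marks: "\<nu> j + 1 < m \<and> (\<forall>i<\<nu> j + 1. F i (x j) = 0)" if j: "j \<in> T" for j
  proof -
    have j1: "j \<in> {1..N}" and xab: "of_int a < x j" "x j < of_int b" using j by (auto simp: T_def)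
    have lim: "real (\<sigma> j) + real (\<nu> j) + 1 - real m < x j" "x j < real (\<sigma> j) + 1"
      using lo[OF j1] hi[OF j1] .
    have \<nu>m: "\<nu> j < m" using lim by linarith
    have der: "iter_deriv s f (x j) = 0" if "s \<le> \<nu> j" "s + 1 < m \<or> s < m \<and> x j \<notin> \<int>" for s
      using iter_deriv_comb[OF that(2), of ?J c] zero[OF j1 that(1)] unfolding f_def by (simp add: mult.commute)
    show ?thesis
    proof (cases "\<nu> j + 1 < m")
      case True
      \<comment> \<open>The order is at most \<open>m - 1\<close>, so derivatives up to
        \<open>m - 2\<close> suffice; these exist on the whole line, even if the node is an
        integer.\<close>
      have "flat (\<nu> j + 1) f (x j)" unfolding flat_def using der True by auto
      then have "F i (x j) = 0" if "i < \<nu> j + 1" for i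
        using that True
        by (intro chain_zeros[of UNIV "m - 2" F f "x j" "\<nu> j + 1" i])
          (auto intro!: dF continuous_at_imp_continuous_on chain_isCont[OF F] simp: fF)
      then show ?thesis using True by blast
    next
      case False
      \<comment> \<open>A zero of full order: now \<open>lo\<close> and \<open>hi\<close> confine
        the node to the open cell starting at \<open>\<sigma> j\<close>. All chain entries vanish
        there, so the cell vanishes, against the choice of \<open>b\<close>.\<close>
      then have \<nu>: "m = \<nu> j + 1" using \<nu>m by simp
      let ?l = "int (\<sigma> j)"
      let ?S = "{of_int ?l<..<of_int ?l + 1 :: real}"
      have xS: "x j \<in> ?S" using lim \<nu> by simp
      have "flat m f (x j)" unfolding flat_def using der cell_not_Ints[OF xS] \<nu> by auto
      moreover have "continuous_on ?S (F (m - 1))"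
      proof -
        have "F (m - 1) y = F (m - 1) (x j)" if "y \<in> ?S" for y
          by (rule chain_last[OF F]) (use floor_interior[of ?l y] floor_interior[of ?l "x j"] that xS in simp)
        then show ?thesis
          using continuous_on_cong[of ?S ?S "F (m - 1)" "\<lambda>_. F (m - 1) (x j)"] continuous_on_const by blast
      qed
      moreover have "y \<notin> \<int>" if "real (\<sigma> j) < y" "y < real (\<sigma> j) + 1" for y
        using cell_not_Ints[of y ?l] that by simp
      ultimately have "F k (x j) = 0" if "k < m" for k
        using that xS m1 fF
        by (intro chain_zeros[of ?S "m - 1" F f "x j" m k])
          (auto intro!: dF)
      moreover have "a \<le> ?l" "?l < b"
        using xab xS by auto
      ultimately show ?thesis using cell_nz[OF _ _ xS] by blast
    qed
  qed
  define K where "K y = \<nu> (the_inv_into T x y) + 1" for y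
  have Kx: "K (x j) = 1 + \<nu> j" if "j \<in> T" for j
    using the_inv_into_f_f[OF inj that] by (simp add: K_def)
  have "finite T" by (simp add: T_def)
  have "int (\<Sum>y\<in>x ` T. K y) \<le> b - a - int m"
    by (rule zero_count[OF F ends nz]) (use \<open>finite T\<close> marks Kx ab in \<open>auto simp: T_def\<close>)
  then have count: "int (\<Sum>j\<in>T. 1 + \<nu> j) \<le> b - a - int m"
    using Kx by (simp add: sum.reindex[OF inj] cong: sum.cong)
  have blocks: "\<exists>j\<in>{1..M}. \<sigma> j < i \<and> i \<le> \<sigma> j + 1 + \<nu> j" if "0 < i" "i \<le> (\<Sum>j=1..M. 1 + \<nu> j)" for i M
    using that
  proof (induction M)
    case (Suc M)
    show ?case
    proof (cases "i \<le> (\<Sum>j=1..M. 1 + \<nu> j)")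
      case True
      then show ?thesis using Suc by auto
    next
      case False
      then show ?thesis using Suc.prems by (intro bexI[of _ "Suc M"]) (auto simp: \<sigma>_def)
    qed
  qed simp
  \<comment> \<open>These are the numbers \<open>q\<close> of the translates whose support
    \<open>[q - m, q]\<close> lies in \<open>[a, b]\<close>. If \<open>q\<close> is in the block of
    node \<open>j\<close>, then \<open>lo\<close> gives \<open>x j > q - m \<ge> a\<close> and
    \<open>hi\<close> gives \<open>x j < q \<le> b\<close>.\<close>
  have "nat ` {a + int m..b} \<subseteq> (\<Union>j\<in>T. {\<sigma> j + 1..\<sigma> j + 1 + \<nu> j})"
  proof
    fix i assume "i \<in> nat ` {a + int m..b}"
    then have i: "a + int m \<le> int i" "int i \<le> b" "0 < i" using a by auto
    then obtain j where j: "j \<in> {1..N}" "\<sigma> j < i" "i \<le> \<sigma> j + 1 + \<nu> j"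
      using blocks[of i N] b n by auto
    have "of_int (a + int m) \<le> (of_int (int i) :: real)" "of_int (int i) \<le> (of_int b :: real)"
      using i by (subst of_int_le_iff; simp)+
    moreover have "real i \<le> real (\<sigma> j + 1 + \<nu> j)" "real (\<sigma> j + 1) \<le> real i" using j by (subst of_nat_le_iff; simp)+
    ultimately have "of_int a < x j" "x j < of_int b" using lo[OF j(1)] hi[OF j(1)] by auto
    then show "i \<in> (\<Union>j\<in>T. {\<sigma> j + 1..\<sigma> j + 1 + \<nu> j})" using j by (auto simp: T_def)
  qed
  then have "card (nat ` {a + int m..b}) \<le> card (\<Union>j\<in>T. {\<sigma> j + 1..\<sigma> j + 1 + \<nu> j})"
    using \<open>finite T\<close> by (intro card_mono) auto
  also have "\<dots> \<le> (\<Sum>j\<in>T. card {\<sigma> j + 1..\<sigma> j + 1 + \<nu> j})"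
    using \<open>finite T\<close> by (rule card_UN_le)
  also have "\<dots> = (\<Sum>j\<in>T. 1 + \<nu> j)" by simp
  finally have "card (nat ` {a + int m..b}) \<le> (\<Sum>j\<in>T. 1 + \<nu> j)" .
  \<comment> \<open>Here \<open>nat\<close> is injective because \<open>a + m\<close> is at least 1.
    For a run of fewer than \<open>m\<close> cells both sides are 0, and \<open>count\<close> alone
    is then contradictory.\<close>
  moreover have "card (nat ` {a + int m..b}) = nat (b - a - int m + 1)"
    using a by (subst card_image) (auto simp: inj_on_def)
  ultimately have "nat (b - a - int m + 1) \<le> (\<Sum>j\<in>T. 1 + \<nu> j)" by metis
  then have "b - a - int m + 1 \<le> int (\<Sum>j\<in>T. 1 + \<nu> j)" unfolding nat_le_iff .
  then show False using count by simp
qed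

end

section \<open>Uniform invertibility\<close>

text \<open>Tychonoff's theorem, transferred to the function type.\<close>

lemma compact_box: "(\<And>i. compact (S i)) \<Longrightarrow> compact (PiE UNIV S :: ('i \<Rightarrow> 'a::topological_space) set)"
  using compactin_PiE[of "\<lambda>_. euclidean" UNIV S]
  by (simp add: euclidean_product_topology)

lemma continuous_on_coord: "continuous_on A f \<Longrightarrow> continuous_on A (\<lambda>p. f p i)"
  by (rule continuous_on_product_then_coordinatewise)

context peb
begin

definition offset :: "(nat \<Rightarrow> nat) \<Rightarrow> nat \<Rightarrow> nat" where
  "offset \<nu> j = (\<Sum>i=1..j-1. 1 + \<nu> i)"

text \<open>The node condition of a window moved to the origin. The margin \<open>\<epsilon>\<close>
  and the gap \<open>\<delta>\<close> turn the strict inequalities needed for injectivity into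
  closed ones.\<close>

definition admissible :: "nat \<Rightarrow> real \<Rightarrow> real \<Rightarrow> nat \<Rightarrow> (nat \<Rightarrow> nat) \<Rightarrow> (nat \<Rightarrow> real) \<Rightarrow> bool" where
  "admissible n \<epsilon> \<delta> N \<nu> x \<longleftrightarrow>
     (\<Sum>j=1..N. 1 + \<nu> j) = n \<and>
     (\<forall>j\<in>{1..N}. x j \<in> {real (offset \<nu> j) + real (\<nu> j) + 1 - real m + \<epsilon>..real (offset \<nu> j) + 1 - \<epsilon>}) \<and>
     (\<forall>i\<in>{1..N}. \<forall>j\<in>{1..N}. i < j \<longrightarrow> x i + \<delta> \<le> x j)"

abbreviation active :: "nat \<Rightarrow> int set" where
  "active n \<equiv> {1 - int m..int n - int m}"

text \<open>The sum of the absolute values of the samples, written through \<open>\<psi>\<close> to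
  expose its joint dependence on nodes and coefficients.\<close>

definition data_norm :: "nat \<Rightarrow> nat \<Rightarrow> (nat \<Rightarrow> nat) \<Rightarrow> (nat \<Rightarrow> real) \<Rightarrow> (int \<Rightarrow> 'a::real_normed_vector) \<Rightarrow> real" where
  "data_norm n N \<nu> x c =
     (\<Sum>j=1..N. \<Sum>s\<le>\<nu> j. norm (\<Sum>i\<in>active n. \<psi> s (x j - of_int i) *\<^sub>R c i))"

lemma data_norm_nonneg: "0 \<le> data_norm n N \<nu> x c"
  by (simp add: data_norm_def sum_nonneg)

text \<open>For a fixed pattern of multiplicities the admissible nodes with normalized coefficients
  form a compact set. The samples depend continuously on them and never all vanish, by
  \<open>schoenberg_whitney\<close>; \<open>C\<close> is the reciprocal of the minimum.\<close>

lemma pattern_bound: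
  fixes \<nu> :: "nat \<Rightarrow> nat"
  assumes \<epsilon>: "0 < \<epsilon>" and \<delta>: "0 < \<delta>"
  shows "\<exists>C>0. \<forall>x (c :: int \<Rightarrow> real). admissible n \<epsilon> \<delta> N \<nu> x \<longrightarrow>
    (\<Sum>i\<in>active n. \<bar>c i\<bar>) \<le> C * data_norm n N \<nu> x c"
proof -
  \<comment> \<open>Nodes and coefficients are functions on infinite index sets; pinning the
    remaining coordinates to 0 makes each factor of the product compact.\<close>
  define I where "I j = (if j \<in> {1..N} then
    {real (offset \<nu> j) + real (\<nu> j) + 1 - real m + \<epsilon>..real (offset \<nu> j) + 1 - \<epsilon>} else {0})" for j
  define B where "B i = (if i \<in> active n then {-1..1::real} else {0})" for i
  define Z where "Z = (PiE UNIV I \<times> PiE UNIV B) \<inter>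
    ({p. \<forall>i\<in>{1..N}. \<forall>j\<in>{1..N}. i < j \<longrightarrow> fst p i + \<delta> \<le> fst p j} \<inter> {p. (\<Sum>i\<in>active n. \<bar>snd p i\<bar>) = 1})"
  define \<Psi> where "\<Psi> p = data_norm n N \<nu> (fst p) (snd p)" for p :: "(nat \<Rightarrow> real) \<times> (int \<Rightarrow> real)"
  have cf: "continuous_on A (\<lambda>p. fst p j)" for A :: "((nat \<Rightarrow> real) \<times> (int \<Rightarrow> real)) set" and j
    by (rule continuous_on_coord[OF continuous_on_fst[OF continuous_on_id]])
  have cs: "continuous_on A (\<lambda>p. snd p j)" for A :: "((nat \<Rightarrow> real) \<times> (int \<Rightarrow> real)) set" and j
    by (rule continuous_on_coord[OF continuous_on_snd[OF continuous_on_id]])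
  have "closed {p :: (nat \<Rightarrow> real) \<times> (int \<Rightarrow> real). \<forall>i\<in>{1..N}. \<forall>j\<in>{1..N}. i < j \<longrightarrow> fst p i + \<delta> \<le> fst p j}"
  proof -
    have "closed {p :: (nat \<Rightarrow> real) \<times> (int \<Rightarrow> real). i < j \<longrightarrow> fst p i + \<delta> \<le> fst p j}" for i j
      by (cases "i < j") (simp_all add: closed_Collect_le continuous_on_add cf)
    then have "closed (\<Inter>i\<in>{1..N}. \<Inter>j\<in>{1..N}. {p :: (nat \<Rightarrow> real) \<times> (int \<Rightarrow> real). i < j \<longrightarrow> fst p i + \<delta> \<le> fst p j})"
      by (intro closed_INT ballI)
    then show ?thesis by (rule back_subst[of closed]) auto
  qed
  moreover have "closed {p :: (nat \<Rightarrow> real) \<times> (int \<Rightarrow> real). (\<Sum>i\<in>active n. \<bar>snd p i\<bar>) = 1}"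
    by (intro closed_Collect_eq continuous_intros cs)
  ultimately have "compact Z" unfolding Z_def
    by (intro compact_Int_closed compact_Times compact_box closed_Int) (auto simp: I_def B_def)
  \<comment> \<open>A jump of \<open>\<psi> s\<close> is possible only for \<open>s = m - 1\<close>.
    Then \<open>\<nu> j = m - 1\<close>, and the margin interval shrinks to the interior of a single
    cell, so integer shifts avoid the integers too.\<close>
  have noint: "s + 1 < m \<or> s < m \<and> x - of_int i \<notin> \<int>"
    if "x \<in> I j" "j \<in> {1..N}" "s \<le> \<nu> j" for x j s and i :: int
  proof -
    have x: "real (offset \<nu> j) + real (\<nu> j) + 1 - real m < x" "x < real (offset \<nu> j) + 1"
      using that \<epsilon> by (auto simp: I_def)
    then have "\<nu> j < m" by linarith
    moreover have "x - of_int i \<notin> \<int>" if "\<nu> j + 1 = m"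
      using x that by (intro cell_not_Ints[of _ "int (offset \<nu> j) - i"]) auto
    ultimately show ?thesis using that by fastforce
  qed
  have "continuous_on Z \<Psi>"
    unfolding \<Psi>_def data_norm_def
  proof (intro continuous_on_sum continuous_on_norm continuous_on_scaleR cs)
    fix j s and i :: int assume j: "j \<in> {1..N}" and s: "s \<in> {..\<nu> j}"
    have "continuous_on {y. s + 1 < m \<or> s < m \<and> y \<notin> \<int>} (\<psi> s)"
      by (intro continuous_at_imp_continuous_on ballI psi_isCont) blast
    then show "continuous_on Z (\<lambda>p. \<psi> s (fst p j - of_int i))"
    proof (rule continuous_on_compose2)
      show "continuous_on Z (\<lambda>p. fst p j - of_int i)" by (intro continuous_intros cf)
      show "(\<lambda>p. fst p j - of_int i) ` Z \<subseteq> {y. s + 1 < m \<or> s < m \<and> y \<notin> \<int>}"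
        using noint[OF _ j, of _ s i] s unfolding Z_def by (fastforce simp: PiE_def Pi_def)
    qed
  qed
  have adm: "admissible n \<epsilon> \<delta> N \<nu> x \<longleftrightarrow> (\<Sum>j=1..N. 1 + \<nu> j) = n \<and> (\<forall>j\<in>{1..N}. x j \<in> I j) \<and>
     (\<forall>i\<in>{1..N}. \<forall>j\<in>{1..N}. i < j \<longrightarrow> x i + \<delta> \<le> x j)" for x
    unfolding admissible_def I_def by auto
  \<comment> \<open>Homogeneity in the coefficients. Resetting the coordinates outside the index
    ranges to 0 does not change the samples.\<close>
  have normalized: "\<exists>p\<in>Z. (\<Sum>i\<in>active n. \<bar>c i\<bar>) * \<Psi> p = data_norm n N \<nu> x c"
    if a: "admissible n \<epsilon> \<delta> N \<nu> x" and pos: "0 < (\<Sum>i\<in>active n. \<bar>c i\<bar>)" for x and c :: "int \<Rightarrow> real"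
  proof -
    define t where "t = (\<Sum>i\<in>active n. \<bar>c i\<bar>)"
    have t: "0 < t" using pos by (simp add: t_def)
    define x' where "x' j = (if j \<in> {1..N} then x j else 0)" for j
    define c' where "c' i = (if i \<in> active n then c i / t else 0)" for i
    have "\<bar>c i\<bar> \<le> t" if "i \<in> active n" for i
      unfolding t_def by (rule member_le_sum) (use that in auto)
    then have "\<bar>c i / t\<bar> \<le> 1" if "i \<in> active n" for i using t that by simp
    then have "- 1 \<le> c i / t \<and> c i / t \<le> 1" if "i \<in> active n" for i
      using abs_le_D1 abs_le_D2 minus_le_iff that by metis
    then have "c' \<in> PiE UNIV B" unfolding PiE_UNIV_domain c'_def B_def by simp
    moreover have "x' \<in> PiE UNIV I" using a by (auto simp: adm x'_def I_def)
    moreover have "(\<Sum>i\<in>active n. \<bar>c' i\<bar>) = 1"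
      using t by (simp add: c'_def t_def flip: sum_divide_distrib)
    ultimately have "(x', c') \<in> Z" using a unfolding Z_def adm by (simp add: x'_def)
    moreover have "t * \<Psi> (x', c') = data_norm n N \<nu> x c"
    proof -
      have "t * norm (\<Sum>i\<in>active n. \<psi> s (x' j - of_int i) *\<^sub>R c' i) = norm (\<Sum>i\<in>active n. \<psi> s (x j - of_int i) *\<^sub>R c i)"
        if "j \<in> {1..N}" for j s
      proof -
        have "(\<Sum>i\<in>active n. \<psi> s (x j - of_int i) *\<^sub>R c i) = t * (\<Sum>i\<in>active n. \<psi> s (x' j - of_int i) *\<^sub>R c' i)"
          unfolding sum_distrib_left using t that by (intro sum.cong) (auto simp: x'_def c'_def)
        then show ?thesis using t by (simp add: abs_mult)
      qed
      then show ?thesis unfolding \<Psi>_def data_norm_def sum_distrib_left fst_conv snd_conv by (intro sum.cong) auto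
    qed
    ultimately show ?thesis unfolding t_def by blast
  qed
  show ?thesis
  proof (cases "Z = {} \<or> (\<Sum>j=1..N. 1 + \<nu> j) \<noteq> n")
    case True
    have "(\<Sum>i\<in>active n. \<bar>c i\<bar>) \<le> 1 * data_norm n N \<nu> x c" if "admissible n \<epsilon> \<delta> N \<nu> x" for x and c :: "int \<Rightarrow> real"
    proof -
      have "Z = {}" using True that adm by blast
      then have "\<not> 0 < (\<Sum>i\<in>active n. \<bar>c i\<bar>)" using normalized[OF that, of c] by blast
      then show ?thesis using data_norm_nonneg[of n N \<nu> x c] by linarith
    qed
    then show ?thesis by (intro exI[of _ 1]) auto
  next
    case False
    then obtain p where p: "p \<in> Z" "\<And>q. q \<in> Z \<Longrightarrow> \<Psi> p \<le> \<Psi> q"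
      using continuous_attains_inf[OF \<open>compact Z\<close> _ \<open>continuous_on Z \<Psi>\<close>] by blast
    have "\<Psi> p \<noteq> 0"
    proof
      assume 0: "\<Psi> p = 0"
      have "\<forall>j\<in>{1..N}. \<forall>s\<in>{..\<nu> j}. norm (\<Sum>i\<in>active n. \<psi> s (fst p j - of_int i) *\<^sub>R snd p i) = 0"
        using 0 unfolding \<Psi>_def data_norm_def by (subst (asm) sum_nonneg_eq_0_iff, simp, simp add: sum_nonneg)
          (subst (asm) sum_nonneg_eq_0_iff, auto)
      then have z: "(\<Sum>i\<in>active n. snd p i * \<psi> s (fst p j - of_int i)) = 0" if "j \<in> {1..N}" "s \<le> \<nu> j" for j s
        using that by (auto simp: mult.commute)
      have I: "fst p j \<in> I j" for j using p(1) by (auto simp: Z_def)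
      have "snd p i = 0" if "i \<in> active n" for i
      proof (rule schoenberg_whitney[where N = N and x = "fst p" and \<nu> = \<nu> and n = n, OF _ _ _ _ z that])
        show "fst p i < fst p j" if "i \<in> {1..N}" "j \<in> {1..N}" "i < j" for i j
        proof -
          have "fst p i + \<delta> \<le> fst p j" using p(1) that unfolding Z_def by blast
          then show ?thesis using \<delta> by simp
        qed
        show "real (\<Sum>i=1..j-1. 1 + \<nu> i) + real (\<nu> j) + 1 - real m < fst p j" if "j \<in> {1..N}" for j
          using I[of j] that \<epsilon> by (auto simp: I_def offset_def)
        show "fst p j < real (\<Sum>i=1..j-1. 1 + \<nu> i) + 1" if "j \<in> {1..N}" for j
          using I[of j] that \<epsilon> by (auto simp: I_def offset_def)
      qed (use False in auto)
      then have "(\<Sum>i\<in>active n. \<bar>snd p i\<bar>) = 0" by simp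
      then show False using p(1) by (simp add: Z_def)
    qed
    then have pos: "0 < \<Psi> p" using data_norm_nonneg[of n N \<nu> "fst p" "snd p"] by (simp add: \<Psi>_def)
    have "(\<Sum>i\<in>active n. \<bar>c i\<bar>) \<le> inverse (\<Psi> p) * data_norm n N \<nu> x c"
      if a: "admissible n \<epsilon> \<delta> N \<nu> x" for x and c :: "int \<Rightarrow> real"
    proof (cases "0 < (\<Sum>i\<in>active n. \<bar>c i\<bar>)")
      case True
      then obtain q where q: "q \<in> Z" "(\<Sum>i\<in>active n. \<bar>c i\<bar>) * \<Psi> q = data_norm n N \<nu> x c"
        using normalized[OF a] by blast
      have "(\<Sum>i\<in>active n. \<bar>c i\<bar>) * \<Psi> p \<le> data_norm n N \<nu> x c"
        using p(2)[OF q(1)] True unfolding q(2)[symmetric] by (intro mult_left_mono) auto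
      then show ?thesis using pos by (simp add: field_simps)
    next
      case False
      then show ?thesis using data_norm_nonneg[of n N \<nu> x c] pos
        by (meson inverse_nonnegative_iff_nonnegative less_imp_le linorder_not_less mult_nonneg_nonneg order_trans)
    qed
    then show ?thesis using pos by (intro exI[of _ "inverse (\<Psi> p)"]) auto
  qed
qed

text \<open>Up to values of \<open>\<nu>\<close> beyond \<open>N\<close> there are finitely many
  patterns, with \<open>N\<close> and all \<open>\<nu> j\<close> at most \<open>n\<close>, so the
  sum of their constants serves all. Real and imaginary parts are treated separately, which doubles
  \<open>D\<close>; the added 1 ensures positivity.\<close>

lemma uniform_bound:
  assumes \<epsilon>: "0 < \<epsilon>" and \<delta>: "0 < \<delta>"
  shows "\<exists>C>0. \<forall>N \<nu> x (c :: int \<Rightarrow> complex). admissible n \<epsilon> \<delta> N \<nu> x \<longrightarrow>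
    (\<Sum>i\<in>active n. norm (c i)) \<le> C * data_norm n N \<nu> x c"
proof -
  obtain C where C0: "\<And>N \<nu>. 0 < C N \<nu>" and C: "\<And>N \<nu> x (c :: int \<Rightarrow> real). admissible n \<epsilon> \<delta> N \<nu> x \<Longrightarrow>
      (\<Sum>i\<in>active n. \<bar>c i\<bar>) \<le> C N \<nu> * data_norm n N \<nu> x c"
    using pattern_bound[OF \<epsilon> \<delta>, of n] by metis
  define Pt where "Pt = (SIGMA N:{..n}. {\<nu> :: nat \<Rightarrow> nat. \<forall>j. (j \<in> {1..N} \<longrightarrow> \<nu> j \<in> {..n}) \<and> (j \<notin> {1..N} \<longrightarrow> \<nu> j = 0)})"
  have fin: "finite Pt" unfolding Pt_def
    by (intro finite_SigmaI finite_set_of_finite_funs) auto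
  define D where "D = (\<Sum>(N, \<nu>)\<in>Pt. C N \<nu>)"
  have real_bound: "(\<Sum>i\<in>active n. \<bar>c i\<bar>) \<le> D * data_norm n N \<nu> x c"
    if a: "admissible n \<epsilon> \<delta> N \<nu> x" for N \<nu> x and c :: "int \<Rightarrow> real"
  proof -
    define \<nu>' where "\<nu>' j = (if j \<in> {1..N} then \<nu> j else 0)" for j
    have sum: "(\<Sum>j=1..N. 1 + \<nu> j) = n" using a by (simp add: admissible_def)
    have "(\<Sum>j=1..N. 1 + \<nu> j) = N + (\<Sum>j=1..N. \<nu> j)" unfolding sum.distrib by simp
    then have "N \<le> n" using sum by linarith
    moreover have "\<nu> j \<le> n" if "j \<in> {1..N}" for j
    proof -
      have "1 + \<nu> j \<le> (\<Sum>j=1..N. 1 + \<nu> j)" by (rule member_le_sum) (use that in auto)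
      then show ?thesis using sum by simp
    qed
    ultimately have mem: "(N, \<nu>') \<in> Pt" by (auto simp: Pt_def \<nu>'_def)
    have off: "offset \<nu>' j = offset \<nu> j" if "j \<in> {1..N}" for j
      unfolding offset_def \<nu>'_def using that by (intro sum.cong) auto
    have a': "admissible n \<epsilon> \<delta> N \<nu>' x"
      using a unfolding admissible_def by (simp add: off) (simp add: \<nu>'_def)
    have "data_norm n N \<nu>' x c = data_norm n N \<nu> x c"
      unfolding data_norm_def by (intro sum.cong) (auto simp: \<nu>'_def)
    then have "(\<Sum>i\<in>active n. \<bar>c i\<bar>) \<le> C N \<nu>' * data_norm n N \<nu> x c" using C[OF a', of c] by simp
    also have "\<dots> \<le> D * data_norm n N \<nu> x c"
    proof (rule mult_right_mono[OF _ data_norm_nonneg])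
      show "C N \<nu>' \<le> D" unfolding D_def using member_le_sum[OF mem, of "\<lambda>(N, \<nu>). C N \<nu>"] fin C0 by (auto simp: less_imp_le)
    qed
    finally show ?thesis .
  qed
  have D: "0 \<le> D" unfolding D_def using C0 by (intro sum_nonneg) (auto simp: less_imp_le)
  have "(\<Sum>i\<in>active n. norm (c i)) \<le> (2 * D + 1) * data_norm n N \<nu> x c"
    if a: "admissible n \<epsilon> \<delta> N \<nu> x" for N \<nu> x and c :: "int \<Rightarrow> complex"
  proof -
    have re: "data_norm n N \<nu> x (\<lambda>i. Re (c i)) \<le> data_norm n N \<nu> x c"
      unfolding data_norm_def
    proof (intro sum_mono)
      fix j s
      show "norm (\<Sum>i\<in>active n. \<psi> s (x j - of_int i) *\<^sub>R Re (c i)) \<le> norm (\<Sum>i\<in>active n. \<psi> s (x j - of_int i) *\<^sub>R c i)"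
        using abs_Re_le_cmod[of "\<Sum>i\<in>active n. \<psi> s (x j - of_int i) *\<^sub>R c i"] by simp
    qed
    have im: "data_norm n N \<nu> x (\<lambda>i. Im (c i)) \<le> data_norm n N \<nu> x c"
      unfolding data_norm_def
    proof (intro sum_mono)
      fix j s
      show "norm (\<Sum>i\<in>active n. \<psi> s (x j - of_int i) *\<^sub>R Im (c i)) \<le> norm (\<Sum>i\<in>active n. \<psi> s (x j - of_int i) *\<^sub>R c i)"
        using abs_Im_le_cmod[of "\<Sum>i\<in>active n. \<psi> s (x j - of_int i) *\<^sub>R c i"] by simp
    qed
    have "(\<Sum>i\<in>active n. norm (c i)) \<le> (\<Sum>i\<in>active n. \<bar>Re (c i)\<bar> + \<bar>Im (c i)\<bar>)"
      by (intro sum_mono cmod_le)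
    also have "\<dots> = (\<Sum>i\<in>active n. \<bar>Re (c i)\<bar>) + (\<Sum>i\<in>active n. \<bar>Im (c i)\<bar>)" by (rule sum.distrib)
    also have "\<dots> \<le> D * data_norm n N \<nu> x (\<lambda>i. Re (c i)) + D * data_norm n N \<nu> x (\<lambda>i. Im (c i))"
      by (intro add_mono real_bound[OF a])
    also have "\<dots> \<le> D * data_norm n N \<nu> x c + D * data_norm n N \<nu> x c"
      by (intro add_mono mult_left_mono re im D)
    also have "\<dots> \<le> (2 * D + 1) * data_norm n N \<nu> x c"
      using data_norm_nonneg[of n N \<nu> x c] by (simp add: algebra_simps)
    finally show ?thesis .
  qed
  then show ?thesis using D by (intro exI[of _ "2 * D + 1"]) auto
qed

end

section \<open>Local norm estimates\<close>

text \<open>Comparison with the largest term. \<open>D\<close> is any bound on the number of terms,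
  so that one constant can serve all windows.\<close>

lemma powr_sum_le:
  fixes a :: "'i \<Rightarrow> real"
  assumes I: "finite I" and a: "\<And>i. i \<in> I \<Longrightarrow> 0 \<le> a i" and P: "0 < P" and D: "real (card I) \<le> D"
  shows "(\<Sum>i\<in>I. a i) powr P \<le> D powr P * (\<Sum>i\<in>I. a i powr P)"
proof (cases "I = {}")
  case False
  define b where "b = Max (a ` I)"
  have "b \<in> a ` I" unfolding b_def by (rule Max_in) (use I False in auto)
  then obtain i where i: "i \<in> I" "b = a i" by auto
  have b: "a j \<le> b" if "j \<in> I" for j unfolding b_def by (rule Max_ge) (use I that in auto)
  have "(\<Sum>i\<in>I. a i) \<le> real (card I) * b" by (rule sum_bounded_above) (rule b)
  also have "\<dots> \<le> D * b" by (rule mult_right_mono[OF D]) (use i a in auto)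
  finally have "(\<Sum>i\<in>I. a i) powr P \<le> (D * b) powr P"
    by (intro powr_mono2) (use P a in \<open>auto simp: sum_nonneg\<close>)
  also have "\<dots> = D powr P * a i powr P" using D i a by (simp add: powr_mult)
  also have "\<dots> \<le> D powr P * (\<Sum>i\<in>I. a i powr P)"
    by (intro mult_left_mono member_le_sum) (use i I in auto)
  finally show ?thesis .
qed (use P in simp)

text \<open>Distinct points of \<open>X\<close> in a cell have distinct
  \<open>\<lfloor>x / e\<rfloor>\<close>, and these values range over
  \<open>\<lfloor>1 / e\<rfloor> + 2\<close> consecutive integers.\<close>

lemma uniform_discrete_card_cell:
  assumes e: "0 < e" "\<And>x y. x \<in> X \<Longrightarrow> y \<in> X \<Longrightarrow> dist x y < e \<Longrightarrow> x = (y::real)"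
    and F: "finite F" "F \<subseteq> X"
  shows "card {x \<in> F. \<lfloor>x\<rfloor> = n} \<le> nat (\<lfloor>1 / e\<rfloor> + 2)"
proof -
  have "inj_on (\<lambda>x. \<lfloor>x / e\<rfloor>) {x \<in> F. \<lfloor>x\<rfloor> = n}"
  proof (rule inj_onI)
    fix x y assume "x \<in> {x \<in> F. \<lfloor>x\<rfloor> = n}" "y \<in> {x \<in> F. \<lfloor>x\<rfloor> = n}" and eq: "\<lfloor>x / e\<rfloor> = \<lfloor>y / e\<rfloor>"
    then have xy: "x \<in> X" "y \<in> X" using F by auto
    have "\<bar>x / e - y / e\<bar> < 1" using eq by linarith
    then have "dist x y < e" using e(1) by (simp add: dist_real_def field_simps flip: diff_divide_distrib)
    then show "x = y" using e(2) xy by blast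
  qed
  moreover have "(\<lambda>x. \<lfloor>x / e\<rfloor>) ` {x \<in> F. \<lfloor>x\<rfloor> = n} \<subseteq> {\<lfloor>of_int n / e\<rfloor>..\<lfloor>of_int n / e\<rfloor> + \<lfloor>1 / e\<rfloor> + 1}"
  proof (clarsimp)
    fix x :: real
    have "of_int \<lfloor>x\<rfloor> / e \<le> x / e" "x / e \<le> (of_int \<lfloor>x\<rfloor> + 1) / e"
      using e(1) by (auto intro!: divide_right_mono)
    then have *: "of_int \<lfloor>x\<rfloor> / e \<le> x / e" "x / e \<le> of_int \<lfloor>x\<rfloor> / e + 1 / e" by (simp_all add: add_divide_distrib)
    then show "\<lfloor>of_int \<lfloor>x\<rfloor> / e\<rfloor> \<le> \<lfloor>x / e\<rfloor> \<and> \<lfloor>x / e\<rfloor> \<le> \<lfloor>of_int \<lfloor>x\<rfloor> / e\<rfloor> + \<lfloor>1 / e\<rfloor> + 1"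
      by (auto simp: floor_mono) linarith
  qed
  ultimately have "card {x \<in> F. \<lfloor>x\<rfloor> = n} \<le> card {\<lfloor>of_int n / e\<rfloor>..\<lfloor>of_int n / e\<rfloor> + \<lfloor>1 / e\<rfloor> + 1}"
    by (rule card_inj_on_le) auto
  then show ?thesis by simp
qed

context peb
begin

section \<open>Infinite series of translates compared locally with their coefficients\<close>

definition full :: "(int \<Rightarrow> complex) \<Rightarrow> real \<Rightarrow> complex" where
  "full c x = (\<Sum>\<^sub>\<infinity>l\<in>UNIV. c l * complex_of_real (\<phi> (x - of_int l)))"

text \<open>The indices are those of the \<open>m\<close> translates alive on the cell starting at
  \<open>n\<close>; function values and samples are both compared with this sum.\<close>

definition cell_norm :: "(int \<Rightarrow> complex) \<Rightarrow> int \<Rightarrow> real" where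
  "cell_norm c n = (\<Sum>j\<in>{n - int m + 1..n}. norm (c j))"

lemma cell_norm_nonneg: "0 \<le> cell_norm c n"
  by (simp add: cell_norm_def sum_nonneg)

lemma shift_inv_spaceE:
  assumes "f \<in> shift_inv_space p \<phi>"
  obtains c where "f = full c"
  using assms by (auto simp: shift_inv_space_def full_def[abs_def])

text \<open>The interval exceeds the cell by one unit on either side, so that derivatives and right
  limits at its ends can be computed from the finite sum.\<close>

lemma full_eq_comb:
  assumes x: "of_int n - 1 < x" "x < of_int n + 2"
  shows "full c x = comb {n - int m - 1..n + 2} c x"
proof -
  have "full c x = infsum (\<lambda>l. c l * complex_of_real (\<phi> (x - of_int l))) {n - int m - 1..n + 2}"
    unfolding full_def
  proof (rule infsum_cong_neutral)
    fix l assume l: "l \<in> UNIV - {n - int m - 1..n + 2}"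
    then consider "n + 3 \<le> l" | "l \<le> n - int m - 2" by force
    then have "x - of_int l < 0 \<or> real m < x - of_int l"
    proof cases
      case 1
      then have "of_int (n + 3) \<le> real_of_int l" by (subst of_int_le_iff)
      then show ?thesis using x by simp
    next
      case 2
      then have "real_of_int l \<le> of_int (n - int m - 2)" by (subst of_int_le_iff)
      then show ?thesis using x by simp
    qed
    then show "c l * complex_of_real (\<phi> (x - of_int l)) = 0" by (simp add: phi_zero)
  qed auto
  also have "\<dots> = comb {n - int m - 1..n + 2} c x"
    by (simp add: comb_def scaleR_conv_of_real mult.commute)
  finally show ?thesis .
qed

lemma psi_sum_cong:
  fixes c :: "int \<Rightarrow> 'a::real_normed_vector"
  assumes J: "finite J" "{\<lfloor>x\<rfloor> - int m + 1..\<lfloor>x\<rfloor>} \<subseteq> J"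
  shows "(\<Sum>j\<in>J. \<psi> s (x - of_int j) *\<^sub>R c j) =
    (\<Sum>j\<in>{\<lfloor>x\<rfloor> - int m + 1..\<lfloor>x\<rfloor>}. \<psi> s (x - of_int j) *\<^sub>R c j)"
proof (rule sum.mono_neutral_right[OF J], rule ballI)
  fix j assume "j \<in> J - {\<lfloor>x\<rfloor> - int m + 1..\<lfloor>x\<rfloor>}"
  then consider "\<lfloor>x\<rfloor> + 1 \<le> j" | "j \<le> \<lfloor>x\<rfloor> - int m" by force
  then have "x - of_int j < 0 \<or> real m \<le> x - of_int j"
  proof cases
    case 1
    then have "of_int (\<lfloor>x\<rfloor> + 1) \<le> real_of_int j" by (subst of_int_le_iff)
    then show ?thesis by simp linarith
  next
    case 2
    then have "real_of_int j \<le> of_int (\<lfloor>x\<rfloor> - int m)" by (subst of_int_le_iff)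
    then show ?thesis by simp linarith
  qed
  then show "\<psi> s (x - of_int j) *\<^sub>R c j = 0" by (simp add: psi_zero)
qed

lemma sample_deriv_full:
  assumes "s < m" "finite J" "{\<lfloor>x\<rfloor> - int m + 1..\<lfloor>x\<rfloor>} \<subseteq> J"
  shows "sample_deriv m s (full c) x = (\<Sum>j\<in>J. \<psi> s (x - of_int j) *\<^sub>R c j)"
proof -
  let ?n = "\<lfloor>x\<rfloor>"
  let ?S = "{of_int ?n - 1<..<of_int ?n + 2 :: real}"
  let ?J = "{?n - int m - 1..?n + 2}"
  have eq: "iter_deriv s (full c) y = iter_deriv s (comb ?J c) y" if "y \<in> ?S" for y
    by (rule iter_deriv_cong_open[OF _ that]) (auto intro: full_eq_comb)
  have xS: "x \<in> ?S" by simp linarith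
  have "\<forall>\<^sub>F y in at_right x. iter_deriv s (full c) y = iter_deriv s (comb ?J c) y"
    unfolding eventually_at_right_field using eq xS by (intro exI[of _ "of_int ?n + 2"]) auto
  then have "sample_deriv m s (full c) x = sample_deriv m s (comb ?J c) x"
    using eq[OF xS] Lim_cong[OF _ refl] unfolding sample_deriv_def by metis
  also have "\<dots> = (\<Sum>j\<in>?J. \<psi> s (x - of_int j) *\<^sub>R c j)"
    by (rule sample_deriv_comb[OF assms(1)])
  also have "\<dots> = (\<Sum>j\<in>J. \<psi> s (x - of_int j) *\<^sub>R c j)"
    using psi_sum_cong[OF assms(2,3), of s c] psi_sum_cong[of ?J x s c] by simp
  finally show ?thesis .
qed

lemma full_psi:
  assumes "finite J" "{\<lfloor>x\<rfloor> - int m + 1..\<lfloor>x\<rfloor>} \<subseteq> J"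
  shows "full c x = (\<Sum>j\<in>J. \<psi> 0 (x - of_int j) *\<^sub>R c j)"
proof -
  let ?J = "{\<lfloor>x\<rfloor> - int m - 1..\<lfloor>x\<rfloor> + 2}"
  have "\<psi> 0 y = \<phi> y" for y using phi_piece[of y] by (simp add: \<psi>_def)
  then have "full c x = (\<Sum>j\<in>?J. \<psi> 0 (x - of_int j) *\<^sub>R c j)"
    using full_eq_comb[of "\<lfloor>x\<rfloor>" x c] by (simp add: comb_def) linarith
  also have "\<dots> = (\<Sum>j\<in>J. \<psi> 0 (x - of_int j) *\<^sub>R c j)"
    using psi_sum_cong[OF assms, of 0 c] psi_sum_cong[of ?J x 0 c] by simp
  finally show ?thesis .
qed

lemma pointwise_bound:
  "\<exists>K>0. \<forall>c x. norm (full c x) \<le> K * cell_norm c \<lfloor>x\<rfloor> \<and>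
     (\<forall>s<m. norm (sample_deriv m s (full c) x) \<le> K * cell_norm c \<lfloor>x\<rfloor>)"
proof -
  obtain K0 where K0: "\<And>s x. s < m \<Longrightarrow> \<bar>\<psi> s x\<bar> \<le> K0 s" using psi_bounded by metis
  define K where "K = (\<Sum>s<m. \<bar>K0 s\<bar>) + 1"
  have "\<bar>\<psi> s x\<bar> \<le> K" if "s < m" for s x
  proof -
    have "\<bar>\<psi> s x\<bar> \<le> \<bar>K0 s\<bar>" using K0[OF that, of x] by linarith
    also have "\<dots> \<le> (\<Sum>s<m. \<bar>K0 s\<bar>)" by (rule member_le_sum) (use that in auto)
    finally show ?thesis by (simp add: K_def)
  qed
  then have "norm (\<Sum>j\<in>{\<lfloor>x\<rfloor> - int m + 1..\<lfloor>x\<rfloor>}. \<psi> s (x - of_int j) *\<^sub>R c j) \<le> K * cell_norm c \<lfloor>x\<rfloor>"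
    if "s < m" for s x and c :: "int \<Rightarrow> complex"
    unfolding cell_norm_def sum_distrib_left
    by (intro order_trans[OF norm_sum] sum_mono) (use that in \<open>auto intro!: mult_right_mono\<close>)
  moreover have "0 < K" unfolding K_def by (intro add_nonneg_pos sum_nonneg) auto
  ultimately show ?thesis
    using sample_deriv_full[OF _ _ order_refl] full_psi[OF _ order_refl] m1
    by (intro exI[of _ K]) auto
qed

text \<open>The indices \<open>l + i\<close> with \<open>i\<close> in \<open>active k\<close> are
  those of all translates alive on the \<open>k - m + 1\<close> cells from \<open>l\<close>
  on.\<close>

lemma cell_norm_le_shift:
  assumes "l \<le> n" "n - int m + 1 \<ge> l + 1 - int m" "n \<le> l + (int k - int m)"
  shows "cell_norm c n \<le> (\<Sum>i\<in>active k. norm (c (l + i)))"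
proof -
  have "cell_norm c n \<le> (\<Sum>j\<in>(\<lambda>i. l + i) ` active k. norm (c j))"
    unfolding cell_norm_def
  proof (rule sum_mono2)
    show "{n - int m + 1..n} \<subseteq> (\<lambda>i. l + i) ` active k"
    proof
      fix j assume "j \<in> {n - int m + 1..n}"
      then show "j \<in> (\<lambda>i. l + i) ` active k" using assms by (intro image_eqI[of _ _ "j - l"]) auto
    qed
  qed auto
  also have "\<dots> = (\<Sum>i\<in>active k. norm (c (l + i)))" by (subst sum.reindex) (auto simp: inj_on_def)
  finally show ?thesis .
qed

text \<open>Subtracting \<open>l\<close> from the nodes is undone by re-indexing the coefficients,
  so the constant found at the origin applies to every window.\<close>

lemma data_norm_shift:
  assumes m: "\<And>j. j \<in> {1..N} \<Longrightarrow> \<nu> j < m"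
    and x: "\<And>j. j \<in> {1..N} \<Longrightarrow> l \<le> \<lfloor>x j\<rfloor> \<and> \<lfloor>x j\<rfloor> \<le> l + (int k - int m)"
  shows "data_norm k N \<nu> (\<lambda>j. x j - of_int l) (\<lambda>i. c (l + i)) =
    (\<Sum>j=1..N. \<Sum>s\<le>\<nu> j. norm (sample_deriv m s (full c) (x j)))"
  unfolding data_norm_def
proof (intro sum.cong refl)
  fix j s assume j: "j \<in> {1..N}" and s: "s \<in> {..\<nu> j}"
  have "(\<Sum>i\<in>active k. \<psi> s (x j - of_int l - of_int i) *\<^sub>R c (l + i)) =
      (\<Sum>i\<in>(\<lambda>i. l + i) ` active k. \<psi> s (x j - of_int i) *\<^sub>R c i)"
    by (subst sum.reindex) (auto simp: inj_on_def algebra_simps)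
  also have "\<dots> = sample_deriv m s (full c) (x j)"
  proof (rule sample_deriv_full[symmetric])
    show "s < m" using m[OF j] s by simp
    show "{\<lfloor>x j\<rfloor> - int m + 1..\<lfloor>x j\<rfloor>} \<subseteq> (\<lambda>i. l + i) ` active k"
    proof
      fix i assume "i \<in> {\<lfloor>x j\<rfloor> - int m + 1..\<lfloor>x j\<rfloor>}"
      then show "i \<in> (\<lambda>i. l + i) ` active k" using x[OF j] by (intro image_eqI[of _ _ "i - l"]) auto
    qed
  qed simp
  finally show "norm (\<Sum>i\<in>active k. \<psi> s (x j - of_int l - of_int i) *\<^sub>R c (l + i)) =
      norm (sample_deriv m s (full c) (x j))" by simp
qed

lemma full_measurable [measurable]: "full c \<in> borel_measurable borel"
proof (rule borel_measurable_continuous_countable_exceptions)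
  show "countable (\<int> :: real set)" unfolding Ints_def by simp
  show "continuous_on (- \<int>) (full c)"
  proof (intro continuous_at_imp_continuous_on ballI)
    fix x :: real assume x: "x \<in> - \<int>"
    let ?n = "\<lfloor>x\<rfloor>"
    let ?J = "{?n - int m - 1..?n + 2}"
    have "continuous_on UNIV (comb_piece ?n ?J c)" using Ck_continuous[OF Ck_comb_piece[of 0]] m1 by simp
    then have "isCont (comb_piece ?n ?J c) x" by (simp add: continuous_on_eq_continuous_within)
    moreover have "\<forall>\<^sub>F y in nhds x. full c y = comb_piece ?n ?J c y"
    proof -
      let ?S = "{of_int ?n<..<of_int ?n + 1 :: real}"
      have "x \<in> ?S" using floor_interval x by blast
      moreover have "full c y = comb_piece ?n ?J c y" if y: "y \<in> ?S" for y
      proof -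
        have "full c y = comb ?J c y" by (rule full_eq_comb) (use y in auto)
        also have "\<dots> = comb_piece ?n ?J c y" by (rule comb_eq_piece) (use floor_interior[of ?n y] y in auto)
        finally show ?thesis .
      qed
      ultimately show ?thesis using eventually_nhds open_greaterThanLessThan by blast
    qed
    ultimately show "isCont (full c) x" by (simp add: isCont_cong)
  qed
qed

text \<open>The case \<open>n = m\<close> of \<open>uniform_bound\<close> with simple nodes. Spacing
  \<open>1 / (m + 2)\<close> leaves room for \<open>\<theta>\<close> to move all nodes by up to one
  spacing while a margin of one spacing remains at both ends; hence the constant is independent of
  \<open>\<theta>\<close>.\<close>

lemma cell_points_bound:
  "\<exists>C>0. \<forall>c n \<theta>. 0 \<le> \<theta> \<longrightarrow> \<theta> \<le> 1 \<longrightarrow>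
     cell_norm c n \<le> C * (\<Sum>j=1..m. norm (full c (of_int n + real j / (real m + 2) + \<theta> / (real m + 2))))"
proof -
  define e where "e = 1 / (real m + 2)"
  have e: "0 < e" by (simp add: e_def)
  obtain C where C: "0 < C" "\<And>N \<nu> x (c :: int \<Rightarrow> complex). admissible m e e N \<nu> x \<Longrightarrow>
      (\<Sum>i\<in>active m. norm (c i)) \<le> C * data_norm m N \<nu> x c"
    using uniform_bound[OF e e, of m] by metis
  have "cell_norm c n \<le> C * (\<Sum>j=1..m. norm (full c (of_int n + real j / (real m + 2) + \<theta> / (real m + 2))))"
    if \<theta>: "0 \<le> \<theta>" "\<theta> \<le> 1" for c n \<theta>
  proof -
    define x where "x j = real j * e + \<theta> * e" for j :: nat
    have x: "e \<le> x j" "x j \<le> 1 - e" if "j \<in> {1..m}" for j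
    proof -
      have "1 * e \<le> real j * e" "real j * e \<le> real m * e" using that e by (auto intro!: mult_right_mono)
      moreover have "0 \<le> \<theta> * e" "\<theta> * e \<le> 1 * e" using \<theta> e by (auto intro!: mult_right_mono)
      moreover have "real m * e = 1 - 2 * e" by (simp add: e_def field_simps)
      ultimately show "e \<le> x j" "x j \<le> 1 - e" unfolding x_def by linarith+
    qed
    have "x i + e \<le> x j" if "i < j" for i j
    proof -
      have "(real i + 1) * e \<le> real j * e" using that e by (intro mult_right_mono) auto
      then show ?thesis by (simp add: x_def algebra_simps)
    qed
    then have "admissible m e e m (\<lambda>_. 0) x"
      using x unfolding admissible_def offset_def by (fastforce simp: of_nat_diff)
    from C(2)[OF this, of "\<lambda>i. c (n + i)"]
    have "(\<Sum>i\<in>active m. norm (c (n + i))) \<le> C * data_norm m m (\<lambda>_. 0) x (\<lambda>i. c (n + i))" .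
    moreover have "cell_norm c n \<le> (\<Sum>i\<in>active m. norm (c (n + i)))"
      by (rule cell_norm_le_shift) auto
    moreover have "data_norm m m (\<lambda>_. 0) x (\<lambda>i. c (n + i)) = (\<Sum>j=1..m. norm (full c (of_int n + x j)))"
      unfolding data_norm_def
    proof (intro sum.cong refl)
      fix j assume j: "j \<in> {1..m}"
      have fl: "\<lfloor>of_int n + x j\<rfloor> = n"
        using x[of j] j e by (intro floor_unique) auto
      have im: "(\<lambda>i. n + i) ` active m = {n - int m + 1..n}"
      proof
        show "{n - int m + 1..n} \<subseteq> (\<lambda>i. n + i) ` active m"
        proof
          fix i assume "i \<in> {n - int m + 1..n}"
          then show "i \<in> (\<lambda>i. n + i) ` active m" by (intro image_eqI[of _ _ "i - n"]) auto
        qed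
      qed auto
      have "full c (of_int n + x j) = (\<Sum>i\<in>(\<lambda>i. n + i) ` active m. \<psi> 0 (of_int n + x j - of_int i) *\<^sub>R c i)"
        by (rule full_psi) (simp_all add: fl im)
      also have "\<dots> = (\<Sum>i\<in>active m. \<psi> 0 (x j - of_int i) *\<^sub>R c (n + i))"
        by (subst sum.reindex) (auto simp: inj_on_def)
      finally show "(\<Sum>s\<le>0. norm (\<Sum>i\<in>active m. \<psi> s (x j - of_int i) *\<^sub>R c (n + i))) = norm (full c (of_int n + x j))"
        by simp
    qed
    ultimately show ?thesis by (simp add: x_def e_def add.assoc)
  qed
  then show ?thesis using C(1) by blast
qed

text \<open>While \<open>\<theta>\<close> runs over \<open>[0, 1]\<close>, a node sweeps an interval
  of length \<open>1 / q\<close> inside the cell, and the substitution costs a factor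
  \<open>q\<close>. The \<open>m\<close> nodes contribute the factor \<open>m\<close>, and
  \<open>K1\<close> comes from taking powers.\<close>

lemma cell_norm_le_integral:
  assumes P: "0 < P"
  shows "\<exists>K>0. \<forall>c n. ennreal (cell_norm c n powr P) \<le>
    ennreal K * (\<integral>\<^sup>+y. ennreal (norm (full c y) powr P) * indicator {of_int n..<of_int n + 1} y \<partial>lborel)"
proof -
  obtain C where C: "0 < C" "\<And>c n \<theta>. 0 \<le> \<theta> \<Longrightarrow> \<theta> \<le> 1 \<Longrightarrow>
     cell_norm c n \<le> C * (\<Sum>j=1..m. norm (full c (of_int n + real j / (real m + 2) + \<theta> / (real m + 2))))"
    using cell_points_bound by metis
  define K1 where "K1 = C powr P * real m powr P"
  have K1: "0 < K1" using C m1 by (simp add: K1_def)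
  define q where "q = real m + 2"
  have q: "0 < q" by (simp add: q_def)
  have "ennreal (cell_norm c n powr P) \<le> ennreal (K1 * (real m * q)) *
     (\<integral>\<^sup>+y. ennreal (norm (full c y) powr P) * indicator {of_int n..<of_int n + 1} y \<partial>lborel)" for c n
  proof -
    let ?b = "\<lambda>y. ennreal (norm (full c y) powr P)"
    let ?I = "\<integral>\<^sup>+y. ?b y * indicator {of_int n..<of_int n + 1} y \<partial>lborel"
    have pw: "ennreal (cell_norm c n powr P) \<le> ennreal K1 * (\<Sum>j=1..m. ?b (of_int n + real j / q + \<theta> / q))"
      if "0 \<le> \<theta>" "\<theta> \<le> 1" for \<theta>
    proof -
      let ?a = "\<lambda>j. norm (full c (of_int n + real j / q + \<theta> / q))"
      have "cell_norm c n powr P \<le> (C * (\<Sum>j=1..m. ?a j)) powr P"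
        by (intro powr_mono2) (use C(2)[OF that, of c n] P cell_norm_nonneg in \<open>auto simp: q_def\<close>)
      also have "\<dots> = C powr P * (\<Sum>j=1..m. ?a j) powr P"
        by (rule powr_mult)
      also have "\<dots> \<le> C powr P * (real m powr P * (\<Sum>j=1..m. ?a j powr P))"
        by (intro mult_left_mono powr_sum_le) (use P in auto)
      finally have "ennreal (cell_norm c n powr P) \<le> ennreal (K1 * (\<Sum>j=1..m. ?a j powr P))"
        by (intro ennreal_leI) (simp add: K1_def mult.assoc)
      also have "\<dots> = ennreal K1 * (\<Sum>j=1..m. ?b (of_int n + real j / q + \<theta> / q))"
        using K1 by (simp add: ennreal_mult sum_nonneg)
      finally show ?thesis .
    qed
    have sub: "(\<integral>\<^sup>+\<theta>. ?b (of_int n + real j / q + \<theta> / q) * indicator {0..1} \<theta> \<partial>lborel) \<le> ennreal q * ?I"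
      if j: "j \<in> {1..m}" for j
    proof -
      let ?t = "of_int n + real j / q"
      let ?g = "\<lambda>y. ?b y * indicator {?t..?t + 1 / q} y"
      have "(\<integral>\<^sup>+y. ?g y \<partial>lborel) = ennreal \<bar>1 / q\<bar> * (\<integral>\<^sup>+\<theta>. ?g (?t + 1 / q * \<theta>) \<partial>lborel)"
        by (rule nn_integral_real_affine) (use q in auto)
      also have "(\<integral>\<^sup>+\<theta>. ?g (?t + 1 / q * \<theta>) \<partial>lborel) = (\<integral>\<^sup>+\<theta>. ?b (?t + \<theta> / q) * indicator {0..1} \<theta> \<partial>lborel)"
        by (intro nn_integral_cong arg_cong2[of _ _ _ _ "(*)"])
          (use q in \<open>auto simp: indicator_def field_simps zero_le_mult_iff\<close>)
      finally have "ennreal q * (\<integral>\<^sup>+y. ?g y \<partial>lborel) =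
          ennreal q * (ennreal \<bar>1 / q\<bar> * (\<integral>\<^sup>+\<theta>. ?b (?t + \<theta> / q) * indicator {0..1} \<theta> \<partial>lborel))" by simp
      also have "\<dots> = (\<integral>\<^sup>+\<theta>. ?b (?t + \<theta> / q) * indicator {0..1} \<theta> \<partial>lborel)"
        using q by (simp add: ennreal_mult[symmetric] flip: mult.assoc)
      finally have "(\<integral>\<^sup>+\<theta>. ?b (?t + \<theta> / q) * indicator {0..1} \<theta> \<partial>lborel) = ennreal q * (\<integral>\<^sup>+y. ?g y \<partial>lborel)" by simp
      also have "\<dots> \<le> ennreal q * ?I"
      proof -
        have "real j / q + 1 / q < 1" "0 \<le> real j / q" using j q by (auto simp: q_def field_simps)
        then have "?g y \<le> ?b y * indicator {of_int n..<of_int n + 1} y" for y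
          by (intro mult_left_mono) (auto simp: indicator_def)
        then show ?thesis by (intro mult_left_mono[OF nn_integral_mono]) auto
      qed
      finally show ?thesis .
    qed
    have "ennreal (cell_norm c n powr P) = (\<integral>\<^sup>+\<theta>. ennreal (cell_norm c n powr P) * indicator {0..1::real} \<theta> \<partial>lborel)"
      by (subst nn_integral_cmult_indicator) auto
    also have "\<dots> \<le> (\<integral>\<^sup>+\<theta>. ennreal K1 * (\<Sum>j=1..m. ?b (of_int n + real j / q + \<theta> / q) * indicator {0..1} \<theta>) \<partial>lborel)"
      by (intro nn_integral_mono) (use pw in \<open>auto simp: indicator_def\<close>)
    also have "\<dots> = ennreal K1 * (\<Sum>j=1..m. \<integral>\<^sup>+\<theta>. ?b (of_int n + real j / q + \<theta> / q) * indicator {0..1} \<theta> \<partial>lborel)"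
    proof -
      have meas: "(\<lambda>\<theta>. ?b (of_int n + real j / q + \<theta> / q) * indicator {0..1} \<theta>) \<in> borel_measurable lborel" for j :: nat
        by measurable
      show ?thesis
        by (subst nn_integral_sum[OF meas, symmetric], rule nn_integral_cmult) (intro borel_measurable_sum meas)
    qed
    also have "\<dots> \<le> ennreal K1 * (\<Sum>j=1..m. ennreal q * ?I)"
      by (intro mult_left_mono sum_mono sub) auto
    also have "\<dots> = ennreal (K1 * (real m * q)) * ?I"
      using K1 q by (simp add: ennreal_mult ennreal_of_nat_eq_real_of_nat mult.assoc)
    finally show ?thesis .
  qed
  moreover have "0 < K1 * (real m * q)" using K1 q m1 by simp
  ultimately show ?thesis by blast
qed

end

section \<open>Sampling inequalities\<close>

lemma window_index:
  assumes "0 < (L::int)"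
  obtains k where "M + k * L \<le> n" "n < M + k * L + L"
proof
  have "(n - M) div L * L + (n - M) mod L = n - M" by simp
  then show "M + (n - M) div L * L \<le> n" "n < M + (n - M) div L * L + L"
    using pos_mod_sign[OF assms, of "n - M"] pos_mod_bound[OF assms, of "n - M"] by linarith+
qed

lemma windows_disjoint:
  assumes L: "0 < L" and "k \<noteq> k'"
  shows "{real_of_int (M + k * L)..<real_of_int (M + k * L + L)} \<inter>
    {real_of_int (M + k' * L)..<real_of_int (M + k' * L + L)} = {}"
proof -
  have *: "{real_of_int (M + k * L)..<real_of_int (M + k * L + L)} \<inter>
    {real_of_int (M + k' * L)..<real_of_int (M + k' * L + L)} = {}" if "k < k'" for k k'
  proof -
    have "(k + 1) * L \<le> k' * L" using that L by (intro mult_right_mono) auto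
    then have "M + k * L + L \<le> M + k' * L" by (simp add: algebra_simps)
    then have "real_of_int (M + k * L + L) \<le> real_of_int (M + k' * L)" unfolding of_int_le_iff .
    then show ?thesis by auto
  qed
  show ?thesis using *[of k k'] *[of k' k] assms(2) by (cases "k < k'") auto
qed

context peb
begin

text \<open>A sample is controlled by the coefficients alive on its cell, hence by the integral over
  that cell. \<open>B\<close> allows for \<open>m\<close> orders at one point, and \<open>Q\<close>
  for the number of points of a separated set in one cell.\<close>

lemma sample_upper_bound:
  assumes X: "uniform_discrete X" and \<mu>: "\<And>x. x \<in> X \<Longrightarrow> \<mu> x < m" and P: "0 < P"
  shows "\<exists>B>0. \<forall>c. (\<Sum>\<^sub>\<infinity>x\<in>X. \<Sum>s=0..\<mu> x. ennreal (norm (sample_deriv m s (full c) x) powr P)) \<le>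
    ennreal B * (\<integral>\<^sup>+y. ennreal (norm (full c y) powr P) \<partial>lborel)"
proof -
  obtain e where e: "0 < e" "\<And>x y. x \<in> X \<Longrightarrow> y \<in> X \<Longrightarrow> dist x y < e \<Longrightarrow> x = y"
    using X unfolding uniform_discrete_def by blast
  obtain K where K: "0 < K" "\<And>c x s. s < m \<Longrightarrow> norm (sample_deriv m s (full c) x) \<le> K * cell_norm c \<lfloor>x\<rfloor>"
    using pointwise_bound by metis
  obtain K2 where K2: "0 < K2" "\<And>c n. ennreal (cell_norm c n powr P) \<le>
    ennreal K2 * (\<integral>\<^sup>+y. ennreal (norm (full c y) powr P) * indicator {of_int n..<of_int n + 1} y \<partial>lborel)"
    using cell_norm_le_integral[OF P] by metis
  define Q where "Q = real (nat (\<lfloor>1 / e\<rfloor> + 2))"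
  have Q: "0 < Q" unfolding Q_def using e(1) by (simp add: add_nonneg_pos)
  define B where "B = real m * K powr P * K2"
  have B: "0 < B" using K K2 m1 by (simp add: B_def)
  have "(\<Sum>\<^sub>\<infinity>x\<in>X. \<Sum>s=0..\<mu> x. ennreal (norm (sample_deriv m s (full c) x) powr P)) \<le>
    ennreal (B * Q) * (\<integral>\<^sup>+y. ennreal (norm (full c y) powr P) \<partial>lborel)" for c
  proof -
    let ?b = "\<lambda>y. ennreal (norm (full c y) powr P)"
    let ?C = "\<lambda>n. {of_int n..<of_int n + 1 :: real}"
    have point: "(\<Sum>s=0..\<mu> x. ennreal (norm (sample_deriv m s (full c) x) powr P))
        \<le> ennreal B * (\<integral>\<^sup>+y. ?b y * indicator (?C \<lfloor>x\<rfloor>) y \<partial>lborel)" if x: "x \<in> X" for x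
    proof -
      have "(\<Sum>s=0..\<mu> x. ennreal (norm (sample_deriv m s (full c) x) powr P))
          \<le> (\<Sum>s=0..\<mu> x. ennreal (K powr P * cell_norm c \<lfloor>x\<rfloor> powr P))"
      proof (intro sum_mono ennreal_leI)
        fix s assume "s \<in> {0..\<mu> x}"
        then have "norm (sample_deriv m s (full c) x) \<le> K * cell_norm c \<lfloor>x\<rfloor>" using K(2) \<mu>[OF x] by simp
        then have "norm (sample_deriv m s (full c) x) powr P \<le> (K * cell_norm c \<lfloor>x\<rfloor>) powr P"
          by (intro powr_mono2) (use P in auto)
        then show "norm (sample_deriv m s (full c) x) powr P \<le> K powr P * cell_norm c \<lfloor>x\<rfloor> powr P"
          by (simp add: powr_mult)
      qed
      also have "\<dots> = of_nat (\<mu> x + 1) * (ennreal (K powr P) * ennreal (cell_norm c \<lfloor>x\<rfloor> powr P))"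
        by (simp add: ennreal_mult)
      also have "\<dots> \<le> of_nat m * (ennreal (K powr P) * ennreal (cell_norm c \<lfloor>x\<rfloor> powr P))"
        by (intro mult_right_mono of_nat_mono) (use \<mu>[OF x] in auto)
      also have "\<dots> \<le> of_nat m * (ennreal (K powr P) * (ennreal K2 * (\<integral>\<^sup>+y. ?b y * indicator (?C \<lfloor>x\<rfloor>) y \<partial>lborel)))"
        by (intro mult_left_mono K2(2)) auto
      also have "\<dots> = ennreal B * (\<integral>\<^sup>+y. ?b y * indicator (?C \<lfloor>x\<rfloor>) y \<partial>lborel)"
        using K K2 by (simp add: B_def ennreal_mult ennreal_of_nat_eq_real_of_nat mult.assoc)
      finally show ?thesis .
    qed
    show ?thesis
      unfolding nonneg_infsum_complete[OF zero_le]
    proof (rule SUP_least)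
      fix F assume "F \<in> {F. finite F \<and> F \<subseteq> X}"
      then have F: "finite F" "F \<subseteq> X" by auto
      have "(\<Sum>x\<in>F. \<Sum>s=0..\<mu> x. ennreal (norm (sample_deriv m s (full c) x) powr P))
          \<le> (\<Sum>x\<in>F. ennreal B * (\<integral>\<^sup>+y. ?b y * indicator (?C \<lfloor>x\<rfloor>) y \<partial>lborel))"
        by (intro sum_mono point) (use F in auto)
      also have "\<dots> = ennreal B * (\<integral>\<^sup>+y. (\<Sum>x\<in>F. ?b y * indicator (?C \<lfloor>x\<rfloor>) y) \<partial>lborel)"
        by (subst nn_integral_sum) (auto simp: sum_distrib_left)
      also have "\<dots> \<le> ennreal B * (\<integral>\<^sup>+y. ennreal Q * ?b y \<partial>lborel)"
      proof (intro mult_left_mono[OF nn_integral_mono])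
        fix y
        have "(\<Sum>x\<in>F. ?b y * indicator (?C \<lfloor>x\<rfloor>) y) = (\<Sum>x\<in>{x \<in> F. \<lfloor>x\<rfloor> = \<lfloor>y\<rfloor>}. ?b y)"
        proof (rule sum.mono_neutral_cong_right)
          show "\<forall>x\<in>F - {x \<in> F. \<lfloor>x\<rfloor> = \<lfloor>y\<rfloor>}. ?b y * indicator (?C \<lfloor>x\<rfloor>) y = 0"
          proof
            fix x assume "x \<in> F - {x \<in> F. \<lfloor>x\<rfloor> = \<lfloor>y\<rfloor>}"
            then have "y \<notin> ?C \<lfloor>x\<rfloor>" using floor_unique[of "\<lfloor>x\<rfloor>" y] by auto
            then have "indicator (?C \<lfloor>x\<rfloor>) y = (0 :: ennreal)" by (rule indicator_simps(2))
            then show "?b y * indicator (?C \<lfloor>x\<rfloor>) y = 0" by simp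
          qed
          show "?b y * indicator (?C \<lfloor>x\<rfloor>) y = ?b y" if "x \<in> {x \<in> F. \<lfloor>x\<rfloor> = \<lfloor>y\<rfloor>}" for x
            using that by (simp add: indicator_def)
        qed (use F in auto)
        also have "\<dots> = of_nat (card {x \<in> F. \<lfloor>x\<rfloor> = \<lfloor>y\<rfloor>}) * ?b y" by simp
        also have "\<dots> \<le> of_nat (nat (\<lfloor>1 / e\<rfloor> + 2)) * ?b y"
          by (intro mult_right_mono of_nat_mono uniform_discrete_card_cell[OF e F]) auto
        also have "\<dots> = ennreal Q * ?b y" by (simp add: Q_def ennreal_of_nat_eq_real_of_nat)
        finally show "(\<Sum>x\<in>F. ?b y * indicator (?C \<lfloor>x\<rfloor>) y) \<le> ennreal Q * ?b y" .
      qed auto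
      also have "\<dots> = ennreal (B * Q) * (\<integral>\<^sup>+y. ?b y \<partial>lborel)"
        using B Q by (subst nn_integral_cmult) (auto simp: ennreal_mult mult.assoc)
      finally show "(\<Sum>x\<in>F. \<Sum>s=0..\<mu> x. ennreal (norm (sample_deriv m s (full c) x) powr P))
          \<le> ennreal (B * Q) * (\<integral>\<^sup>+y. ?b y \<partial>lborel)" .
    qed
  qed
  then show ?thesis using B Q by (intro exI[of _ "B * Q"]) auto
qed

text \<open>The local integral estimate with exponent 1 suffices: a cell has measure one, so its
  integral is at most the essential supremum.\<close>

lemma sample_upper_bound_sup:
  assumes \<mu>: "\<And>x. x \<in> X \<Longrightarrow> \<mu> x < m"
  shows "\<exists>B>0. \<forall>c. (SUP x\<in>X. SUP s\<in>{0..\<mu> x}. ennreal (norm (sample_deriv m s (full c) x))) \<le>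
    ennreal B * esssup lborel (\<lambda>x. ennreal (norm (full c x)))"
proof -
  obtain K where K: "0 < K" "\<And>c x s. s < m \<Longrightarrow> norm (sample_deriv m s (full c) x) \<le> K * cell_norm c \<lfloor>x\<rfloor>"
    using pointwise_bound by metis
  obtain K2 where K2: "0 < K2" "\<And>c n. ennreal (cell_norm c n powr 1) \<le>
    ennreal K2 * (\<integral>\<^sup>+y. ennreal (norm (full c y) powr 1) * indicator {of_int n..<of_int n + 1} y \<partial>lborel)"
    using cell_norm_le_integral[of 1] by auto
  have "(SUP x\<in>X. SUP s\<in>{0..\<mu> x}. ennreal (norm (sample_deriv m s (full c) x))) \<le>
    ennreal (K * K2) * esssup lborel (\<lambda>x. ennreal (norm (full c x)))" for c
  proof (intro SUP_least)
    fix x s assume x: "x \<in> X" and s: "s \<in> {0..\<mu> x}"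
    let ?S = "esssup lborel (\<lambda>x. ennreal (norm (full c x)))"
    let ?C = "{of_int \<lfloor>x\<rfloor>..<of_int \<lfloor>x\<rfloor> + 1 :: real}"
    have "(\<integral>\<^sup>+y. ennreal (norm (full c y) powr 1) * indicator ?C y \<partial>lborel) \<le> (\<integral>\<^sup>+y. ?S * indicator ?C y \<partial>lborel)"
    proof (rule nn_integral_mono_AE)
      show "AE y in lborel. ennreal (norm (full c y) powr 1) * indicator ?C y \<le> ?S * indicator ?C y"
        using esssup_AE[of "\<lambda>x. ennreal (norm (full c x))" lborel]
        by eventually_elim (auto simp: indicator_def)
    qed
    also have "\<dots> = ?S" by (subst nn_integral_cmult_indicator) auto
    finally have I: "(\<integral>\<^sup>+y. ennreal (norm (full c y) powr 1) * indicator ?C y \<partial>lborel) \<le> ?S" .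
    have "ennreal (norm (sample_deriv m s (full c) x)) \<le> ennreal (K * cell_norm c \<lfloor>x\<rfloor>)"
      using K(2) \<mu>[OF x] s by (intro ennreal_leI) auto
    also have "\<dots> = ennreal K * ennreal (cell_norm c \<lfloor>x\<rfloor> powr 1)"
      using K(1) cell_norm_nonneg by (simp add: ennreal_mult)
    also have "\<dots> \<le> ennreal K * (ennreal K2 * ?S)"
      by (intro mult_left_mono order_trans[OF K2(2)] I) auto
    also have "\<dots> = ennreal (K * K2) * ?S" using K K2 by (simp add: ennreal_mult mult.assoc)
    finally show "ennreal (norm (sample_deriv m s (full c) x)) \<le> ennreal (K * K2) * ?S" .
  qed
  then show ?thesis using K K2 by (intro exI[of _ "K * K2"]) auto
qed

text \<open>Isolates what the sampling inequality takes from (iii): finite node sets whose samples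
  control the coefficients, with constants independent of \<open>k\<close>. \<open>D\<close> bounds
  the number of samples per window, which passing from sums to powers or suprema requires.\<close>

definition windows :: "real set \<Rightarrow> (real \<Rightarrow> nat) \<Rightarrow> int \<Rightarrow> int \<Rightarrow> (int \<Rightarrow> real set) \<Rightarrow> real \<Rightarrow> real \<Rightarrow> bool" where
  "windows X \<mu> M L Y C D \<longleftrightarrow> 0 < L \<and> 0 < C \<and> 0 < D \<and>
     (\<forall>k. finite (Y k) \<and> Y k \<subseteq> X \<inter> {real_of_int (M + k * L)..<real_of_int (M + k * L + L)} \<and>
        real (card (SIGMA x:Y k. {0..\<mu> x})) \<le> D \<and>
        (\<forall>c n. M + k * L \<le> n \<longrightarrow> n < M + k * L + L \<longrightarrow>
           cell_norm c n \<le> C * (\<Sum>x\<in>Y k. \<Sum>s=0..\<mu> x. norm (sample_deriv m s (full c) x))))"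

text \<open>On a window the samples bound the function pointwise, so integration contributes its
  length \<open>L\<close>. The windows partition the line and their node sets are disjoint, so no
  sample is counted twice on summation.\<close>

lemma sample_lower_bound:
  assumes W: "windows X \<mu> M L Y C D" and P: "0 < P"
  shows "\<exists>K>0. \<forall>c. (\<integral>\<^sup>+y. ennreal (norm (full c y) powr P) \<partial>lborel) \<le>
    ennreal K * (\<Sum>\<^sub>\<infinity>x\<in>X. \<Sum>s=0..\<mu> x. ennreal (norm (sample_deriv m s (full c) x) powr P))"
proof -
  have L: "0 < L" and C: "0 < C" and D: "0 < D" using W by (auto simp: windows_def)
  have Y: "finite (Y k)" "Y k \<subseteq> X" "Y k \<subseteq> {real_of_int (M + k * L)..<real_of_int (M + k * L + L)}"
    "real (card (SIGMA x:Y k. {0..\<mu> x})) \<le> D" for k using W unfolding windows_def by blast+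
  have cell: "cell_norm c n \<le> C * (\<Sum>x\<in>Y k. \<Sum>s=0..\<mu> x. norm (sample_deriv m s (full c) x))"
    if "M + k * L \<le> n" "n < M + k * L + L" for c n k using W that unfolding windows_def by blast
  obtain K0 where K0: "0 < K0" "\<And>c x. norm (full c x) \<le> K0 * cell_norm c \<lfloor>x\<rfloor>"
    using pointwise_bound by metis
  define K where "K = (K0 * C * D) powr P"
  have K: "0 < K" using K0 C D by (simp add: K_def)
  have "(\<integral>\<^sup>+y. ennreal (norm (full c y) powr P) \<partial>lborel) \<le>
    ennreal (K * real_of_int L) * (\<Sum>\<^sub>\<infinity>x\<in>X. \<Sum>s=0..\<mu> x. ennreal (norm (sample_deriv m s (full c) x) powr P))" for c
  proof -
    let ?b = "\<lambda>y. ennreal (norm (full c y) powr P)"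
    let ?a = "\<lambda>x. \<Sum>s=0..\<mu> x. norm (sample_deriv m s (full c) x) powr P"
    let ?S = "\<Sum>\<^sub>\<infinity>x\<in>X. \<Sum>s=0..\<mu> x. ennreal (norm (sample_deriv m s (full c) x) powr P)"
    let ?W = "\<lambda>k. {real_of_int (M + k * L)..<real_of_int (M + k * L + L)}"
    have bW: "?b y \<le> ennreal (K * (\<Sum>x\<in>Y k. ?a x))" if y: "y \<in> ?W k" for y k
    proof (rule ennreal_leI)
      let ?g = "\<lambda>(x, s). norm (sample_deriv m s (full c) x)"
      have fl: "M + k * L \<le> \<lfloor>y\<rfloor>" "\<lfloor>y\<rfloor> < M + k * L + L" using y by (auto simp: le_floor_iff floor_less_iff)
      have "norm (full c y) \<le> K0 * cell_norm c \<lfloor>y\<rfloor>" by (rule K0(2))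
      also have "\<dots> \<le> K0 * (C * (\<Sum>x\<in>Y k. \<Sum>s=0..\<mu> x. norm (sample_deriv m s (full c) x)))"
        using K0(1) by (intro mult_left_mono cell fl) auto
      also have "\<dots> = (K0 * C) * (\<Sum>p\<in>(SIGMA x:Y k. {0..\<mu> x}). ?g p)"
        using Y(1) by (simp add: sum.Sigma)
      finally have "norm (full c y) powr P \<le> ((K0 * C) * (\<Sum>p\<in>(SIGMA x:Y k. {0..\<mu> x}). ?g p)) powr P"
        by (intro powr_mono2) (use P in auto)
      also have "\<dots> = (K0 * C) powr P * (\<Sum>p\<in>(SIGMA x:Y k. {0..\<mu> x}). ?g p) powr P"
        by (rule powr_mult)
      also have "\<dots> \<le> (K0 * C) powr P * (D powr P * (\<Sum>p\<in>(SIGMA x:Y k. {0..\<mu> x}). ?g p powr P))"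
        by (intro mult_left_mono powr_sum_le) (use Y P in auto)
      also have "(\<Sum>p\<in>(SIGMA x:Y k. {0..\<mu> x}). ?g p powr P) = (\<Sum>x\<in>Y k. ?a x)"
        using Y(1) by (simp add: sum.Sigma case_prod_beta)
      finally show "norm (full c y) powr P \<le> K * (\<Sum>x\<in>Y k. ?a x)"
        by (simp add: K_def powr_mult mult.assoc)
    qed
    have IW: "(\<integral>\<^sup>+y. ?b y * indicator (?W k) y \<partial>lborel) \<le> ennreal (K * real_of_int L) * (\<Sum>x\<in>Y k. ennreal (?a x))" for k
    proof -
      have "(\<integral>\<^sup>+y. ?b y * indicator (?W k) y \<partial>lborel) \<le> (\<integral>\<^sup>+y. ennreal (K * (\<Sum>x\<in>Y k. ?a x)) * indicator (?W k) y \<partial>lborel)"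
        by (intro nn_integral_mono) (use bW[of _ k] in \<open>auto simp: indicator_def\<close>)
      also have "\<dots> = ennreal (K * (\<Sum>x\<in>Y k. ?a x)) * ennreal (real_of_int L)"
        using L by (subst nn_integral_cmult_indicator) auto
      also have "\<dots> = ennreal (K * real_of_int L) * (\<Sum>x\<in>Y k. ennreal (?a x))"
        using L K by (simp add: ennreal_mult sum_nonneg mult_ac)
      finally show ?thesis .
    qed
    \<comment> \<open>Windows are indexed by integers; the enumeration by naturals turns the
      integral over the line into a series.\<close>
    let ?A = "\<lambda>i::nat. ?W (int_decode i)"
    have disj: "disjoint_family ?A"
      unfolding disjoint_family_on_def using windows_disjoint[OF L] by (metis int_decode_eq)
    have b_split: "?b y = (\<Sum>i. ?b y * indicator (?A i) y)" for y
    proof -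
      obtain k where k: "M + k * L \<le> \<lfloor>y\<rfloor>" "\<lfloor>y\<rfloor> < M + k * L + L" using window_index[OF L] .
      then have "y \<in> ?A (int_encode k)" by (simp only: int_encode_inverse) (auto simp: le_floor_iff floor_less_iff)
      then show ?thesis using suminf_cmult_indicator[OF disj, of y "int_encode k" "\<lambda>_. ?b y"] by simp
    qed
    have "(\<integral>\<^sup>+y. ?b y \<partial>lborel) = (\<integral>\<^sup>+y. (\<Sum>i. ?b y * indicator (?A i) y) \<partial>lborel)"
      using b_split by presburger
    also have "\<dots> = (\<Sum>i. \<integral>\<^sup>+y. ?b y * indicator (?A i) y \<partial>lborel)"
      by (rule nn_integral_suminf) measurable
    also have "\<dots> \<le> ennreal (K * real_of_int L) * ?S"
    proof (rule suminf_le_const[OF summableI])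
      fix n
      have "(\<Sum>i<n. \<integral>\<^sup>+y. ?b y * indicator (?A i) y \<partial>lborel) \<le>
          (\<Sum>i<n. ennreal (K * real_of_int L) * (\<Sum>x\<in>Y (int_decode i). ennreal (?a x)))"
        by (intro sum_mono IW)
      also have "\<dots> = ennreal (K * real_of_int L) * (\<Sum>i<n. \<Sum>x\<in>Y (int_decode i). ennreal (?a x))"
        by (simp only: sum_distrib_left)
      also have "(\<Sum>i<n. \<Sum>x\<in>Y (int_decode i). ennreal (?a x)) = (\<Sum>x\<in>(\<Union>i<n. Y (int_decode i)). ennreal (?a x))"
      proof (rule sum.UNION_disjoint[symmetric])
        show "\<forall>i\<in>{..<n}. \<forall>j\<in>{..<n}. i \<noteq> j \<longrightarrow> Y (int_decode i) \<inter> Y (int_decode j) = {}"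
          using disj Y(3) unfolding disjoint_family_on_def by blast
      qed (use Y(1) in auto)
      also have "\<dots> \<le> ?S"
        unfolding nonneg_infsum_complete[OF zero_le]
        by (rule SUP_upper2[of "\<Union>i<n. Y (int_decode i)"]) (use Y in \<open>auto simp: sum_nonneg\<close>)
      finally show "(\<Sum>i<n. \<integral>\<^sup>+y. ?b y * indicator (?A i) y \<partial>lborel) \<le> ennreal (K * real_of_int L) * ?S"
        by (simp add: mult_left_mono)
    qed
    finally show ?thesis .
  qed
  then show ?thesis using K L by (intro exI[of _ "K * real_of_int L"]) auto
qed

lemma sample_lower_bound_sup:
  assumes W: "windows X \<mu> M L Y C D"
  shows "\<exists>K>0. \<forall>c. esssup lborel (\<lambda>x. ennreal (norm (full c x))) \<le>
    ennreal K * (SUP x\<in>X. SUP s\<in>{0..\<mu> x}. ennreal (norm (sample_deriv m s (full c) x)))"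
proof -
  have L: "0 < L" and C: "0 < C" and D: "0 < D" using W by (auto simp: windows_def)
  have Y: "finite (Y k)" "Y k \<subseteq> X" "real (card (SIGMA x:Y k. {0..\<mu> x})) \<le> D" for k
    using W unfolding windows_def by blast+
  have cell: "cell_norm c n \<le> C * (\<Sum>x\<in>Y k. \<Sum>s=0..\<mu> x. norm (sample_deriv m s (full c) x))"
    if "M + k * L \<le> n" "n < M + k * L + L" for c n k using W that unfolding windows_def by blast
  obtain K0 where K0: "0 < K0" "\<And>c x. norm (full c x) \<le> K0 * cell_norm c \<lfloor>x\<rfloor>"
    using pointwise_bound by metis
  have "esssup lborel (\<lambda>x. ennreal (norm (full c x))) \<le>
    ennreal (K0 * C * D) * (SUP x\<in>X. SUP s\<in>{0..\<mu> x}. ennreal (norm (sample_deriv m s (full c) x)))" for c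
  proof (rule esssup_I, measurable, rule AE_I2)
    fix y :: real
    let ?S = "SUP x\<in>X. SUP s\<in>{0..\<mu> x}. ennreal (norm (sample_deriv m s (full c) x))"
    let ?g = "\<lambda>(x, s). norm (sample_deriv m s (full c) x)"
    obtain k where k: "M + k * L \<le> \<lfloor>y\<rfloor>" "\<lfloor>y\<rfloor> < M + k * L + L" using window_index[OF L] .
    let ?I = "SIGMA x:Y k. {0..\<mu> x}"
    have "norm (full c y) \<le> K0 * cell_norm c \<lfloor>y\<rfloor>" by (rule K0(2))
    also have "\<dots> \<le> K0 * (C * (\<Sum>x\<in>Y k. \<Sum>s=0..\<mu> x. norm (sample_deriv m s (full c) x)))"
      using K0(1) by (intro mult_left_mono cell k) auto
    also have "\<dots> = (K0 * C) * (\<Sum>p\<in>?I. ?g p)"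
      using Y(1) by (simp add: sum.Sigma)
    finally have "ennreal (norm (full c y)) \<le> ennreal ((K0 * C) * (\<Sum>p\<in>?I. ?g p))" by (rule ennreal_leI)
    also have "\<dots> = ennreal (K0 * C) * (\<Sum>p\<in>?I. ennreal (?g p))"
    proof -
      have "0 \<le> (\<Sum>p\<in>?I. ?g p)" by (intro sum_nonneg) auto
      then have "ennreal ((K0 * C) * (\<Sum>p\<in>?I. ?g p)) = ennreal (K0 * C) * ennreal (\<Sum>p\<in>?I. ?g p)"
        using K0 C by (intro ennreal_mult) auto
      moreover have "ennreal (\<Sum>p\<in>?I. ?g p) = (\<Sum>p\<in>?I. ennreal (?g p))"
        by (rule sum_ennreal[symmetric]) auto
      ultimately show ?thesis by simp
    qed
    also have "\<dots> \<le> ennreal (K0 * C) * (\<Sum>p\<in>?I. ?S)"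
    proof (intro mult_left_mono sum_mono)
      fix p assume "p \<in> ?I"
      then obtain x s where p: "p = (x, s)" "x \<in> X" "s \<in> {0..\<mu> x}" using Y(2)[of k] by auto
      show "ennreal (?g p) \<le> ?S"
        unfolding p(1) by (auto intro!: SUP_upper2[OF p(2)] SUP_upper2[OF p(3)])
    qed auto
    also have "\<dots> = ennreal (K0 * C) * (ennreal (real (card ?I)) * ?S)"
      by (simp add: ennreal_of_nat_eq_real_of_nat)
    also have "\<dots> \<le> ennreal (K0 * C) * (ennreal D * ?S)"
      by (intro mult_left_mono mult_right_mono ennreal_leI Y) auto
    also have "\<dots> = ennreal (K0 * C * D) * ?S" using K0 C D by (simp add: ennreal_mult mult.assoc)
    finally show "ennreal (norm (full c y)) \<le> ennreal (K0 * C * D) * ?S" .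
  qed
  then show ?thesis using K0 C D by (intro exI[of _ "K0 * C * D"]) auto
qed

text \<open>After subtraction of the left end of the window, (iii) becomes admissibility with
  \<open>n = q\<close>, and the separation constant \<open>e\<close> of \<open>X\<close> serves as
  the gap \<open>\<delta>\<close>.\<close>

lemma windows_exist:
  fixes M L :: int
  assumes X: "uniform_discrete X" and \<mu>: "\<And>x. x \<in> X \<Longrightarrow> \<mu> x < m" and L: "0 < L" and \<epsilon>: "0 < \<epsilon>"
    and H: "\<And>k::int. \<exists>(N::nat) (x :: nat \<Rightarrow> real) (\<nu> :: nat \<Rightarrow> nat).
        (\<forall>i\<in>{1..N}. \<forall>j\<in>{1..N}. i < j \<longrightarrow> x i < x j) \<and>
        (\<forall>j\<in>{1..N}. x j \<in> X \<inter> {real_of_int (M + k * L)..<real_of_int (M + k * L + L)}) \<and>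
        (\<forall>j\<in>{1..N}. \<nu> j \<le> \<mu> (x j)) \<and>
        (\<Sum>j=1..N. 1 + int (\<nu> j)) = L + int m - 1 \<and>
        (\<forall>j\<in>{1..N}. x j \<in> X \<inter>
          (\<lambda>t. t + real_of_int (M + k * L + 1 + (\<Sum>n=1..j-1. 1 + int (\<nu> n)))) `
            {real (\<nu> j) - real m + \<epsilon>..-\<epsilon>})"
  obtains Y C D where "windows X \<mu> M L Y C D"
proof -
  obtain e where e: "0 < e" "\<And>x y. x \<in> X \<Longrightarrow> y \<in> X \<Longrightarrow> dist x y < e \<Longrightarrow> x = y"
    using X unfolding uniform_discrete_def by blast
  define q where "q = nat (L + int m - 1)"
  have q: "int q = L + int m - 1" using L m1 by (simp add: q_def)
  obtain C where C: "0 < C" "\<And>N \<nu> x (c :: int \<Rightarrow> complex). admissible q \<epsilon> e N \<nu> x \<Longrightarrow>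
      (\<Sum>i\<in>active q. norm (c i)) \<le> C * data_norm q N \<nu> x c"
    using uniform_bound[OF \<epsilon> e(1), of q] by metis
  have ex: "\<exists>Y. finite Y \<and> Y \<subseteq> X \<inter> {real_of_int (M + k * L)..<real_of_int (M + k * L + L)} \<and>
        real (card (SIGMA x:Y. {0..\<mu> x})) \<le> real (q * m) \<and>
        (\<forall>c n. M + k * L \<le> n \<longrightarrow> n < M + k * L + L \<longrightarrow>
           cell_norm c n \<le> C * (\<Sum>x\<in>Y. \<Sum>s=0..\<mu> x. norm (sample_deriv m s (full c) x)))" for k
  proof -
    let ?l = "M + k * L"
    obtain N :: nat and x :: "nat \<Rightarrow> real" and \<nu> :: "nat \<Rightarrow> nat" where conj: "(\<forall>i\<in>{1..N}. \<forall>j\<in>{1..N}. i < j \<longrightarrow> x i < x j) \<and>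
        (\<forall>j\<in>{1..N}. x j \<in> X \<inter> {real_of_int ?l..<real_of_int (?l + L)}) \<and>
        (\<forall>j\<in>{1..N}. \<nu> j \<le> \<mu> (x j)) \<and>
        (\<Sum>j=1..N. 1 + int (\<nu> j)) = L + int m - 1 \<and>
        (\<forall>j\<in>{1..N}. x j \<in> X \<inter>
          (\<lambda>t. t + real_of_int (?l + 1 + (\<Sum>n=1..j-1. 1 + int (\<nu> n)))) `
            {real (\<nu> j) - real m + \<epsilon>..-\<epsilon>})"
      using H[of k] by (elim exE) (rule that)
    note h = conj[THEN conjunct1] conj[THEN conjunct2, THEN conjunct1]
      conj[THEN conjunct2, THEN conjunct2, THEN conjunct1]
      conj[THEN conjunct2, THEN conjunct2, THEN conjunct2, THEN conjunct1]
      conj[THEN conjunct2, THEN conjunct2, THEN conjunct2, THEN conjunct2]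
    have incr: "x i < x j" if "i \<in> {1..N}" "j \<in> {1..N}" "i < j" for i j using h(1) that by blast
    have xX: "x j \<in> X" and xW: "x j \<in> {real_of_int ?l..<real_of_int (?l + L)}" and \<nu>: "\<nu> j \<le> \<mu> (x j)"
      and loc: "x j \<in> (\<lambda>t. t + real_of_int (?l + 1 + (\<Sum>n=1..j-1. 1 + int (\<nu> n)))) `
            {real (\<nu> j) - real m + \<epsilon>..-\<epsilon>}" if "j \<in> {1..N}" for j
      using h(2,3,5) that by blast+
    note sum = h(4)
    have "int (\<Sum>j=1..N. 1 + \<nu> j) = int q" using sum q by simp
    then have sumq: "(\<Sum>j=1..N. 1 + \<nu> j) = q" unfolding of_nat_eq_iff .
    have adm: "admissible q \<epsilon> e N \<nu> (\<lambda>j. x j - of_int ?l)"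
      unfolding admissible_def
    proof (intro conjI ballI impI sumq)
      fix j assume j: "j \<in> {1..N}"
      obtain t where t: "t \<in> {real (\<nu> j) - real m + \<epsilon>..-\<epsilon>}"
        "x j = t + real_of_int (?l + 1 + (\<Sum>n=1..j-1. 1 + int (\<nu> n)))" using loc[OF j] by (rule imageE)
      have "(\<Sum>n=1..j-1. 1 + int (\<nu> n)) = int (offset \<nu> j)" by (simp add: offset_def)
      then have "x j = t + of_int ?l + 1 + real (offset \<nu> j)" using t(2) by simp
      then show "x j - of_int ?l \<in> {real (offset \<nu> j) + real (\<nu> j) + 1 - real m + \<epsilon>..real (offset \<nu> j) + 1 - \<epsilon>}"
        using t(1) by auto
    next
      fix i j assume ij: "i \<in> {1..N}" "j \<in> {1..N}" "i < j"
      have "x i < x j" by (rule incr[OF ij])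
      moreover have "\<not> dist (x i) (x j) < e" using e(2)[OF xX[OF ij(1)] xX[OF ij(2)]] \<open>x i < x j\<close> by auto
      ultimately show "x i - of_int ?l + e \<le> x j - of_int ?l" by (simp add: dist_real_def)
    qed
    define Y where "Y = x ` {1..N}"
    have inj: "inj_on x {1..N}"
      by (rule inj_onI) (use incr in \<open>metis less_irrefl linorder_neqE_nat\<close>)
    have "N \<le> q" using sumq unfolding sum.distrib by simp
    \<comment> \<open>At most \<open>q\<close> nodes, each with at most \<open>m\<close> orders,
      whence the bound \<open>q * m\<close>.\<close>
    have "card (SIGMA x:Y. {0..\<mu> x}) = (\<Sum>x\<in>Y. card {0..\<mu> x})"
      by (rule card_SigmaI) (auto simp: Y_def)
    also have "\<dots> \<le> (\<Sum>x\<in>Y. m)" by (intro sum_mono) (use \<mu> xX in \<open>force simp: Y_def\<close>)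
    also have "\<dots> \<le> q * m" using \<open>N \<le> q\<close> card_image[OF inj] by (simp add: Y_def)
    finally have card: "card (SIGMA x:Y. {0..\<mu> x}) \<le> q * m" .
    have "cell_norm c n \<le> C * (\<Sum>x\<in>Y. \<Sum>s=0..\<mu> x. norm (sample_deriv m s (full c) x))"
      if n: "?l \<le> n" "n < ?l + L" for c n
    proof -
      have "cell_norm c n \<le> (\<Sum>i\<in>active q. norm (c (?l + i)))"
        by (rule cell_norm_le_shift) (use n q in auto)
      also have "\<dots> \<le> C * data_norm q N \<nu> (\<lambda>j. x j - of_int ?l) (\<lambda>i. c (?l + i))"
        by (rule C(2)[OF adm])
      also have "data_norm q N \<nu> (\<lambda>j. x j - of_int ?l) (\<lambda>i. c (?l + i)) =
          (\<Sum>j=1..N. \<Sum>s\<le>\<nu> j. norm (sample_deriv m s (full c) (x j)))"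
      proof (rule data_norm_shift)
        show "\<nu> j < m" if "j \<in> {1..N}" for j using \<nu>[OF that] \<mu>[OF xX[OF that]] by simp
        show "?l \<le> \<lfloor>x j\<rfloor> \<and> \<lfloor>x j\<rfloor> \<le> ?l + (int q - int m)" if "j \<in> {1..N}" for j
        proof -
          have "?l \<le> \<lfloor>x j\<rfloor>" using xW[OF that] by (simp add: le_floor_iff)
          moreover have "\<lfloor>x j\<rfloor> < ?l + L" using xW[OF that] by (simp add: floor_less_iff)
          ultimately show ?thesis using q by simp
        qed
      qed
      \<comment> \<open>The selected orders are completed to all those prescribed by
        \<open>\<mu>\<close>; the additional terms are nonnegative.\<close>
      also have "\<dots> \<le> (\<Sum>j=1..N. \<Sum>s=0..\<mu> (x j). norm (sample_deriv m s (full c) (x j)))"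
        by (intro sum_mono sum_mono2) (use \<nu> in fastforce)+
      also have "\<dots> = (\<Sum>x\<in>Y. \<Sum>s=0..\<mu> x. norm (sample_deriv m s (full c) x))"
        unfolding Y_def sum.reindex[OF inj] comp_def ..
      finally show ?thesis using C(1) by (simp add: mult_left_mono)
    qed
    moreover have "finite Y" "Y \<subseteq> X \<inter> {real_of_int ?l..<real_of_int (?l + L)}"
      using xX xW unfolding Y_def by blast+
    moreover have "real (card (SIGMA x:Y. {0..\<mu> x})) \<le> real (q * m)" using card unfolding of_nat_le_iff .
    ultimately show ?thesis by blast
  qed
  obtain Y where Y: "\<forall>k. finite (Y k) \<and> Y k \<subseteq> X \<inter> {real_of_int (M + k * L)..<real_of_int (M + k * L + L)} \<and>
        real (card (SIGMA x:Y k. {0..\<mu> x})) \<le> real (q * m) \<and>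
        (\<forall>c n. M + k * L \<le> n \<longrightarrow> n < M + k * L + L \<longrightarrow>
           cell_norm c n \<le> C * (\<Sum>x\<in>Y k. \<Sum>s=0..\<mu> x. norm (sample_deriv m s (full c) x)))"
    by (rule exE[OF choice[OF allI[OF ex]]])
  have "0 < real (q * m)" using q L m1 by (cases "q = 0") auto
  then have "windows X \<mu> M L Y C (real (q * m))"
    unfolding windows_def by (intro conjI L C(1) Y)
  then show thesis by (rule that)
qed

lemma sampling_set_of_windows:
  assumes X: "uniform_discrete X" and \<mu>: "\<And>x. x \<in> X \<Longrightarrow> \<mu> x < m" and W: "windows X \<mu> M L Y C D"
    and p: "1 \<le> p"
  shows "sampling_set m \<phi> p X \<mu>"
proof -
  have "\<exists>K B. 0 < K \<and> 0 < B \<and> (\<forall>c. Lp_power p (full c) \<le> ennreal K * sample_power m p X \<mu> (full c) \<and>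
      sample_power m p X \<mu> (full c) \<le> ennreal B * Lp_power p (full c))"
  proof (cases "p = \<infinity>")
    case True
    obtain K where K: "0 < K" "\<And>c. esssup lborel (\<lambda>x. ennreal (norm (full c x))) \<le>
      ennreal K * (SUP x\<in>X. SUP s\<in>{0..\<mu> x}. ennreal (norm (sample_deriv m s (full c) x)))"
      using sample_lower_bound_sup[OF W] by blast
    obtain B where B: "0 < B" "\<And>c. (SUP x\<in>X. SUP s\<in>{0..\<mu> x}. ennreal (norm (sample_deriv m s (full c) x))) \<le>
      ennreal B * esssup lborel (\<lambda>x. ennreal (norm (full c x)))"
      using sample_upper_bound_sup[of X \<mu>] \<mu> by blast
    show ?thesis
      unfolding Lp_power_def sample_power_def if_P[OF True] using K B by blast
  next
    case False
    define P where "P = enn2real p"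
    have "0 < P" unfolding P_def
      using p False by (simp add: enn2real_positive_iff less_top less_le_trans[OF zero_less_one])
    obtain K where K: "0 < K" "\<And>c. (\<integral>\<^sup>+y. ennreal (norm (full c y) powr P) \<partial>lborel) \<le>
      ennreal K * (\<Sum>\<^sub>\<infinity>x\<in>X. \<Sum>s=0..\<mu> x. ennreal (norm (sample_deriv m s (full c) x) powr P))"
      using sample_lower_bound[OF W \<open>0 < P\<close>] by blast
    obtain B where B: "0 < B" "\<And>c. (\<Sum>\<^sub>\<infinity>x\<in>X. \<Sum>s=0..\<mu> x. ennreal (norm (sample_deriv m s (full c) x) powr P)) \<le>
      ennreal B * (\<integral>\<^sup>+y. ennreal (norm (full c y) powr P) \<partial>lborel)"
      using sample_upper_bound[OF X, of \<mu> P] \<mu> \<open>0 < P\<close> by blast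
    show ?thesis
      unfolding Lp_power_def sample_power_def if_not_P[OF False] P_def[symmetric] using K B by blast
  qed
  then obtain K B where K: "0 < K" and B: "0 < B"
    and lower: "\<And>c. Lp_power p (full c) \<le> ennreal K * sample_power m p X \<mu> (full c)"
    and upper: "\<And>c. sample_power m p X \<mu> (full c) \<le> ennreal B * Lp_power p (full c)" by blast
  \<comment> \<open>The lower bound is in the form norm at most \<open>K\<close> times samples, so
    the constant required is its reciprocal.\<close>
  have "ennreal (1 / K) * Lp_power p (full c) \<le> sample_power m p X \<mu> (full c)" for c
  proof -
    have "ennreal (1 / K) * Lp_power p (full c) \<le> ennreal (1 / K) * (ennreal K * sample_power m p X \<mu> (full c))"
      by (rule mult_left_mono[OF lower]) simp
    also have "\<dots> = sample_power m p X \<mu> (full c)"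
      using K by (simp add: ennreal_mult[symmetric] flip: mult.assoc)
    finally show ?thesis .
  qed
  then show ?thesis
    unfolding sampling_set_def using K B upper
    by (intro exI[of _ "1 / K"] exI[of _ B]) (auto elim!: shift_inv_spaceE)
qed

end

theorem theorem4p2:
  fixes m :: nat and \<gamma> :: "nat \<Rightarrow> real" and r :: "nat \<Rightarrow> real \<Rightarrow> real"
    and \<phi> :: "real \<Rightarrow> real" and X :: "real set" and \<mu> :: "real \<Rightarrow> nat"
  assumes "1 \<le> m"
    and "peb_weight_data m r"
    and "peb_spline m \<gamma> r \<phi>"
    and "uniform_discrete X"
    and "\<forall>x\<in>X. \<mu> x \<le> m - 1"
    and "\<exists>(M::int) (L::int) (\<epsilon>::real). 0 < M \<and> 0 < L \<and> 0 < \<epsilon> \<and>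
      (\<forall>k::int. \<exists>(N::nat) (x :: nat \<Rightarrow> real) (\<nu> :: nat \<Rightarrow> nat).
        (\<forall>i\<in>{1..N}. \<forall>j\<in>{1..N}. i < j \<longrightarrow> x i < x j) \<and>
        (\<forall>j\<in>{1..N}. x j \<in> X \<inter> {real_of_int (M + k * L)..<real_of_int (M + k * L + L)}) \<and>
        (\<forall>j\<in>{1..N}. \<nu> j \<le> \<mu> (x j)) \<and>
        (\<Sum>j=1..N. 1 + int (\<nu> j)) = L + int m - 1 \<and>
        (\<forall>j\<in>{1..N}. x j \<in> X \<inter>
          (\<lambda>t. t + real_of_int (M + k * L + 1 + (\<Sum>n=1..j-1. 1 + int (\<nu> n)))) `
            {real (\<nu> j) - real m + \<epsilon>..-\<epsilon>}))"
  shows "\<forall>p::ennreal. 1 \<le> p \<longrightarrow> sampling_set m \<phi> p X \<mu>"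
proof -
  interpret peb m \<gamma> r \<phi> using assms(1-3) by unfold_locales
  have \<mu>: "\<mu> x < m" if "x \<in> X" for x using assms(1,5) that by (metis Suc_le_eq Suc_pred' le_imp_less_Suc less_le_trans zero_less_one)
  obtain M L :: int and \<epsilon> where "0 < L" "0 < \<epsilon>" and H: "\<And>k::int. \<exists>(N::nat) (x :: nat \<Rightarrow> real) (\<nu> :: nat \<Rightarrow> nat).
        (\<forall>i\<in>{1..N}. \<forall>j\<in>{1..N}. i < j \<longrightarrow> x i < x j) \<and>
        (\<forall>j\<in>{1..N}. x j \<in> X \<inter> {real_of_int (M + k * L)..<real_of_int (M + k * L + L)}) \<and>
        (\<forall>j\<in>{1..N}. \<nu> j \<le> \<mu> (x j)) \<and>
        (\<Sum>j=1..N. 1 + int (\<nu> j)) = L + int m - 1 \<and>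
        (\<forall>j\<in>{1..N}. x j \<in> X \<inter>
          (\<lambda>t. t + real_of_int (M + k * L + 1 + (\<Sum>n=1..j-1. 1 + int (\<nu> n)))) `
            {real (\<nu> j) - real m + \<epsilon>..-\<epsilon>})"
    using assms(6) by blast
  obtain Y C D where "windows X \<mu> M L Y C D"
    using windows_exist[of X \<mu> L \<epsilon> M] assms(4) \<mu> \<open>0 < L\<close> \<open>0 < \<epsilon>\<close> H by blast
  then show ?thesis using sampling_set_of_windows[of X \<mu>] assms(4) \<mu> by blast
qed

end
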